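(* Let $1\le p<\infty$, $0<\theta\le\infty$, $\omega\in{}^c\Omega_\theta$, $v\in\mathcal W(\mathbb{R}^n)$, and $X:={}^cLM_{p\theta,\omega}(\mathbb{R}^n,v)$. For measurable $f$ and measurable $A\subset\mathbb{R}^n$ put $N_A(f):=\big(\int_A|f|^{p'}v^{1-p'}\big)^{1/p'}$ if $p>1$, and $N_A(f):=\operatorname{ess\,sup}_A|f|v^{-1}$ if $p=1$. (i) If $0<\theta\le1$, then $\|f\|_{X'}\approx\sup_{t>0}N_{B(0,t)}(f)\,\|\omega\|_{\theta,(0,t)}^{-1}$. (ii) If $1<\theta\le\infty$, then $$\|f\|_{X'}\approx\Big(\int_{(0,\infty)}N_{B(0,t)}(f)^{\theta'}\,d\Big(\|\omega\|_{\theta,(0,t+)}^{-\theta'}\Big)\Big)^{1/\theta'}+\frac{N_{\mathbb{R}^n}(f)}{\|\omega\|_{\theta,(0,\infty)}},$$ where $\theta'=\theta/(\theta-1)$ ($\theta'=1$ if $\theta=\infty$). In both cases the constants of equivalence are independent of $f$.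
   Context: $B(0,r)$ is the open ball of radius $r$ centered at $0$, ${}^cB(0,r):=\mathbb{R}^n\setminus B(0,r)$; $p'=p/(p-1)$ for $1<p<\infty$. $\|g\|_{\theta,A}:=(\int_A|g|^\theta)^{1/\theta}$ (ess sup if $\theta=\infty$). $\mathcal W(\mathbb{R}^n)$: measurable functions positive and finite a.e. ${}^cLM_{p\theta,\omega}(\mathbb{R}^n,v)$ is the set of $f$ with $\int_{{}^cB(0,t)}|f|^pv<\infty$ for all $t>0$ and $\|f\|_X:=\big\|\omega(r)\big(\int_{{}^cB(0,r)}|f|^pv\big)^{1/p}\big\|_{\theta,(0,\infty)}<\infty$. ${}^c\Omega_\theta$: measurable $\omega\ge0$ on $(0,\infty)$ with $0<\|\omega\|_{\theta,(0,t)}<\infty$ for all $t>0$. The associate space norm is $\|f\|_{X'}:=\sup\{\int_{\mathbb{R}^n}|fg|:\|g\|_X\le1\}$. $\|\omega\|_{\theta,(0,t+)}:=\lim_{s\to t+}\|\omega\|_{\theta,(0,s)}$, and the integral $\int f\,d\varphi$ with respect to the non-increasing function $\varphi(t)=\|\omega\|_{\theta,(0,t+)}^{-\theta'}$ is defined as $-\int f\,d(-\varphi)$ (Lebesgue–Stieltjes integral). Conventions $0/0=0$, $0\cdot(\pm\infty)=0$, $1/(\pm\infty)=0$.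
   Formalization: In (ii) the integral is taken against the positive measure d(-φ), φ(t)=‖ω‖_{θ,(0,t+)}^{-θ'}; with the stated convention ∫f dφ=-∫f d(-φ) it would be nonpositive, and its 1/θ' power undefined or the equivalence false (e.g. θ=∞, ω(r)=r). *)

theory Defs
  imports "HOL-Analysis.Analysis"
begin

text \<open>Real power of an extended nonnegative real, for a positive exponent a:
  the value infinity stays infinity, otherwise the usual real power.\<close>
definition epowr :: "ennreal \<Rightarrow> real \<Rightarrow> ennreal" where
  "epowr x a = (if x = \<infinity> then \<infinity> else ennreal (enn2real x powr a))"

definition lnorm :: "ennreal \<Rightarrow> 'a measure \<Rightarrow> 'a set \<Rightarrow> ('a \<Rightarrow> ennreal) \<Rightarrow> ennreal" where
  "lnorm \<theta> M A g =
     (if \<theta> = \<infinity> then Inf {c. AE x in M. x \<in> A \<longrightarrow> g x \<le> c}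
      else epowr (\<integral>\<^sup>+ x \<in> A. epowr (g x) (enn2real \<theta>) \<partial>M) (1 / enn2real \<theta>))"

definition cOmega :: "ennreal \<Rightarrow> (real \<Rightarrow> real) set" where
  "cOmega \<theta> = {\<omega>. \<omega> \<in> borel_measurable lebesgue \<and> (\<forall>r>0. 0 \<le> \<omega> r) \<and>
      (\<forall>t>0. 0 < lnorm \<theta> lebesgue {0<..<t} (\<lambda>r. ennreal (\<omega> r)) \<and>
             lnorm \<theta> lebesgue {0<..<t} (\<lambda>r. ennreal (\<omega> r)) < \<infinity>)}"

definition Wclass :: "('a::euclidean_space \<Rightarrow> real) set" where
  "Wclass = {v. v \<in> borel_measurable lebesgue \<and> (AE x in lebesgue. 0 < v x)}"

definition cball_int :: "real \<Rightarrow> ('a::euclidean_space \<Rightarrow> real) \<Rightarrow> ('a \<Rightarrow> real) \<Rightarrow> real \<Rightarrow> ennreal" where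
  "cball_int p v f r = (\<integral>\<^sup>+ x \<in> - ball 0 r. ennreal (\<bar>f x\<bar> powr p * v x) \<partial>lebesgue)"

definition Xnorm :: "real \<Rightarrow> ennreal \<Rightarrow> (real \<Rightarrow> real) \<Rightarrow> ('a::euclidean_space \<Rightarrow> real) \<Rightarrow> ('a \<Rightarrow> real) \<Rightarrow> ennreal" where
  "Xnorm p \<theta> \<omega> v f =
     lnorm \<theta> lebesgue {0<..} (\<lambda>r. ennreal (\<omega> r) * epowr (cball_int p v f r) (1 / p))"

definition Xspace :: "real \<Rightarrow> ennreal \<Rightarrow> (real \<Rightarrow> real) \<Rightarrow> ('a::euclidean_space \<Rightarrow> real) \<Rightarrow> ('a \<Rightarrow> real) set" where
  "Xspace p \<theta> \<omega> v = {f. f \<in> borel_measurable lebesgue \<and>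
      (\<forall>t>0. cball_int p v f t < \<infinity>) \<and> Xnorm p \<theta> \<omega> v f < \<infinity>}"

definition assoc_norm :: "real \<Rightarrow> ennreal \<Rightarrow> (real \<Rightarrow> real) \<Rightarrow> ('a::euclidean_space \<Rightarrow> real) \<Rightarrow> ('a \<Rightarrow> real) \<Rightarrow> ennreal" where
  "assoc_norm p \<theta> \<omega> v f =
     (SUP g \<in> {g \<in> Xspace p \<theta> \<omega> v. Xnorm p \<theta> \<omega> v g \<le> 1}. \<integral>\<^sup>+ x. ennreal \<bar>f x * g x\<bar> \<partial>lebesgue)"

definition Nfun :: "real \<Rightarrow> ('a::euclidean_space \<Rightarrow> real) \<Rightarrow> 'a set \<Rightarrow> ('a \<Rightarrow> real) \<Rightarrow> ennreal" where
  "Nfun p v A f =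
     (if p = 1 then Inf {c. AE x in lebesgue. x \<in> A \<longrightarrow> ennreal (\<bar>f x\<bar> * inverse (v x)) \<le> c}
      else (let p' = p / (p - 1) in
            epowr (\<integral>\<^sup>+ x \<in> A. ennreal (\<bar>f x\<bar> powr p' * v x powr (1 - p')) \<partial>lebesgue) (1 / p')))"

definition conj_exp :: "ennreal \<Rightarrow> real" where
  "conj_exp \<theta> = (if \<theta> = \<infinity> then 1 else enn2real \<theta> / (enn2real \<theta> - 1))"

definition omega_norm_plus :: "ennreal \<Rightarrow> (real \<Rightarrow> real) \<Rightarrow> real \<Rightarrow> ennreal" where
  "omega_norm_plus \<theta> \<omega> t = Lim (at_right t) (\<lambda>s. lnorm \<theta> lebesgue {0<..<s} (\<lambda>r. ennreal (\<omega> r)))"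

text \<open>Lebesgue--Stieltjes integral over \<open>(0,\<infinity>)\<close> of a nonnegative h with respect to the
  nonnegative measure \<open>d(-\<phi>)\<close>, \<open>\<phi>\<close> non-increasing and right-continuous on \<open>(0,\<infinity>)\<close>
  (possibly unbounded near 0): the monotone limit of the integrals over \<open>(\<epsilon>,\<infinity>)\<close>,
  where on \<open>(\<epsilon>,\<infinity>)\<close> the measure \<open>d(-\<phi>)\<close> is the interval measure of \<open>t \<mapsto> -\<phi>(max t \<epsilon>)\<close>.\<close>
definition LS_neg_integral :: "(real \<Rightarrow> real) \<Rightarrow> (real \<Rightarrow> ennreal) \<Rightarrow> ennreal" where
  "LS_neg_integral \<phi> h =
     (SUP \<epsilon> \<in> {0<..}. \<integral>\<^sup>+ t \<in> {\<epsilon><..}. h t \<partial>(interval_measure (\<lambda>t. - \<phi> (max t \<epsilon>))))"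

end

theory Submission
  imports Defs
begin

text \<open>Write \<open>W(t)\<close> for the norm of \<open>\<omega>\<close> over \<open>(0,t)\<close>, \<open>\<Phi>(s)\<close> for the norm \<open>N\<close> of \<open>f\<close> over
  \<open>{W(|x|) \<le> s}\<close> and \<open>G(s)\<close> for the weighted \<open>L\<^sup>p\<close> norm of the test function \<open>h\<close> over
  \<open>{W(|x|) > s}\<close>. Averaging Hoelder's inequality over bands gives
  \<open>\<integral>|fh| \<le> 2 \<integral> \<Phi>(s) G(s/2) ds/s\<close>. By a layer-cake comparison, \<open>\<integral> G(s/2)\<^sup>\<theta> d(s\<^sup>\<theta>)\<close> is
  bounded by the \<open>\<theta>\<close>-th power of the norm of \<open>h\<close> in \<open>X\<close>, so for \<open>\<theta> \<le> 1\<close> monotonicity of \<open>G\<close>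
  and for \<open>\<theta> > 1\<close> another use of Hoelder's inequality give the upper bounds, because \<open>W\<close>
  transports \<open>d(-\<phi>)\<close> to \<open>\<theta>' s\<^sup>-\<^sup>\<theta>\<^sup>'\<^sup>-\<^sup>1 ds\<close>. Conversely, finite sums of near-extremal functions for
  \<open>\<Phi>(2\<^sup>k)\<close>, whose norm in \<open>X\<close> is controlled by a dyadic Hardy inequality, give the lower bounds.\<close>

section \<open>Powers of extended nonnegative reals, Hoelder's inequality, layer cake\<close>

text \<open>The obstacle is that \<open>W\<close> may jump (when \<theta> is infinite), stay
  constant on intervals and be bounded, so radii at which \<open>W\<close> takes prescribed values
  2^k need not exist. Every quantity is therefore indexed by a level s of \<open>W\<close> instead
  of a radius. For \<theta> > 1 the integral \<open>J\<close> of \<Phi>(s)^\<theta>' against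
  \<theta>' s^(-\<theta>'-1) ds over all levels carries both terms of (ii): levels between values of
  \<open>W\<close> give the Stieltjes integral, a jump of \<open>W\<close> being a whole interval of
  levels with the same ball, and levels above the total norm l of \<omega> see all of R^n, where the
  density integrates over [l, \<infinity>) to l^(-\<theta>'). The sets {W(|x|) \<le> s} are balls
  only up to a sphere, whence the many almost-everywhere arguments. The constants stay explicit: a
  factor 2 from the width of a band, another from the shift to s/2, 1/\<theta> from an embedding for
  decreasing functions when \<theta> \<le> 1, and a Hardy constant in \<open>K\<close>.\<close>

lemma epowr_zero [simp]: "epowr 0 a = 0"
  by (simp add: epowr_def)

lemma epowr_top [simp]: "epowr \<infinity> a = \<infinity>" "epowr top a = top"
  by (auto simp: epowr_def)

lemma epowr_ennreal: "0 \<le> x \<Longrightarrow> epowr (ennreal x) a = ennreal (x powr a)"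
  by (simp add: epowr_def)

lemma epowr_one [simp]: "epowr x 1 = x"
  by (cases x) (auto simp: epowr_ennreal)

lemma epowr_mono: "0 \<le> a \<Longrightarrow> x \<le> y \<Longrightarrow> epowr x a \<le> epowr y a"
  by (cases x; cases y)
    (auto simp: epowr_ennreal top_unique intro!: ennreal_leI powr_mono2)

lemma epowr_epowr: "epowr (epowr x a) b = epowr x (a * b)"
  by (cases x) (auto simp: epowr_ennreal powr_powr)

text \<open>Holds for every real a, because \<open>epowr\<close> keeps 0 and top fixed whatever the
  exponent. Zero factors are split off since the product of 0 and top is 0.\<close>

lemma epowr_mult: "epowr (x * y) a = epowr x a * epowr y a"
proof (cases "x = 0 \<or> y = 0")
  case False
  show ?thesis
  proof (cases x; cases y)
    fix r s assume "x = ennreal r" "0 \<le> r" "y = ennreal s" "0 \<le> s"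
    thus ?thesis
      by (simp add: epowr_ennreal powr_mult flip: ennreal_mult)
  next
    fix r assume "x = ennreal r" "0 \<le> r" "y = top"
    thus ?thesis using False
      by (simp add: epowr_ennreal ennreal_mult_top)
  next
    fix r assume "y = ennreal r" "0 \<le> r" "x = top"
    thus ?thesis using False
      by (simp add: epowr_ennreal ennreal_top_mult)
  qed auto
qed auto

lemma epowr_le_iff: "0 < a \<Longrightarrow> epowr x a \<le> epowr y a \<longleftrightarrow> x \<le> y"
proof
  assume a: "0 < a" and "epowr x a \<le> epowr y a"
  then have "epowr (epowr x a) (1 / a) \<le> epowr (epowr y a) (1 / a)"
    by (intro epowr_mono[of "1 / a"]) auto
  with a show "x \<le> y" by (simp add: epowr_epowr)
qed (simp add: epowr_mono)

lemma epowr_less_iff: "0 < a \<Longrightarrow> epowr x a < epowr y a \<longleftrightarrow> x < y"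
  using epowr_le_iff[of a y x] by (simp add: not_le[symmetric])

lemma epowr_le_iff': "0 < a \<Longrightarrow> epowr x a \<le> y \<longleftrightarrow> x \<le> epowr y (1 / a)"
  using epowr_le_iff[of a x "epowr y (1 / a)"] by (simp add: epowr_epowr)

lemma epowr_eq_0_iff [simp]: "epowr x a = 0 \<longleftrightarrow> x = 0"
  by (cases x) (auto simp: epowr_ennreal)

lemma epowr_eq_top_iff [simp]: "epowr x a = top \<longleftrightarrow> x = top"
  by (cases x) (auto simp: epowr_ennreal)

lemma epowr_less_top_iff [simp]: "epowr x a < top \<longleftrightarrow> x < top"
  using epowr_eq_top_iff[of x a] by (metis less_top)

lemma epowr_add: "epowr x (a + b) = epowr x a * epowr x b"
  by (cases x) (auto simp: epowr_ennreal powr_add simp flip: ennreal_mult)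

lemma epowr_one_left [simp]: "epowr 1 a = 1"
  using epowr_ennreal[of 1 a] by simp

text \<open>Division by x + y reduces the claim to t \<le> t powr a for t in [0,1]. With a the
  reciprocal of the conjugate exponent it splits the root of a sum into the two terms of
  (ii).\<close>

lemma epowr_subadditive:
  assumes "0 < a" "a \<le> 1"
  shows "epowr (x + y) a \<le> epowr x a + epowr y a"
proof (cases "x + y = 0 \<or> x + y = \<infinity>")
  case True
  then show ?thesis by (auto simp: ennreal_add_eq_top)
next
  case False
  then obtain r s where rs: "x = ennreal r" "0 \<le> r" "y = ennreal s" "0 \<le> s"
    by (cases x; cases y) auto
  with False have pos: "0 < r + s" by (metis add_nonneg_nonneg ennreal_0 ennreal_plus order_le_less)
  have le: "u / (r + s) \<le> (u / (r + s)) powr a" if "0 \<le> u" "u \<le> r + s" for u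
    using powr_mono'[of a 1 "u / (r + s)"] that pos assms by simp
  have "1 = r / (r + s) + s / (r + s)" using pos by (simp flip: add_divide_distrib)
  also have "\<dots> \<le> (r / (r + s)) powr a + (s / (r + s)) powr a"
    using le[of r] le[of s] rs by auto
  also have "\<dots> = (r powr a + s powr a) / (r + s) powr a"
    using rs pos by (simp add: powr_divide add_divide_distrib)
  finally have "(r + s) powr a \<le> r powr a + s powr a"
    using pos by (simp add: field_simps)
  with rs show ?thesis by (simp add: epowr_ennreal flip: ennreal_plus)
qed

lemma borel_measurable_epowr [measurable (raw)]:
  assumes [measurable]: "f \<in> borel_measurable M"
  shows "(\<lambda>x. epowr (f x) a) \<in> borel_measurable M"
  unfolding epowr_def by measurable

lemma ennreal_Young:
  fixes x y :: ennreal
  assumes "1 < p" "1 < q" "1 / p + 1 / q = 1"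
  shows "x * y \<le> ennreal (1 / p) * epowr x p + ennreal (1 / q) * epowr y q"
proof (cases "x = \<infinity> \<or> y = \<infinity>")
  case True
  then show ?thesis using assms by (auto simp: ennreal_mult_top)
next
  case False
  then obtain r s where rs: "x = ennreal r" "0 \<le> r" "y = ennreal s" "0 \<le> s"
    by (cases x; cases y) auto
  have "r * s \<le> 1 / p * r powr p + 1 / q * s powr q"
    using Youngs_inequality[OF assms rs(2,4)] by simp
  then have "ennreal (r * s) \<le> ennreal (1 / p * r powr p + 1 / q * s powr q)"
    by (rule ennreal_leI)
  also have "\<dots> = ennreal (1 / p) * epowr x p + ennreal (1 / q) * epowr y q"
    using assms unfolding rs by (simp add: rs epowr_ennreal del: times_divide_eq_left flip: ennreal_mult)
  finally show ?thesis using rs by (simp add: ennreal_mult)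
qed

text \<open>Young's inequality for f and g divided by their norms, integrated. Norms equal to 0 or
  infinity cannot be normalised and are treated first.\<close>

lemma nn_integral_Holder:
  assumes pq: "1 < p" "1 < q" "1 / p + 1 / q = 1"
    and [measurable]: "f \<in> borel_measurable M" "g \<in> borel_measurable M"
  shows "(\<integral>\<^sup>+x. f x * g x \<partial>M)
    \<le> epowr (\<integral>\<^sup>+x. epowr (f x) p \<partial>M) (1 / p) * epowr (\<integral>\<^sup>+x. epowr (g x) q \<partial>M) (1 / q)"
    (is "_ \<le> epowr ?F _ * epowr ?G _")
proof -
  consider "?F = 0" | "?G = 0" | "?F \<noteq> 0" "?G \<noteq> 0" "?F = \<infinity> \<or> ?G = \<infinity>"
    | "?F \<noteq> 0" "?G \<noteq> 0" "?F < \<infinity>" "?G < \<infinity>"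
    by (metis infinity_ennreal_def less_top)
  then show ?thesis
  proof cases
    case 1
    then have "AE x in M. f x = 0" by (simp add: nn_integral_0_iff_AE)
    then have "(\<integral>\<^sup>+x. f x * g x \<partial>M) = 0" by (subst nn_integral_0_iff_AE) auto
    then show ?thesis by simp
  next
    case 2
    then have "AE x in M. g x = 0" by (simp add: nn_integral_0_iff_AE)
    then have "(\<integral>\<^sup>+x. f x * g x \<partial>M) = 0" by (subst nn_integral_0_iff_AE) auto
    then show ?thesis by simp
  next
    case 3
    then have "epowr ?F (1 / p) * epowr ?G (1 / q) = \<infinity>"
      by (auto simp: ennreal_mult_eq_top_iff)
    then show ?thesis by simp
  next
    case 4
    define a where "a = enn2real (epowr ?F (1 / p))"
    define b where "b = enn2real (epowr ?G (1 / q))"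
    have a: "epowr ?F (1 / p) = ennreal a" "0 < a"
      using 4 unfolding a_def by (auto simp: enn2real_positive_iff zero_less_iff_neq_zero)
    have b: "epowr ?G (1 / q) = ennreal b" "0 < b"
      using 4 unfolding b_def by (auto simp: enn2real_positive_iff zero_less_iff_neq_zero)
    have F: "?F = ennreal (a powr p)"
    proof -
      have "?F = epowr (epowr ?F (1 / p)) p" using pq by (simp add: epowr_epowr)
      then show ?thesis using a by (simp add: epowr_ennreal)
    qed
    have G: "?G = ennreal (b powr q)"
    proof -
      have "?G = epowr (epowr ?G (1 / q)) q" using pq by (simp add: epowr_epowr)
      then show ?thesis using b by (simp add: epowr_ennreal)
    qed
    have "(\<integral>\<^sup>+x. f x * g x \<partial>M)
      = (\<integral>\<^sup>+x. ennreal (a * b) * ((ennreal (1 / a) * f x) * (ennreal (1 / b) * g x)) \<partial>M)"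
    proof (intro nn_integral_cong)
      fix x
      have "ennreal (a * b) * ennreal (1 / a) * ennreal (1 / b) = 1"
        using a b by (simp add: flip: ennreal_mult)
      then show "f x * g x = ennreal (a * b) * ((ennreal (1 / a) * f x) * (ennreal (1 / b) * g x))"
        by (metis (no_types, lifting) mult.assoc mult.commute mult_1)
    qed
    also have "\<dots> = ennreal (a * b) * (\<integral>\<^sup>+x. (ennreal (1 / a) * f x) * (ennreal (1 / b) * g x) \<partial>M)"
      by (intro nn_integral_cmult) measurable
    also have "\<dots> \<le> ennreal (a * b) * (\<integral>\<^sup>+x. ennreal (1 / p) * epowr (ennreal (1 / a) * f x) p
        + ennreal (1 / q) * epowr (ennreal (1 / b) * g x) q \<partial>M)"
      by (intro mult_left_mono nn_integral_mono ennreal_Young pq) auto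
    also have "(\<integral>\<^sup>+x. ennreal (1 / p) * epowr (ennreal (1 / a) * f x) p
        + ennreal (1 / q) * epowr (ennreal (1 / b) * g x) q \<partial>M)
      = ennreal (1 / p) * (ennreal ((1 / a) powr p) * ?F) + ennreal (1 / q) * (ennreal ((1 / b) powr q) * ?G)"
      using a b by (simp add: nn_integral_add nn_integral_cmult epowr_mult epowr_ennreal)
    also have "ennreal ((1 / a) powr p) * ?F = 1"
      using a unfolding F by (simp add: powr_divide flip: ennreal_mult)
    also have "ennreal ((1 / b) powr q) * ?G = 1"
      using b unfolding G by (simp add: powr_divide flip: ennreal_mult)
    also have "ennreal (1 / p) * 1 + ennreal (1 / q) * 1 = 1"
      using pq by (simp flip: ennreal_plus)
    finally show ?thesis using a b by (simp add: ennreal_mult)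
  qed
qed

section \<open>Sigma-finiteness, monotone functions and the layer-cake formula\<close>

lemma sigma_finite_lebesgue: "sigma_finite_measure (lebesgue :: 'a::euclidean_space measure)"
proof
  show "\<exists>A::'a set set. countable A \<and> A \<subseteq> sets lebesgue \<and> \<Union>A = space lebesgue \<and>
      (\<forall>a\<in>A. emeasure lebesgue a \<noteq> \<infinity>)"
  proof (intro exI conjI ballI)
    show "countable (range (\<lambda>n::nat. ball (0::'a) (real n)))" by simp
    show "(\<Union>n::nat. ball (0::'a) (real n)) = space lebesgue"
      by (auto simp: reals_Archimedean2)
    fix a :: "'a set"
    assume "a \<in> range (\<lambda>n::nat. ball 0 (real n))"
    then show "emeasure lebesgue a \<noteq> \<infinity>"
      using emeasure_bounded_finite[of a] by auto
  qed auto
qed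

interpretation lebesgue: sigma_finite_measure "lebesgue :: 'a::euclidean_space measure"
  by (rule sigma_finite_lebesgue)

text \<open>Such a set is an interval. This makes every function that is monotone in the level or in
  the radius Borel measurable without any continuity.\<close>

lemma up_closed_borel:
  fixes U :: "real set"
  assumes "\<And>x y. x \<in> U \<Longrightarrow> x \<le> y \<Longrightarrow> y \<in> U"
  shows "U \<in> sets borel"
proof -
  have "is_interval U"
    unfolding is_interval_1 using assms by blast
  then show ?thesis
    using is_interval_convex real_interval_borel_measurable by blast
qed

lemma borel_measurable_mono_ennreal:
  fixes f :: "real \<Rightarrow> ennreal"
  assumes "mono f"
  shows "f \<in> borel_measurable borel"
proof (rule borel_measurableI_greater)
  fix y show "{x \<in> space borel. y < f x} \<in> sets borel"
    by (rule up_closed_borel) (use assms in \<open>auto dest: monoD intro: less_le_trans\<close>)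
qed

lemma borel_measurable_antimono_ennreal:
  fixes f :: "real \<Rightarrow> ennreal"
  assumes "antimono f"
  shows "f \<in> borel_measurable borel"
proof (rule borel_measurableI_less)
  fix y show "{x \<in> space borel. f x < y} \<in> sets borel"
    by (rule up_closed_borel) (use assms in \<open>auto dest: antimonoD intro: le_less_trans\<close>)
qed

text \<open>F x is the length of the set of u with 0 < u < F x, and Tonelli's theorem exchanges the
  order. Keeping the weight w inside lets integrals over different measure spaces be compared
  through the weighted measures of superlevel sets alone.\<close>

lemma nn_integral_layer_cake:
  fixes F w :: "'a \<Rightarrow> ennreal"
  assumes "sigma_finite_measure M"
    and [measurable]: "F \<in> borel_measurable M" "w \<in> borel_measurable M"
  shows "(\<integral>\<^sup>+x. w x * F x \<partial>M)
    = (\<integral>\<^sup>+u\<in>{0<..}. (\<integral>\<^sup>+x. w x * indicator {x. ennreal u < F x} x \<partial>M) \<partial>lborel)"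
proof -
  interpret sigma_finite_measure M by fact
  interpret P: pair_sigma_finite M lborel ..
  have F: "F x = (\<integral>\<^sup>+u. indicator {0<..} u * indicator {x. ennreal u < F x} x \<partial>lborel)" for x
  proof -
    have "(\<integral>\<^sup>+u. indicator {0<..} u * indicator {x. ennreal u < F x} x \<partial>lborel)
      = emeasure lborel {u. 0 < u \<and> ennreal u < F x}"
      by (subst nn_integral_indicator[of "{u. 0 < u \<and> ennreal u < F x}" lborel, symmetric])
        (auto intro!: nn_integral_cong simp: indicator_def simp del: nn_integral_indicator)
    also have "\<dots> = F x"
    proof (cases "F x")
      case (real r)
      then have "{u. 0 < u \<and> ennreal u < F x} = {0<..<r}"
        by (auto simp: ennreal_less_iff)
      with real show ?thesis by simp
    next
      case top
      then have "{u. 0 < u \<and> ennreal u < F x} = {0<..}" by auto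
      moreover have "of_nat n \<le> emeasure lborel {0::real<..}" for n
        using emeasure_mono[of "{0<..real n}" "{0<..}" lborel]
        by (auto simp: ennreal_of_nat_eq_real_of_nat subset_eq)
      then have "emeasure lborel {0::real<..} = top"
        using ennreal_Ex_less_of_nat[of "emeasure lborel {0::real<..}"] by (metis leD less_top)
      ultimately show ?thesis using top by simp
    qed
    finally show ?thesis by simp
  qed
  have "(\<integral>\<^sup>+x. w x * F x \<partial>M)
     = (\<integral>\<^sup>+x. (\<integral>\<^sup>+u. w x * (indicator {0<..} u * indicator {x. ennreal u < F x} x) \<partial>lborel) \<partial>M)"
    by (subst F) (simp add: nn_integral_cmult)
  also have "\<dots> = (\<integral>\<^sup>+u. (\<integral>\<^sup>+x. w x * (indicator {0<..} u * indicator {x. ennreal u < F x} x) \<partial>M) \<partial>lborel)"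
    by (rule P.Fubini'[symmetric]) (simp add: indicator_def)
  also have "\<dots> = (\<integral>\<^sup>+u\<in>{0<..}. (\<integral>\<^sup>+x. w x * indicator {x. ennreal u < F x} x \<partial>M) \<partial>lborel)"
    by (intro nn_integral_cong) (auto simp: indicator_def)
  finally show ?thesis .
qed

section \<open>Weighted norms on sets: Hoelder duality\<close>

text \<open>The infimum ranges over an uncountable set, but a sequence realises it, so countably
  many null sets suffice: the essential supremum is itself an essential bound.\<close>

lemma AE_le_Inf_AE:
  fixes g :: "'a \<Rightarrow> ennreal"
  shows "AE x in M. x \<in> A \<longrightarrow> g x \<le> Inf {c. AE x in M. x \<in> A \<longrightarrow> g x \<le> c}"
proof -
  let ?S = "{c. AE x in M. x \<in> A \<longrightarrow> g x \<le> c}"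
  have "top \<in> ?S" by simp
  then obtain u where u: "range u \<subseteq> ?S" "Inf ?S = (INF i::nat. u i)"
    using ennreal_Inf_countable_INF[of ?S] by blast
  have "AE x in M. \<forall>i. x \<in> A \<longrightarrow> g x \<le> u i"
    unfolding AE_all_countable using u(1) by auto
  then show ?thesis unfolding u(2) by eventually_elim (auto intro: INF_greatest)
qed

text \<open>Inclusion up to a null set is the form used later, because level sets of W(|x|) are
  balls only up to a sphere.\<close>

lemma Nfun_mono_AE:
  assumes "1 \<le> p" "AE x in lebesgue. x \<in> A \<longrightarrow> x \<in> B"
  shows "Nfun p v A f \<le> Nfun p v B f"
proof (cases "p = 1")
  case True
  show ?thesis unfolding Nfun_def using True
    by (auto intro!: Inf_superset_mono elim!: eventually_elim2[OF assms(2)])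
next
  case False
  have "(\<integral>\<^sup>+x\<in>A. k x \<partial>lebesgue) \<le> (\<integral>\<^sup>+x\<in>B. k x \<partial>lebesgue)" for k :: "_ \<Rightarrow> ennreal"
    using assms(2) by (intro nn_integral_mono_AE) (auto elim!: eventually_mono simp: indicator_def)
  with False assms(1) show ?thesis
    unfolding Nfun_def Let_def by (auto intro!: epowr_mono)
qed

lemma set_nn_integral_UN_le:
  fixes A :: "nat \<Rightarrow> 'a set" and k :: "'a \<Rightarrow> ennreal"
  assumes "incseq A" and [measurable]: "\<And>i. A i \<in> sets M" "k \<in> borel_measurable M"
    and le: "\<And>i. (\<integral>\<^sup>+x\<in>A i. k x \<partial>M) \<le> c"
  shows "(\<integral>\<^sup>+x\<in>(\<Union>i. A i). k x \<partial>M) \<le> c"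
proof -
  have "k x * indicator (\<Union>i. A i) x = (SUP i. k x * indicator (A i) x)" for x
  proof (cases "x \<in> (\<Union>i. A i)")
    case True
    then obtain i where "x \<in> A i" by auto
    then show ?thesis
      by (intro antisym SUP_upper2[of i] SUP_least) (auto simp: indicator_def)
  next
    case False
    then show ?thesis by simp
  qed
  then have "(\<integral>\<^sup>+x\<in>(\<Union>i. A i). k x \<partial>M) = (\<integral>\<^sup>+x. (SUP i. k x * indicator (A i) x) \<partial>M)"
    by simp
  also have "\<dots> = (SUP i. \<integral>\<^sup>+x\<in>A i. k x \<partial>M)"
    using \<open>incseq A\<close>
    by (intro nn_integral_monotone_convergence_SUP)
      (auto simp: incseq_def le_fun_def indicator_def)
  also have "\<dots> \<le> c" using le by (auto intro: SUP_least)
  finally show ?thesis .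
qed

text \<open>The Fatou property of the norm: monotone convergence for p > 1, a countable union of
  null sets for p = 1. It reduces bounds over level sets to bounds over balls that exhaust
  them.\<close>

lemma Nfun_UN_le:
  fixes A :: "nat \<Rightarrow> 'a::euclidean_space set"
  assumes p: "1 \<le> p" and "incseq A" and [measurable]: "\<And>i. A i \<in> sets lebesgue"
    "f \<in> borel_measurable lebesgue" "v \<in> borel_measurable lebesgue"
    and le: "\<And>i. Nfun p v (A i) f \<le> c"
  shows "Nfun p v (\<Union>i. A i) f \<le> c"
proof (cases "p = 1")
  case True
  have "AE x in lebesgue. x \<in> A i \<longrightarrow> ennreal (\<bar>f x\<bar> * inverse (v x)) \<le> c" for i
    using AE_le_Inf_AE[where M = lebesgue and A = "A i" and g = "\<lambda>x. ennreal (\<bar>f x\<bar> * inverse (v x))"]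
      le[of i] True
    by (auto simp: Nfun_def elim!: eventually_mono)
  then have "AE x in lebesgue. \<forall>i. x \<in> A i \<longrightarrow> ennreal (\<bar>f x\<bar> * inverse (v x)) \<le> c"
    unfolding AE_all_countable by blast
  then have "AE x in lebesgue. x \<in> (\<Union>i. A i) \<longrightarrow> ennreal (\<bar>f x\<bar> * inverse (v x)) \<le> c"
    by eventually_elim auto
  with True show ?thesis by (auto simp: Nfun_def intro: Inf_lower)
next
  case False
  then have "0 < 1 / (p / (p - 1))" using p by simp
  with le show ?thesis
    unfolding Nfun_def Let_def using False
    by (auto simp: epowr_le_iff' intro!: set_nn_integral_UN_le[OF \<open>incseq A\<close>])
qed

text \<open>Extends \<open>cball_int\<close> from complements of balls to arbitrary sets, since
  complements of level sets of W(|x|) occur as well.\<close>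

definition Mint :: "real \<Rightarrow> ('a::euclidean_space \<Rightarrow> real) \<Rightarrow> 'a set \<Rightarrow> ('a \<Rightarrow> real) \<Rightarrow> ennreal" where
  "Mint p v A h = (\<integral>\<^sup>+x\<in>A. ennreal (\<bar>h x\<bar> powr p * v x) \<partial>lebesgue)"

lemma Mint_mono: "A \<subseteq> B \<Longrightarrow> Mint p v A h \<le> Mint p v B h"
  unfolding Mint_def by (intro nn_integral_mono) (auto simp: indicator_def)

text \<open>The product of v^(-1/p) and v^(1/p) is inserted, which is 1 wherever v > 0, that is
  almost everywhere. As -p'/p = 1 - p', the first factor produces N. For p = 1 the quotient |f|/v is
  replaced by its essential bound.\<close>

lemma Holder_Nfun:
  fixes f h v :: "'a::euclidean_space \<Rightarrow> real"
  assumes p: "1 \<le> p" and v: "v \<in> Wclass"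
    and [measurable]: "A \<in> sets lebesgue" "f \<in> borel_measurable lebesgue" "h \<in> borel_measurable lebesgue"
  shows "(\<integral>\<^sup>+x\<in>A. ennreal \<bar>f x * h x\<bar> \<partial>lebesgue) \<le> Nfun p v A f * epowr (Mint p v A h) (1 / p)"
proof -
  have [measurable]: "v \<in> borel_measurable lebesgue" and pos: "AE x in lebesgue. 0 < v x"
    using v by (auto simp: Wclass_def)
  show ?thesis
  proof (cases "p = 1")
    case True
    let ?N = "Nfun 1 v A f"
    have "AE x in lebesgue. x \<in> A \<longrightarrow> ennreal (\<bar>f x\<bar> * inverse (v x)) \<le> ?N"
      using AE_le_Inf_AE[where M = lebesgue and A = A and g = "\<lambda>x. ennreal (\<bar>f x\<bar> * inverse (v x))"]
      by (simp add: Nfun_def)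
    with pos have "AE x in lebesgue. ennreal \<bar>f x * h x\<bar> * indicator A x
      \<le> ?N * (ennreal (\<bar>h x\<bar> powr 1 * v x) * indicator A x)"
    proof eventually_elim
      fix x assume x: "0 < v x" "x \<in> A \<longrightarrow> ennreal (\<bar>f x\<bar> * inverse (v x)) \<le> ?N"
      then have "ennreal \<bar>f x * h x\<bar> = ennreal (\<bar>f x\<bar> * inverse (v x)) * ennreal (\<bar>h x\<bar> * v x)"
        by (simp add: abs_mult flip: ennreal_mult)
      with x show "ennreal \<bar>f x * h x\<bar> * indicator A x
          \<le> ?N * (ennreal (\<bar>h x\<bar> powr 1 * v x) * indicator A x)"
        by (auto simp: indicator_def intro!: mult_right_mono)
    qed
    then have "(\<integral>\<^sup>+x\<in>A. ennreal \<bar>f x * h x\<bar> \<partial>lebesgue)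
        \<le> (\<integral>\<^sup>+x. ?N * (ennreal (\<bar>h x\<bar> powr 1 * v x) * indicator A x) \<partial>lebesgue)"
      by (rule nn_integral_mono_AE)
    also have "\<dots> = ?N * Mint 1 v A h"
      unfolding Mint_def by (rule nn_integral_cmult) measurable
    finally show ?thesis using True by simp
  next
    case False
    define q where "q = p / (p - 1)"
    have q: "1 < p" "1 < q" "1 / q + 1 / p = 1"
      using p False unfolding q_def by (auto simp: field_simps)
    let ?F = "\<lambda>x. ennreal (\<bar>f x\<bar> * v x powr (- (1 / p))) * indicator A x"
    let ?H = "\<lambda>x. ennreal (\<bar>h x\<bar> * v x powr (1 / p)) * indicator A x"
    have "(\<integral>\<^sup>+x\<in>A. ennreal \<bar>f x * h x\<bar> \<partial>lebesgue) = (\<integral>\<^sup>+x. ?F x * ?H x \<partial>lebesgue)"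
    proof (intro nn_integral_cong_AE, use pos in eventually_elim)
      fix x assume "0 < v x"
      then have "\<bar>f x\<bar> * v x powr (- (1 / p)) * (\<bar>h x\<bar> * v x powr (1 / p)) = \<bar>f x * h x\<bar>"
        by (simp add: abs_mult powr_minus field_simps)
      then show "ennreal \<bar>f x * h x\<bar> * indicator A x = ?F x * ?H x"
        by (auto simp: indicator_def simp flip: ennreal_mult)
    qed
    also have "\<dots> \<le> epowr (\<integral>\<^sup>+x. epowr (?F x) q \<partial>lebesgue) (1 / q)
        * epowr (\<integral>\<^sup>+x. epowr (?H x) p \<partial>lebesgue) (1 / p)"
      by (rule nn_integral_Holder) (use q in auto)
    also have "(\<integral>\<^sup>+x. epowr (?F x) q \<partial>lebesgue)
        = (\<integral>\<^sup>+x\<in>A. ennreal (\<bar>f x\<bar> powr q * v x powr (1 - q)) \<partial>lebesgue)"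
    proof (intro nn_integral_cong_AE, use pos in eventually_elim)
      fix x assume "0 < v x"
      moreover have "- (1 / p) * q = 1 - q" using q unfolding q_def by (simp add: field_simps)
      ultimately have "(\<bar>f x\<bar> * v x powr (- (1 / p))) powr q = \<bar>f x\<bar> powr q * v x powr (1 - q)"
        by (simp add: powr_mult powr_powr)
      then show "epowr (?F x) q = ennreal (\<bar>f x\<bar> powr q * v x powr (1 - q)) * indicator A x"
        by (auto simp: indicator_def epowr_ennreal)
    qed
    also have "(\<integral>\<^sup>+x. epowr (?H x) p \<partial>lebesgue) = Mint p v A h"
      unfolding Mint_def
    proof (intro nn_integral_cong_AE, use pos in eventually_elim)
      fix x assume "0 < v x"
      then have "(\<bar>h x\<bar> * v x powr (1 / p)) powr p = \<bar>h x\<bar> powr p * v x"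
        using p by (simp add: powr_mult powr_powr)
      then show "epowr (?H x) p = ennreal (\<bar>h x\<bar> powr p * v x) * indicator A x"
        by (auto simp: indicator_def epowr_ennreal)
    qed
    finally show ?thesis using False by (simp add: Nfun_def Let_def q_def)
  qed
qed

text \<open>Restricting to a ball and to k \<le> n makes the integral finite while it stays above c.
  Normalising an extremal function requires such a finite integral.\<close>

lemma finite_positive_truncation:
  fixes k :: "'a::euclidean_space \<Rightarrow> real"
  assumes [measurable]: "A \<in> sets lebesgue" "k \<in> borel_measurable lebesgue"
    and less: "c < (\<integral>\<^sup>+x\<in>A. ennreal (k x) \<partial>lebesgue)"
  obtains B where "B \<in> sets lebesgue" "B \<subseteq> A"
    "c < (\<integral>\<^sup>+x\<in>B. ennreal (k x) \<partial>lebesgue)" "(\<integral>\<^sup>+x\<in>B. ennreal (k x) \<partial>lebesgue) < \<infinity>"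
proof -
  define B where "B n = {x \<in> A. k x \<le> real n} \<inter> ball 0 (real n)" for n
  have B [measurable]: "B n \<in> sets lebesgue" for n
    unfolding B_def by (intro sets.Int) (measurable, simp)
  have "incseq B" by (auto simp: incseq_def B_def)
  have "(\<Union>n. B n) = A"
  proof (intro equalityI subsetI)
    fix x assume "x \<in> A"
    obtain n where "max (k x) (norm x) < real n" using reals_Archimedean2 by blast
    with \<open>x \<in> A\<close> show "x \<in> (\<Union>n. B n)" by (auto simp: B_def intro!: exI[of _ n])
  qed (auto simp: B_def)
  then have "\<not> (\<forall>n. (\<integral>\<^sup>+x\<in>B n. ennreal (k x) \<partial>lebesgue) \<le> c)"
    using set_nn_integral_UN_le[OF \<open>incseq B\<close> B, of "\<lambda>x. ennreal (k x)" c] less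
    by (metis assms(2) leD measurable_compose measurable_ennreal)
  then obtain n where n: "c < (\<integral>\<^sup>+x\<in>B n. ennreal (k x) \<partial>lebesgue)" unfolding not_all not_le by blast
  have "(\<integral>\<^sup>+x\<in>B n. ennreal (k x) \<partial>lebesgue) \<le> (\<integral>\<^sup>+x\<in>ball (0::'a) (real n). ennreal (real n) \<partial>lebesgue)"
    by (intro nn_integral_mono) (auto simp: B_def indicator_def intro!: ennreal_leI)
  also have "\<dots> = ennreal (real n) * emeasure lebesgue (ball (0::'a) (real n))"
    by (rule nn_integral_cmult_indicator) simp
  also have "\<dots> < \<infinity>"
    using emeasure_bounded_finite[of "ball (0::'a) (real n)"] by (simp add: ennreal_mult_less_top)
  finally show ?thesis using that[OF B _ n] \<open>(\<Union>n. B n) = A\<close> by blast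
qed

text \<open>The converse of Hoelder's inequality. The strict bound by a leaves room for truncation
  to a set of finite mass, and covers an infinite N as well as an essential supremum that is not
  attained.\<close>

lemma Nfun_near_extremal:
  fixes f v :: "'a::euclidean_space \<Rightarrow> real"
  assumes p: "1 \<le> p" and v: "v \<in> Wclass"
    and [measurable]: "A \<in> sets lebesgue" "f \<in> borel_measurable lebesgue"
    and a: "0 \<le> a" "ennreal a < Nfun p v A f"
  obtains h where "h \<in> borel_measurable lebesgue" "\<And>x. 0 \<le> h x" "\<And>x. x \<notin> A \<Longrightarrow> h x = 0"
    "Mint p v UNIV h \<le> 1" "ennreal a \<le> (\<integral>\<^sup>+x. ennreal (\<bar>f x\<bar> * h x) \<partial>lebesgue)"
proof -
  have [measurable]: "v \<in> borel_measurable lebesgue" and pos: "AE x in lebesgue. 0 < v x"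
    using v by (auto simp: Wclass_def)
  show thesis
  proof (cases "p = 1")
    case True
    define E where "E = {x \<in> A. a < \<bar>f x\<bar> * inverse (v x) \<and> 0 < v x}"
    have E [measurable]: "E \<in> sets lebesgue" unfolding E_def by measurable
    have "0 < (\<integral>\<^sup>+x\<in>E. ennreal 1 \<partial>lebesgue)"
    proof (rule ccontr)
      assume "\<not> 0 < (\<integral>\<^sup>+x\<in>E. ennreal 1 \<partial>lebesgue)"
      then have "emeasure lebesgue E = 0" by simp
      then have "AE x in lebesgue. x \<notin> E" using E by (intro AE_not_in) auto
      with pos have "AE x in lebesgue. x \<in> A \<longrightarrow> ennreal (\<bar>f x\<bar> * inverse (v x)) \<le> ennreal a"
        by eventually_elim (auto simp: E_def not_less intro!: ennreal_leI)
      then have "Nfun p v A f \<le> ennreal a" using True by (auto simp: Nfun_def intro: Inf_lower)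
      with a show False by simp
    qed
    then obtain B where B: "B \<in> sets lebesgue" "B \<subseteq> E" "0 < emeasure lebesgue B" "emeasure lebesgue B < \<infinity>"
      using finite_positive_truncation[OF E, of "\<lambda>_. 1" 0] by auto
    define m where "m = enn2real (emeasure lebesgue B)"
    have m: "emeasure lebesgue B = ennreal m" "0 < m"
      using B(3,4) unfolding m_def by (simp_all add: enn2real_positive_iff)
    \<comment> \<open>On B the quotient |f|/v exceeds a, so this function, whose integral against v
      is 1, pairs with |f| to at least a.\<close>
    define h where "h x = indicator B x / (v x * m)" for x
    have [measurable]: "B \<in> sets lebesgue" by fact
    show thesis
    proof (rule that)
      show "h \<in> borel_measurable lebesgue" unfolding h_def by measurable
      show "0 \<le> h x" "x \<notin> A \<Longrightarrow> h x = 0" for x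
        using B m by (auto simp: h_def E_def indicator_def)
      have "Mint p v UNIV h = (\<integral>\<^sup>+x. ennreal (1 / m) * indicator B x \<partial>lebesgue)"
        unfolding Mint_def using True B m
        by (intro nn_integral_cong) (auto simp: h_def E_def indicator_def subset_eq)
      also have "\<dots> = 1" using B m by (simp add: nn_integral_cmult flip: ennreal_mult)
      finally show "Mint p v UNIV h \<le> 1" by simp
      have "ennreal a = (\<integral>\<^sup>+x. ennreal (a / m) * indicator B x \<partial>lebesgue)"
        using B m a by (simp add: nn_integral_cmult flip: ennreal_mult)
      also have "\<dots> \<le> (\<integral>\<^sup>+x. ennreal (\<bar>f x\<bar> * h x) \<partial>lebesgue)"
      proof (intro nn_integral_mono)
        fix x
        have "a / m \<le> \<bar>f x\<bar> / (v x * m)" if "x \<in> B"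
        proof -
          have "a \<le> \<bar>f x\<bar> / v x" using that B by (auto simp: E_def field_simps)
          then have "a / m \<le> \<bar>f x\<bar> / v x / m" using m by (intro divide_right_mono) auto
          then show ?thesis by simp
        qed
        then show "ennreal (a / m) * indicator B x \<le> ennreal (\<bar>f x\<bar> * h x)"
          by (auto simp: h_def indicator_def intro!: ennreal_leI)
      qed
      finally show "ennreal a \<le> (\<integral>\<^sup>+x. ennreal (\<bar>f x\<bar> * h x) \<partial>lebesgue)" .
    qed
  next
    case False
    define q where "q = p / (p - 1)"
    have q: "1 < p" "1 < q" "1 / q + 1 / p = 1" "(q - 1) * p = q"
      using p False unfolding q_def by (auto simp: field_simps)
    let ?k = "\<lambda>x. \<bar>f x\<bar> powr q * v x powr (1 - q)"
    have "ennreal a < epowr (\<integral>\<^sup>+x\<in>A. ennreal (?k x) \<partial>lebesgue) (1 / q)"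
      using a False by (simp add: Nfun_def Let_def q_def)
    then have "epowr (ennreal a) q < epowr (epowr (\<integral>\<^sup>+x\<in>A. ennreal (?k x) \<partial>lebesgue) (1 / q)) q"
      using q by (simp only: epowr_less_iff)
    then have "epowr (ennreal a) q < (\<integral>\<^sup>+x\<in>A. ennreal (?k x) \<partial>lebesgue)"
      using q by (simp add: epowr_epowr)
    then obtain B where B: "B \<in> sets lebesgue" "B \<subseteq> A"
      "epowr (ennreal a) q < (\<integral>\<^sup>+x\<in>B. ennreal (?k x) \<partial>lebesgue)"
      "(\<integral>\<^sup>+x\<in>B. ennreal (?k x) \<partial>lebesgue) < \<infinity>"
      by (rule finite_positive_truncation[rotated 2]) auto
    have [measurable]: "B \<in> sets lebesgue" by fact
    define I where "I = enn2real (\<integral>\<^sup>+x\<in>B. ennreal (?k x) \<partial>lebesgue)"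
    have I: "(\<integral>\<^sup>+x\<in>B. ennreal (?k x) \<partial>lebesgue) = ennreal I" "0 \<le> I"
      using B unfolding I_def by (auto simp: ennreal_enn2real)
    have Ia: "a powr q < I" using B(3) a unfolding I(1) by (simp add: epowr_ennreal ennreal_less_iff)
    then have I0: "0 < I" by (smt (verit) powr_ge_zero)
    \<comment> \<open>The equality case of Hoelder's inequality on B. Since (q - 1) p = q, division
      by I powr (1 / p) makes the weighted p-norm equal to 1.\<close>
    define h where "h x = indicator B x * (\<bar>f x\<bar> powr (q - 1) * v x powr (1 - q)) / I powr (1 / p)" for x
    show thesis
    proof (rule that)
      show "h \<in> borel_measurable lebesgue" unfolding h_def by measurable
      show "0 \<le> h x" "x \<notin> A \<Longrightarrow> h x = 0" for x
        using B I0 by (auto simp: h_def indicator_def)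
      have "Mint p v UNIV h = (\<integral>\<^sup>+x. ennreal (1 / I) * (ennreal (?k x) * indicator B x) \<partial>lebesgue)"
        unfolding Mint_def
      proof (intro nn_integral_cong_AE, use pos in eventually_elim)
        fix x assume v: "0 < v x"
        have "(\<bar>f x\<bar> powr (q - 1) * v x powr (1 - q) / I powr (1 / p)) powr p * v x
            = \<bar>f x\<bar> powr q * (v x powr ((1 - q) * p) * v x powr 1) / I"
          using q v I0 by (simp add: powr_divide powr_mult powr_powr)
        also have "v x powr ((1 - q) * p) * v x powr 1 = v x powr (1 - q)"
        proof -
          have "(1 - q) * p + 1 = 1 - q" using q(4) by (simp add: algebra_simps)
          then show ?thesis by (simp only: powr_add[symmetric])
        qed
        finally show "ennreal (\<bar>h x\<bar> powr p * v x) * indicator UNIV x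
            = ennreal (1 / I) * (ennreal (?k x) * indicator B x)"
          using I0 by (auto simp: h_def indicator_def simp flip: ennreal_mult)
      qed
      also have "\<dots> = ennreal (1 / I) * ennreal I"
        unfolding I(1)[symmetric] by (rule nn_integral_cmult) measurable
      also have "\<dots> = 1" using I0 by (simp flip: ennreal_mult)
      finally show "Mint p v UNIV h \<le> 1" by simp
      have "a = (a powr q) powr (1 / q)" using a q by (simp add: powr_powr)
      also have "\<dots> \<le> I powr (1 / q)" using Ia q by (intro powr_mono2) auto
      also have "1 / q = 1 - 1 / p" using q by simp
      also have "I powr (1 - 1 / p) = 1 / I powr (1 / p) * I" using I0 by (simp add: powr_diff)
      finally have "ennreal a \<le> ennreal (1 / I powr (1 / p)) * ennreal I"
        using I0 by (simp add: ennreal_leI flip: ennreal_mult)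
      also have "\<dots> = (\<integral>\<^sup>+x. ennreal (1 / I powr (1 / p)) * (ennreal (?k x) * indicator B x) \<partial>lebesgue)"
        unfolding I(1)[symmetric] by (rule nn_integral_cmult[symmetric]) measurable
      also have "\<dots> = (\<integral>\<^sup>+x. ennreal (\<bar>f x\<bar> * h x) \<partial>lebesgue)"
      proof (intro nn_integral_cong)
        fix x
        have "\<bar>f x\<bar> powr q = \<bar>f x\<bar> * \<bar>f x\<bar> powr (q - 1)"
          using q powr_mult_base[of "\<bar>f x\<bar>" "q - 1"] by simp
        then show "ennreal (1 / I powr (1 / p)) * (ennreal (?k x) * indicator B x) = ennreal (\<bar>f x\<bar> * h x)"
          by (auto simp: h_def indicator_def simp flip: ennreal_mult)
      qed
      finally show "ennreal a \<le> (\<integral>\<^sup>+x. ennreal (\<bar>f x\<bar> * h x) \<partial>lebesgue)" .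
    qed
  qed
qed

section \<open>One-dimensional integrals and dyadic sums\<close>

lemma nn_integral_powr_Icc:
  assumes "0 < \<alpha>" "\<alpha> \<le> \<beta>" "0 < q"
  shows "(\<integral>\<^sup>+s\<in>{\<alpha>..\<beta>}. ennreal (q * s powr (- q - 1)) \<partial>lborel) = ennreal (\<alpha> powr - q - \<beta> powr - q)"
proof -
  have "(\<integral>\<^sup>+s. ennreal (q * s powr (- q - 1)) * indicator {\<alpha>..\<beta>} s \<partial>lborel)
      = ennreal (- (\<beta> powr - q) - - (\<alpha> powr - q))"
  proof (rule nn_integral_FTC_Icc)
    fix x assume "x \<in> {\<alpha>..\<beta>}"
    then have "0 < x" using assms by auto
    then show "((\<lambda>x. - (x powr - q)) has_real_derivative q * x powr (- q - 1)) (at x)"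
      by (auto intro!: derivative_eq_intros)
  qed (use assms in auto)
  then show ?thesis by simp
qed

lemma nn_integral_powr_atLeast:
  assumes "0 < \<alpha>" "0 < q"
  shows "(\<integral>\<^sup>+s\<in>{\<alpha>..}. ennreal (q * s powr (- q - 1)) \<partial>lborel) = ennreal (\<alpha> powr - q)"
proof -
  have "((\<lambda>s. s powr - q) \<longlongrightarrow> 0) at_top"
    using assms by (intro tendsto_neg_powr filterlim_ident) auto
  then have "((\<lambda>s. - (s powr - q)) \<longlongrightarrow> - 0) at_top" by (rule tendsto_minus)
  then have "(\<integral>\<^sup>+s. ennreal (q * s powr (- q - 1)) * indicator {\<alpha>..} s \<partial>lborel)
      = ennreal (- 0 - - (\<alpha> powr - q))"
    by (intro nn_integral_FTC_atLeast) (use assms in \<open>auto intro!: derivative_eq_intros\<close>)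
  then show ?thesis by simp
qed

text \<open>For a < 1 the density is unbounded at 0, so the value comes from the gauge integral on
  [0,z] rather than from a primitive differentiable at 0.\<close>

lemma nn_integral_powr_from_0:
  assumes "0 \<le> z" "0 < a"
  shows "(\<integral>\<^sup>+s\<in>{0<..z}. ennreal (a * s powr (a - 1)) \<partial>lborel) = ennreal (z powr a)"
proof -
  have "((\<lambda>x. x powr (a - 1)) has_integral (z powr (a - 1 + 1) / (a - 1 + 1))) {0..z}"
    using assms by (intro has_integral_powr_from_0) auto
  then have "((\<lambda>x. a * x powr (a - 1)) has_integral (a * (z powr a / a))) {0..z}"
    using has_integral_mult_right[of "\<lambda>x. x powr (a - 1)" "z powr a / a" "{0..z}" a] by simp
  then have "((\<lambda>x. indicator {0..z} x * (a * x powr (a - 1))) has_integral (z powr a)) UNIV"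
    using assms
    by (subst (asm) has_integral_restrict_UNIV[symmetric])
      (auto simp: indicator_def of_bool_def if_distrib if_distribR cong: if_cong)
  then have "(\<integral>\<^sup>+x. ennreal (indicator {0..z} x * (a * x powr (a - 1))) \<partial>lborel) = ennreal (z powr a)"
    by (rule nn_integral_has_integral_lborel[rotated 2]) (use assms in \<open>auto simp: indicator_def\<close>)
  moreover have "(\<integral>\<^sup>+s\<in>{0<..z}. ennreal (a * s powr (a - 1)) \<partial>lborel)
      = (\<integral>\<^sup>+x. ennreal (indicator {0..z} x * (a * x powr (a - 1))) \<partial>lborel)"
    by (intro nn_integral_cong) (auto simp: indicator_def not_less)
  ultimately show ?thesis by simp
qed

text \<open>Monotonicity yields k(s) \<le> J/s, with J the root of order a of the weighted integral
  I. Splitting k as k^(1-a) k^a and using this pointwise bound in the first factor leaves I itself.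
  This turns information in L^\<theta> with \<theta> \<le> 1 into an L^1 bound.\<close>

lemma nn_integral_antimono_le:
  fixes k :: "real \<Rightarrow> ennreal"
  assumes "antimono k" "0 < a" "a \<le> 1"
  shows "(\<integral>\<^sup>+s\<in>{0<..}. k s \<partial>lborel)
    \<le> ennreal (1 / a) * epowr (\<integral>\<^sup>+s\<in>{0<..}. ennreal (a * s powr (a - 1)) * epowr (k s) a \<partial>lborel) (1 / a)"
proof (cases "a = 1")
  case True
  have "(\<integral>\<^sup>+s\<in>{0<..}. k s \<partial>lborel) = (\<integral>\<^sup>+s\<in>{0<..}. ennreal (1 * s powr (1 - 1)) * epowr (k s) 1 \<partial>lborel)"
    by (intro nn_integral_cong) (auto simp: indicator_def)
  with True show ?thesis by simp
next
  case False
  note [measurable] = borel_measurable_antimono_ennreal[OF assms(1)]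
  define I where "I = (\<integral>\<^sup>+s\<in>{0<..}. ennreal (a * s powr (a - 1)) * epowr (k s) a \<partial>lborel)"
  define J where "J = epowr I (1 / a)"
  have kJ: "k s \<le> J * ennreal (1 / s)" if "0 < s" for s
  proof -
    have "epowr (ennreal s * k s) a = ennreal (s powr a) * epowr (k s) a"
      using that by (simp add: epowr_mult epowr_ennreal)
    \<comment> \<open>s powr a is written as the mass of the density on (0,s], where k is at least
      k(s).\<close>
    also have "\<dots> = epowr (k s) a * (\<integral>\<^sup>+u\<in>{0<..s}. ennreal (a * u powr (a - 1)) \<partial>lborel)"
      using nn_integral_powr_from_0[of s a] that assms by (simp only: mult.commute)
    also have "\<dots> = (\<integral>\<^sup>+u. epowr (k s) a * (ennreal (a * u powr (a - 1)) * indicator {0<..s} u) \<partial>lborel)"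
      by (rule nn_integral_cmult[symmetric]) measurable
    also have "\<dots> \<le> I"
      unfolding I_def
    proof (intro nn_integral_mono)
      fix u
      have "epowr (k s) a \<le> epowr (k u) a" if "u \<le> s"
        using assms that by (intro epowr_mono antimonoD[OF assms(1)]) auto
      then show "epowr (k s) a * (ennreal (a * u powr (a - 1)) * indicator {0<..s} u)
          \<le> ennreal (a * u powr (a - 1)) * epowr (k u) a * indicator {0<..} u"
        by (auto simp: indicator_def mult.commute intro!: mult_left_mono mult_right_mono)
    qed
    finally have "ennreal s * k s \<le> J" using assms by (simp add: epowr_le_iff' J_def)
    then have "ennreal s * k s * ennreal (1 / s) \<le> J * ennreal (1 / s)" by (rule mult_right_mono) simp
    also have "ennreal s * k s * ennreal (1 / s) = k s"
    proof -
      have "ennreal s * ennreal (1 / s) = 1" using that by (simp flip: ennreal_mult)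
      then show ?thesis by (metis mult.commute mult.assoc mult_1)
    qed
    finally show ?thesis .
  qed
  have "(\<integral>\<^sup>+s\<in>{0<..}. k s \<partial>lborel)
      \<le> (\<integral>\<^sup>+s. (epowr J (1 - a) * ennreal (1 / a))
          * (ennreal (a * s powr (a - 1)) * epowr (k s) a * indicator {0<..} s) \<partial>lborel)"
  proof (intro nn_integral_mono)
    fix s :: real
    have "k s \<le> epowr J (1 - a) * ennreal (1 / a) * (ennreal (a * s powr (a - 1)) * epowr (k s) a)" if "0 < s"
    proof -
      have "k s = epowr (k s) ((1 - a) + a)" by simp
      also have "\<dots> = epowr (k s) (1 - a) * epowr (k s) a" by (rule epowr_add)
      also have "\<dots> \<le> epowr (J * ennreal (1 / s)) (1 - a) * epowr (k s) a"
        using kJ[OF that] assms by (intro mult_right_mono epowr_mono) auto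
      also have "epowr (J * ennreal (1 / s)) (1 - a) = epowr J (1 - a) * ennreal (s powr (a - 1))"
        using that by (simp add: epowr_mult epowr_ennreal powr_divide powr_diff)
      also have "ennreal (s powr (a - 1)) = ennreal (1 / a) * ennreal (a * s powr (a - 1))"
        using assms by (simp flip: ennreal_mult)
      finally show ?thesis by (simp add: mult.assoc)
    qed
    then show "k s * indicator {0<..} s \<le> (epowr J (1 - a) * ennreal (1 / a))
          * (ennreal (a * s powr (a - 1)) * epowr (k s) a * indicator {0<..} s)"
      by (auto simp: indicator_def)
  qed
  also have "\<dots> = epowr J (1 - a) * ennreal (1 / a) * I"
    unfolding I_def by (rule nn_integral_cmult) measurable
  also have "I = epowr J a" using assms by (simp add: J_def epowr_epowr)
  also have "epowr J (1 - a) * ennreal (1 / a) * epowr J a = ennreal (1 / a) * J"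
    using epowr_add[of J "1 - a" a] by (simp add: mult.assoc mult.left_commute)
  finally show ?thesis by (simp add: J_def I_def)
qed

section \<open>Jensen's inequality, geometric sums and the dyadic Hardy inequality\<close>

lemma sum_powr_Jensen:
  fixes w x :: "'i \<Rightarrow> real"
  assumes "finite I" "1 \<le> p" and w: "\<And>i. i \<in> I \<Longrightarrow> 0 \<le> w i" and x: "\<And>i. i \<in> I \<Longrightarrow> 0 \<le> x i"
  shows "(\<Sum>i\<in>I. w i * x i) powr p \<le> (\<Sum>i\<in>I. w i) powr (p - 1) * (\<Sum>i\<in>I. w i * x i powr p)"
proof -
  \<comment> \<open>Convexity of the power is applied on the open half-line, so terms with zero
    weight or zero argument are dropped. The weights are not normalised: their sum l produces the
    factor with exponent p - 1.\<close>
  define J where "J = {i \<in> I. 0 < w i \<and> 0 < x i}"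
  have J: "finite J" "J \<subseteq> I" using assms by (auto simp: J_def)
  have out: "w i = 0 \<or> x i = 0" if "i \<in> I - J" for i
    using that w x by (force simp: J_def)
  have eq: "(\<Sum>i\<in>I. w i * x i) = (\<Sum>i\<in>J. w i * x i)" "(\<Sum>i\<in>I. w i * x i powr p) = (\<Sum>i\<in>J. w i * x i powr p)"
    using out assms J by (auto intro!: sum.mono_neutral_right)
  show ?thesis
  proof (cases "J = {}")
    case True
    then show ?thesis unfolding eq by simp
  next
    case False
    define l where "l = (\<Sum>i\<in>J. w i)"
    have l: "0 < l" unfolding l_def using J False by (intro sum_pos) (auto simp: J_def)
    have lI: "l \<le> (\<Sum>i\<in>I. w i)" unfolding l_def using J assms by (intro sum_mono2) auto
    have "(\<Sum>i\<in>J. (w i / l) *\<^sub>R x i) powr p \<le> (\<Sum>i\<in>J. (w i / l) * x i powr p)"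
      using J False powr_convex[OF assms(2)] l
      by (intro convex_on_sum[where C = "{0<..}"])
        (auto simp: J_def l_def simp flip: sum_divide_distrib)
    then have "((\<Sum>i\<in>J. w i * x i) / l) powr p \<le> (\<Sum>i\<in>J. w i * x i powr p) / l"
      by (simp add: sum_divide_distrib)
    moreover have "((\<Sum>i\<in>J. w i * x i) / l) powr p = (\<Sum>i\<in>J. w i * x i) powr p / l powr p"
      by (rule powr_divide)
    ultimately have "(\<Sum>i\<in>J. w i * x i) powr p \<le> (\<Sum>i\<in>J. w i * x i powr p) / l * l powr p"
      using l by (simp add: pos_divide_le_eq)
    also have "\<dots> = l powr (p - 1) * (\<Sum>i\<in>J. w i * x i powr p)"
      using l by (simp add: powr_diff)
    also have "\<dots> \<le> (\<Sum>i\<in>I. w i) powr (p - 1) * (\<Sum>i\<in>J. w i * x i powr p)"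
      using lI l assms(2) by (intro mult_right_mono powr_mono2) (auto intro!: sum_nonneg simp: J_def)
    finally show ?thesis unfolding eq .
  qed
qed

text \<open>d assigns distinct nonnegative exponents, so the sum is part of a geometric series.
  Having d as a parameter covers sums towards larger and towards smaller indices alike.\<close>

lemma sum_geometric_int_le:
  fixes I :: "int set" and r :: real
  assumes "finite I" "0 < r" "r < 1" and d: "inj_on d I" "\<And>k. k \<in> I \<Longrightarrow> 0 \<le> d k"
  shows "(\<Sum>k\<in>I. r powr real_of_int (d k)) \<le> 1 / (1 - r)"
proof -
  have "(\<Sum>k\<in>I. r powr real_of_int (d k)) = (\<Sum>k\<in>I. r ^ nat (d k))"
    using assms by (intro sum.cong) (auto simp flip: powr_realpow)
  also have "\<dots> = (\<Sum>m\<in>(\<lambda>k. nat (d k)) ` I. r ^ m)"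
    using d by (subst sum.reindex) (auto simp: inj_on_def eq_nat_nat_iff)
  also have "\<dots> \<le> (\<Sum>m. r ^ m)"
    using assms by (intro sum_le_suminf summable_geometric) auto
  also have "\<dots> = 1 / (1 - r)" using assms by (intro suminf_geometric) auto
  finally show ?thesis .
qed

text \<open>A Schur test. Each c k in the tail from j receives the weight r powr (k - j). Jensen's
  inequality costs the row sum of the weights to the power \<theta> - 1, and interchanging the sums
  costs one column sum. Both are at most 1 / (1 - r), whence the power \<theta> of this
  constant.\<close>

lemma sum_dyadic_Hardy:
  fixes I :: "int set" and c :: "int \<Rightarrow> real"
  assumes "finite I" "1 \<le> \<theta>" and c: "\<And>k. k \<in> I \<Longrightarrow> 0 \<le> c k"
  defines "r \<equiv> 2 powr (- 1 / 2) :: real"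
  shows "(\<Sum>j\<in>I. (2 powr j) powr \<theta> * (\<Sum>k\<in>{k \<in> I. j \<le> k}. c k) powr \<theta>)
    \<le> (1 / (1 - r)) powr \<theta> * (\<Sum>k\<in>I. (2 powr k) powr \<theta> * c k powr \<theta>)"
proof -
  have r: "0 < r" "r < 1"
    using powr_less_mono[of "- 1 / 2" 0 "2::real"] by (auto simp: r_def)
  let ?B = "1 / (1 - r)"
  have B: "0 < ?B" using r by simp
  have row: "(2 powr j) powr \<theta> * (\<Sum>k\<in>{k \<in> I. j \<le> k}. c k) powr \<theta>
      \<le> ?B powr (\<theta> - 1) * (\<Sum>k\<in>{k \<in> I. j \<le> k}. r powr (k - j) * ((2 powr k) powr \<theta> * c k powr \<theta>))"
    if "j \<in> I" for j
  proof -
    let ?I = "{k \<in> I. j \<le> k}"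
    have "(\<Sum>k\<in>?I. c k) = (\<Sum>k\<in>?I. r powr (k - j) * (c k * r powr (j - k)))"
      using r by (intro sum.cong) (auto simp: mult.left_commute simp flip: powr_add)
    then have "(\<Sum>k\<in>?I. c k) powr \<theta>
        \<le> (\<Sum>k\<in>?I. r powr (k - j)) powr (\<theta> - 1) * (\<Sum>k\<in>?I. r powr (k - j) * (c k * r powr (j - k)) powr \<theta>)"
      using sum_powr_Jensen[of ?I \<theta> "\<lambda>k. r powr (k - j)" "\<lambda>k. c k * r powr (j - k)"] assms by simp
    also have "\<dots> \<le> ?B powr (\<theta> - 1) * (\<Sum>k\<in>?I. r powr (k - j) * (c k * r powr (j - k)) powr \<theta>)"
    proof (intro mult_right_mono powr_mono2)
      show "(\<Sum>k\<in>?I. r powr (k - j)) \<le> ?B"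
        using sum_geometric_int_le[of ?I r "\<lambda>k. k - j"] assms(1) r by (auto simp: inj_on_def)
    qed (use assms in \<open>auto intro!: sum_nonneg\<close>)
    finally have "(2 powr j) powr \<theta> * (\<Sum>k\<in>?I. c k) powr \<theta>
        \<le> (2 powr j) powr \<theta> * (?B powr (\<theta> - 1) * (\<Sum>k\<in>?I. r powr (k - j) * (c k * r powr (j - k)) powr \<theta>))"
      by (intro mult_left_mono) auto
    also have "\<dots> = ?B powr (\<theta> - 1) * (\<Sum>k\<in>?I. r powr (k - j) * ((2 powr j) powr \<theta> * (c k * r powr (j - k)) powr \<theta>))"
      by (simp add: sum_distrib_left mult_ac)
    also have "\<dots> \<le> ?B powr (\<theta> - 1) * (\<Sum>k\<in>?I. r powr (k - j) * ((2 powr k) powr \<theta> * c k powr \<theta>))"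
    proof (intro mult_left_mono sum_mono)
      fix k assume k: "k \<in> ?I"
      \<comment> \<open>The compensating weight grows only like the square root of 2 powr (k - j),
        so it is absorbed in passing from 2 powr j to 2 powr k. Any ratio r in [1/2, 1) has this
        property.\<close>
      have "r powr (j - k) = 2 powr ((k - j) / 2)"
        unfolding r_def powr_powr
        by (rule arg_cong[where f = "(powr) 2"]) (simp add: algebra_simps diff_divide_distrib)
      also have "\<dots> \<le> 2 powr (real_of_int k - j)" using k by (intro powr_mono) auto
      finally have "2 powr j * (c k * r powr (j - k)) \<le> 2 powr j * (c k * 2 powr (real_of_int k - j))"
        using c k by (intro mult_left_mono) auto
      also have "\<dots> = 2 powr k * c k" by (simp add: powr_diff)
      finally have "(2 powr j * (c k * r powr (j - k))) powr \<theta> \<le> (2 powr k * c k) powr \<theta>"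
        using assms k by (intro powr_mono2) auto
      then show "(2 powr j) powr \<theta> * (c k * r powr (j - k)) powr \<theta> \<le> (2 powr k) powr \<theta> * c k powr \<theta>"
        using c k by (simp add: powr_mult)
    qed (auto intro!: sum_nonneg)
    finally show ?thesis by simp
  qed
  have "(\<Sum>j\<in>I. (2 powr j) powr \<theta> * (\<Sum>k\<in>{k \<in> I. j \<le> k}. c k) powr \<theta>)
      \<le> (\<Sum>j\<in>I. ?B powr (\<theta> - 1) * (\<Sum>k\<in>{k \<in> I. j \<le> k}. r powr (k - j) * ((2 powr k) powr \<theta> * c k powr \<theta>)))"
    using row by (intro sum_mono) simp
  also have "\<dots> = ?B powr (\<theta> - 1) * (\<Sum>j\<in>I. \<Sum>k\<in>{k \<in> I. j \<le> k}. r powr (k - j) * ((2 powr k) powr \<theta> * c k powr \<theta>))"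
    by (rule sum_distrib_left[symmetric])
  also have "(\<Sum>j\<in>I. \<Sum>k\<in>{k \<in> I. j \<le> k}. r powr (k - j) * ((2 powr k) powr \<theta> * c k powr \<theta>))
      = (\<Sum>k\<in>I. \<Sum>j\<in>{j \<in> I. j \<le> k}. r powr (k - j) * ((2 powr k) powr \<theta> * c k powr \<theta>))"
    using assms(1) by (rule sum.swap_restrict[of I I _ "(\<le>)"]) fact
  also have "\<dots> = (\<Sum>k\<in>I. (\<Sum>j\<in>{j \<in> I. j \<le> k}. r powr (k - j)) * ((2 powr k) powr \<theta> * c k powr \<theta>))"
    by (simp add: sum_distrib_right)
  also have "?B powr (\<theta> - 1) * \<dots> \<le> ?B powr (\<theta> - 1) * (\<Sum>k\<in>I. ?B * ((2 powr k) powr \<theta> * c k powr \<theta>))"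
  proof (intro mult_left_mono sum_mono mult_right_mono)
    fix k :: int
    show "(\<Sum>j\<in>{j \<in> I. j \<le> k}. r powr (k - j)) \<le> ?B"
      using sum_geometric_int_le[of "{j \<in> I. j \<le> k}" r "\<lambda>j. k - j"] assms(1) r by (auto simp: inj_on_def)
  qed auto
  also have "\<dots> = ?B powr \<theta> * (\<Sum>k\<in>I. (2 powr k) powr \<theta> * c k powr \<theta>)"
  proof -
    have "?B powr (\<theta> - 1) * ?B = ?B powr \<theta>" using B by (simp add: powr_diff)
    moreover have "(\<Sum>k\<in>I. ?B * ((2 powr k) powr \<theta> * c k powr \<theta>))
        = ?B * (\<Sum>k\<in>I. (2 powr k) powr \<theta> * c k powr \<theta>)"
      by (rule sum_distrib_left[symmetric])
    ultimately show ?thesis by (simp only: mult.assoc[symmetric])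
  qed
  finally show ?thesis .
qed

section \<open>Stieltjes integrals transported to the levels of a monotone function\<close>

lemma measure_eqI_Ioc:
  fixes M N :: "real measure"
  assumes sets: "sets M = sets borel" "sets N = sets borel"
    and eq: "\<And>a b. a < b \<Longrightarrow> emeasure M {a<..b} = emeasure N {a<..b}"
    and fin: "\<And>a b. a < b \<Longrightarrow> emeasure M {a<..b} < \<infinity>"
  shows "M = N"
proof (rule measure_eqI_generator_eq)
  let ?E = "range (\<lambda>(a, b). {a<..b::real})"
  show "Int_stable ?E"
  proof (rule Int_stableI)
    fix A B assume "A \<in> ?E" "B \<in> ?E"
    then obtain a b c d where "A = {a<..b}" "B = {c<..d}" by auto
    then have "A \<inter> B = (\<lambda>(a, b). {a<..b}) (max a c, min b d)" by auto
    then show "A \<inter> B \<in> ?E" by blast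
  qed
  show "?E \<subseteq> Pow UNIV" by auto
  have "emeasure M {a<..b} = emeasure N {a<..b}" for a b
    using eq[of a b] by (cases "a < b") auto
  then show "emeasure M X = emeasure N X" if "X \<in> ?E" for X using that by auto
  show "sets M = sigma_sets UNIV ?E" "sets N = sigma_sets UNIV ?E"
    using sets by (auto simp: borel_sigma_sets_Ioc)
  show "range (\<lambda>n. {- real n - 1<..real n + 1}) \<subseteq> ?E" by auto
  show "(\<Union>n. {- real n - 1<..real n + 1}) = UNIV"
  proof (intro equalityI subsetI)
    fix x :: real
    obtain n where "\<bar>x\<bar> < real n" using reals_Archimedean2 by blast
    then show "x \<in> (\<Union>n. {- real n - 1<..real n + 1})" by (auto intro!: exI[of _ n])
  qed auto
  show "emeasure M {- real n - 1<..real n + 1} \<noteq> \<infinity>" for n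
    using fin[of "- real n - 1" "real n + 1"] by auto
qed

text \<open>The measure \<open>d(-L(t)\<^sup>-\<^sup>q)\<close> is the image of \<open>q s\<^sup>-\<^sup>q\<^sup>-\<^sup>1 ds\<close> under the
  generalised inverse of \<open>w\<close>.\<close>

lemma LS_neg_integral_eq:
  fixes w L \<phi> :: "real \<Rightarrow> real" and h :: "real \<Rightarrow> ennreal"
  assumes "mono w" and pos: "\<And>t. 0 < t \<Longrightarrow> 0 < w t" and q: "0 < q"
    and lim: "\<And>t. 0 < t \<Longrightarrow> (w \<longlongrightarrow> L t) (at_right t)"
    and \<phi>: "\<And>t. 0 < t \<Longrightarrow> \<phi> t = L t powr - q"
    and h [measurable]: "h \<in> borel_measurable borel"
  shows "LS_neg_integral \<phi> h
    = (\<integral>\<^sup>+s\<in>{s. (\<exists>t>0. w t \<le> s) \<and> (\<exists>t. s < w t)}. ennreal (q * s powr (- q - 1)) * h (Sup {t. w t \<le> s}) \<partial>lborel)"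
proof -
  have L_le: "L t \<le> w u" if "0 < t" "t < u" for t u
  proof (rule tendsto_upperbound[OF lim[OF that(1)]])
    show "\<forall>\<^sub>F x in at_right t. w x \<le> w u"
      using eventually_at_right[OF that(2)] that monoD[OF \<open>mono w\<close>] by (auto intro!: exI[of _ u])
  qed simp
  have le_L: "w t \<le> L t" if "0 < t" for t
  proof (rule tendsto_lowerbound[OF lim[OF that]])
    show "\<forall>\<^sub>F x in at_right t. w t \<le> w x"
      using monoD[OF \<open>mono w\<close>] by (auto simp: eventually_at_filter)
  qed simp
  have L_less: "\<exists>u>t. u < b \<and> w u < y" if "0 < t" "L t < y" "t < b" for t y b
  proof -
    have "\<forall>\<^sub>F x in at_right t. w x < y \<and> x < b \<and> t < x"
      using order_tendstoD(2)[OF lim[OF that(1)] that(2)] that(3)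
      by (auto simp: eventually_conj_iff eventually_at_right_less eventually_at_right_field)
    then show ?thesis using eventually_happens[of _ "at_right t"] by force
  qed
  have L_pos: "0 < L t" if "0 < t" for t using le_L[OF that] pos[OF that] by simp
  have L_mono: "L t \<le> L u" if "0 < t" "t \<le> u" for t u
    using L_le[of t u] le_L[of u] that by (cases "t = u") auto
  \<comment> \<open>For e \<ge> 0 these are the levels whose generalised inverse is finite and
    exceeds e.\<close>
  define S where "S e = {s. (\<exists>t>e. w t \<le> s) \<and> (\<exists>t. s < w t)}" for e
  \<comment> \<open>Outside \<open>S 0\<close> the default 0 keeps \<open>\<rho>\<close> nonnegative
    and makes {y < \<rho>} equal to \<open>S y\<close> for every y \<ge> 0, which gives
    measurability.\<close>
  define \<rho> where "\<rho> s = (if s \<in> S 0 then Sup {t. w t \<le> s} else 0)" for s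
  have bdd: "bdd_above {t. w t \<le> s}" if "s < w u" for s u
    using that monoD[OF \<open>mono w\<close>] by (intro bdd_aboveI[of _ u]) (smt (verit) mem_Collect_eq)
  have \<rho>_ge: "u \<le> \<rho> s" if S0: "s \<in> S 0" and u: "w u \<le> s" for u s
  proof -
    obtain t where "s < w t" using S0 by (auto simp: S_def)
    then have "u \<le> Sup {t. w t \<le> s}" using u bdd by (intro cSup_upper) auto
    then show ?thesis using S0 by (simp add: \<rho>_def)
  qed
  have \<rho>_less: "\<exists>t>y. w t \<le> s" if "s \<in> S 0" "y < \<rho> s" for y s
  proof -
    have "{t. w t \<le> s} \<noteq> {}" using that(1) by (auto simp: S_def)
    moreover have "y < Sup {t. w t \<le> s}" using that by (simp add: \<rho>_def)
    ultimately obtain t where "t \<in> {t. w t \<le> s}" "y < t" by (metis less_cSupE)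
    then show ?thesis by auto
  qed
  have S_sub: "S e \<subseteq> S 0" if "0 \<le> e" for e
    using that unfolding S_def by (blast intro: le_less_trans)
  have [measurable]: "S e \<in> sets borel" for e
  proof -
    have "{s. \<exists>t>e. w t \<le> s} \<in> sets borel"
      by (rule up_closed_borel) (blast intro: order_trans)
    moreover have "- {s. \<exists>t. s < w t} \<in> sets borel"
      by (rule up_closed_borel) (blast intro: le_less_trans)
    then have "{s. \<exists>t. s < w t} \<in> sets borel" by (metis borel_comp double_complement)
    ultimately show ?thesis unfolding S_def Collect_conj_eq by (rule sets.Int)
  qed
  have [measurable]: "\<rho> \<in> borel_measurable borel"
  proof (rule borel_measurableI_greater)
    fix y
    have "{x \<in> space borel. y < \<rho> x} = (if y < 0 then UNIV else S y)"
    proof -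
      have "0 \<le> \<rho> s" for s using \<rho>_ge by (cases "s \<in> S 0") (force simp: S_def \<rho>_def)+
      moreover have "s \<in> S y" if "0 \<le> y" "y < \<rho> s" for s
      proof -
        have S0: "s \<in> S 0" using that by (auto simp: \<rho>_def split: if_splits)
        then show ?thesis using \<rho>_less[OF S0 that(2)] by (auto simp: S_def)
      qed
      moreover have "y < \<rho> s" if "0 \<le> y" "s \<in> S y" for s
        using that \<rho>_ge[of s] S_sub[of y] by (auto simp: S_def) (smt (verit) mem_Collect_eq subset_eq)
      ultimately show ?thesis by (auto simp: not_less) (smt (verit))
    qed
    then show "{x \<in> space borel. y < \<rho> x} \<in> sets borel" by simp
  qed
  let ?d = "\<lambda>s. ennreal (q * s powr (- q - 1))"
  have int: "(\<integral>\<^sup>+t\<in>{\<epsilon><..}. h t \<partial>interval_measure (\<lambda>t. - \<phi> (max t \<epsilon>)))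
      = (\<integral>\<^sup>+s\<in>S \<epsilon>. ?d s * h (\<rho> s) \<partial>lborel)" if e: "0 < \<epsilon>" for \<epsilon>
  proof -
    let ?F = "\<lambda>t. - \<phi> (max t \<epsilon>)"
    \<comment> \<open>Candidate for the Stieltjes measure beyond \<epsilon>: the image under
      \<open>\<rho>\<close> of the power density, restricted to levels with \<open>\<rho>\<close>
      beyond \<epsilon>.\<close>
    let ?N = "distr (density lborel (\<lambda>s. ?d s * indicator (S \<epsilon>) s)) borel \<rho>"
    have F: "?F t = - (L (max t \<epsilon>) powr - q)" for t using e by (subst \<phi>) auto
    have F_mono: "?F x \<le> ?F y" if "x \<le> y" for x y
      unfolding F using that e q L_pos L_mono by (auto intro!: powr_mono2')
    \<comment> \<open>Right continuity of the integrator is what makes its interval measure of (a,b]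
      equal to the increment.\<close>
    have L_cont: "(L \<longlongrightarrow> L a) (at_right a)" if a: "0 < a" for a
    proof (rule order_tendstoI)
      fix y assume "y < L a"
      then show "\<forall>\<^sub>F x in at_right a. y < L x"
        using L_mono[OF a] by (auto simp: eventually_at_filter intro!: always_eventually) (smt (verit))
    next
      fix y assume "L a < y"
      then obtain u where "a < u" "w u < y" using L_less[OF a, of y "a + 1"] by auto
      then show "\<forall>\<^sub>F x in at_right a. L x < y"
        using L_le a by (auto simp: eventually_at_right[OF \<open>a < u\<close>] intro!: exI[of _ u]) (smt (verit))
    qed
    have F_cont: "continuous (at_right a) ?F" for a
    proof (cases "a < \<epsilon>")
      case True
      have "\<forall>\<^sub>F x in at_right a. ?F x = ?F a"
        using True by (auto simp: eventually_at_right[OF True] intro!: exI[of _ \<epsilon>])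
      then show ?thesis unfolding continuous_within by (rule tendsto_eventually)
    next
      case False
      then have "((\<lambda>t. - (L t powr - q)) \<longlongrightarrow> - (L a powr - q)) (at_right a)"
        using e L_pos[of a] by (intro tendsto_intros L_cont) auto
      moreover have "\<forall>\<^sub>F x in at_right a. - (L x powr - q) = ?F x"
        unfolding F using False by (auto simp: eventually_at_filter max_def)
      ultimately have "(?F \<longlongrightarrow> - (L a powr - q)) (at_right a)"
        by (rule Lim_transform_eventually)
      then show ?thesis unfolding continuous_within F using False by (simp add: max_def)
    qed
    have "interval_measure ?F = ?N"
    proof (rule measure_eqI_Ioc)
      fix a b :: real assume "a < b"
      have M: "emeasure (interval_measure ?F) {a<..b} = ennreal (?F b - ?F a)"
        using \<open>a < b\<close> by (intro emeasure_interval_measure_Ioc F_mono F_cont) auto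
      then show "emeasure (interval_measure ?F) {a<..b} < \<infinity>" by simp
      \<comment> \<open>Clipping at \<epsilon> matches the clipped integrator. If b \<le>
        \<epsilon>, then a' = b' and both measures of (a,b] vanish.\<close>
      define a' b' where "a' = max a \<epsilon>" and "b' = max b \<epsilon>"
      have ab: "0 < a'" "a' \<le> b'" "0 < b'" using e \<open>a < b\<close> by (auto simp: a'_def b'_def)
      have "emeasure ?N {a<..b} = (\<integral>\<^sup>+s. ?d s * indicator (S \<epsilon>) s * indicator (\<rho> -` {a<..b}) s \<partial>lborel)"
        using measurable_sets[of \<rho> borel borel "{a<..b}"]
        by (subst emeasure_distr) (auto simp: emeasure_density)
      also have "\<dots> = (\<integral>\<^sup>+s\<in>{L a'..L b'}. ?d s \<partial>lborel)"
      proof (rule nn_integral_cong_AE)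
        \<comment> \<open>At these two levels membership in the preimage of (a,b] depends on whether
          w is constant just after a' or b'. They are discarded as null sets.\<close>
        have "AE s in lborel. s \<noteq> L a' \<and> s \<noteq> L b'"
          using AE_lborel_singleton[of "L a'"] AE_lborel_singleton[of "L b'"] by eventually_elim auto
        then show "AE s in lborel. ?d s * indicator (S \<epsilon>) s * indicator (\<rho> -` {a<..b}) s
            = ?d s * indicator {L a'..L b'} s"
        proof eventually_elim
          fix s assume s: "s \<noteq> L a' \<and> s \<noteq> L b'"
          have "s \<in> S \<epsilon> \<and> a < \<rho> s \<and> \<rho> s \<le> b \<longleftrightarrow> L a' \<le> s \<and> s \<le> L b'"
          proof (intro iffI conjI)
            assume A: "s \<in> S \<epsilon> \<and> a < \<rho> s \<and> \<rho> s \<le> b"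
            then have S0: "s \<in> S 0" using S_sub e by (meson order_less_imp_le subsetD)
            have "\<epsilon> < \<rho> s" using A \<rho>_ge[OF S0] by (force simp: S_def)
            then have "a' < \<rho> s" using A by (simp add: a'_def)
            then show "L a' \<le> s" using \<rho>_less[OF S0] L_le[OF ab(1)] by force
            show "s \<le> L b'"
            proof (rule ccontr)
              assume "\<not> s \<le> L b'"
              then obtain u where "b' < u" "w u < s" using L_less[OF ab(3), of s "b' + 1"] by auto
              then show False using \<rho>_ge[OF S0, of u] A by (auto simp: b'_def)
            qed
          next
            assume A: "L a' \<le> s \<and> s \<le> L b'"
            then have less: "L a' < s" "s < L b'" using s by auto
            then obtain u where u: "a' < u" "w u < s" using L_less[OF ab(1), of s "a' + 1"] by auto
            have "s < w (b' + 1)" using L_le[OF ab(3), of "b' + 1"] less by auto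
            then show Se: "s \<in> S \<epsilon>" using u unfolding S_def by (force simp: a'_def)
            then have S0: "s \<in> S 0" using S_sub e by (meson order_less_imp_le subsetD)
            show "a < \<rho> s" using \<rho>_ge[OF S0, of u] u by (auto simp: a'_def)
            have le: "\<rho> s \<le> b'" using \<rho>_less[OF S0, of b'] L_le[OF ab(3)] less by force
            show "\<rho> s \<le> b"
            proof (cases "\<epsilon> \<le> b")
              case True
              then show ?thesis using le by (simp add: b'_def)
            next
              case False
              then have "a' = b'" using \<open>a < b\<close> by (simp add: a'_def b'_def)
              then show ?thesis using less by simp
            qed
          qed
          then show "?d s * indicator (S \<epsilon>) s * indicator (\<rho> -` {a<..b}) s
              = ?d s * indicator {L a'..L b'} s"
            by (auto simp: indicator_def)
        qed
      qed
      also have "\<dots> = ennreal (L a' powr - q - L b' powr - q)"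
        using ab q L_pos L_mono by (intro nn_integral_powr_Icc) auto
      also have "L a' powr - q - L b' powr - q = ?F b - ?F a" unfolding F a'_def b'_def by simp
      finally show "emeasure (interval_measure ?F) {a<..b} = emeasure ?N {a<..b}" using M by simp
    qed simp_all
    then have "(\<integral>\<^sup>+t\<in>{\<epsilon><..}. h t \<partial>interval_measure ?F) = (\<integral>\<^sup>+t\<in>{\<epsilon><..}. h t \<partial>?N)" by simp
    also have "\<dots> = (\<integral>\<^sup>+s. ?d s * indicator (S \<epsilon>) s * (h (\<rho> s) * indicator {\<epsilon><..} (\<rho> s)) \<partial>lborel)"
      by (simp add: nn_integral_distr nn_integral_density)
    also have "\<dots> = (\<integral>\<^sup>+s\<in>S \<epsilon>. ?d s * h (\<rho> s) \<partial>lborel)"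
    proof (intro nn_integral_cong)
      fix s
      have "\<epsilon> < \<rho> s" if "s \<in> S \<epsilon>"
        using that \<rho>_ge[of s] S_sub[of \<epsilon>] e by (force simp: S_def)
      then show "?d s * indicator (S \<epsilon>) s * (h (\<rho> s) * indicator {\<epsilon><..} (\<rho> s)) = ?d s * h (\<rho> s) * indicator (S \<epsilon>) s"
        by (auto simp: indicator_def)
    qed
    finally show ?thesis .
  qed
  have "LS_neg_integral \<phi> h = (SUP \<epsilon>\<in>{0<..}. \<integral>\<^sup>+s\<in>S \<epsilon>. ?d s * h (\<rho> s) \<partial>lborel)"
    unfolding LS_neg_integral_def using int by (intro SUP_cong) auto
  also have "\<dots> = (\<integral>\<^sup>+s\<in>S 0. ?d s * h (\<rho> s) \<partial>lborel)"
  proof (rule antisym)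
    show "(SUP \<epsilon>\<in>{0<..}. \<integral>\<^sup>+s\<in>S \<epsilon>. ?d s * h (\<rho> s) \<partial>lborel) \<le> (\<integral>\<^sup>+s\<in>S 0. ?d s * h (\<rho> s) \<partial>lborel)"
    proof (intro SUP_least nn_integral_mono)
      fix \<epsilon> s :: real assume "\<epsilon> \<in> {0<..}"
      then show "?d s * h (\<rho> s) * indicator (S \<epsilon>) s \<le> ?d s * h (\<rho> s) * indicator (S 0) s"
        using S_sub[of \<epsilon>] by (auto simp: indicator_def)
    qed
    have "S 0 = (\<Union>n. S (1 / real (Suc n)))"
    proof (intro equalityI subsetI)
      fix s assume "s \<in> S 0"
      then obtain t u where "0 < t" "w t \<le> s" "s < w u" by (auto simp: S_def)
      moreover obtain n where "1 / real (Suc n) < t" using nat_approx_posE[OF \<open>0 < t\<close>] .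
      ultimately show "s \<in> (\<Union>n. S (1 / real (Suc n)))" unfolding S_def by blast
    next
      fix s assume "s \<in> (\<Union>n. S (1 / real (Suc n)))"
      then obtain n where "s \<in> S (1 / real (Suc n))" by auto
      then show "s \<in> S 0" using S_sub[of "1 / real (Suc n)"] by auto
    qed
    moreover have "incseq (\<lambda>n. S (1 / real (Suc n)))"
    proof (rule incseq_SucI)
      fix n
      have "1 / real (Suc (Suc n)) \<le> 1 / real (Suc n)" by (simp add: field_simps)
      then show "S (1 / real (Suc n)) \<le> S (1 / real (Suc (Suc n)))"
        unfolding S_def using le_less_trans by blast
    qed
    ultimately show "(\<integral>\<^sup>+s\<in>S 0. ?d s * h (\<rho> s) \<partial>lborel) \<le> (SUP \<epsilon>\<in>{0<..}. \<integral>\<^sup>+s\<in>S \<epsilon>. ?d s * h (\<rho> s) \<partial>lborel)"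
      by (simp only:) (rule set_nn_integral_UN_le, auto intro!: SUP_upper)
  qed
  also have "\<dots> = (\<integral>\<^sup>+s\<in>S 0. ?d s * h (Sup {t. w t \<le> s}) \<partial>lborel)"
    by (intro nn_integral_cong) (auto simp: indicator_def \<rho>_def)
  finally show ?thesis unfolding S_def .
qed

section \<open>Complementary local Morrey spaces\<close>

lemma mono_tendsto_right:
  fixes w :: "real \<Rightarrow> real"
  assumes "mono w"
  shows "(w \<longlongrightarrow> Inf (w ` {t<..})) (at_right t)"
proof (rule order_tendstoI)
  have bdd: "bdd_below (w ` {t<..})"
    using monoD[OF assms] by (intro bdd_belowI[of _ "w t"]) auto
  fix y assume y: "y < Inf (w ` {t<..})"
  have "y < w x" if "t < x" for x
    using that bdd y cInf_lower[of "w x" "w ` {t<..}"] by auto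
  then show "\<forall>\<^sub>F x in at_right t. y < w x"
    by (auto simp: eventually_at_filter)
next
  fix y assume "Inf (w ` {t<..}) < y"
  then obtain u where u: "t < u" "w u < y"
    using cInf_lessD[of "w ` {t<..}" y] by auto
  show "\<forall>\<^sub>F x in at_right t. w x < y"
    unfolding eventually_at_right[OF u(1)]
    using u monoD[OF assms, of _ u] by (intro exI[of _ u]) (metis le_less_trans less_imp_le)
qed

text \<open>U is (0,m], (0,m) or (0,\<infinity>). The exceptional point is genuine only if U has a
  maximum m, where the constant sequence m serves. In the applications it corresponds to a sphere or
  a single radius, which is null.\<close>

lemma down_closed_sequence:
  fixes U :: "real set"
  assumes "U \<noteq> {}" and down: "\<And>x y. y \<in> U \<Longrightarrow> 0 < x \<Longrightarrow> x \<le> y \<Longrightarrow> x \<in> U"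
    and pos: "\<And>x. x \<in> U \<Longrightarrow> 0 < x"
  obtains t m where "incseq t" "\<And>n::nat. t n \<in> U" "\<And>x. x \<in> U \<Longrightarrow> (\<exists>n. x < t n) \<or> x = m"
proof (cases "\<exists>m\<in>U. \<forall>y\<in>U. y \<le> m")
  case True
  then obtain m where "m \<in> U" "\<And>y. y \<in> U \<Longrightarrow> y \<le> m" by auto
  then show thesis by (intro that[of "\<lambda>_. m" m]) force+
next
  case nomax: False
  obtain u where u: "u \<in> U" using assms by auto
  show thesis
  proof (cases "bdd_above U")
    case False
    have "real (Suc n) \<in> U" for n
    proof -
      obtain y where "y \<in> U" "real (Suc n) < y" using False by (force simp: bdd_above_def not_le)
      then show ?thesis using down[of y "real (Suc n)"] by auto
    qed
    moreover have "\<exists>n. x < real (Suc n)" for x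
      using reals_Archimedean2[of x] by (metis less_trans lessI of_nat_less_iff)
    ultimately show thesis by (intro that[of "\<lambda>n. real (Suc n)" 0]) (auto simp: incseq_def)
  next
    case True
    define \<rho> where "\<rho> = Sup U"
    have less: "y < \<rho>" if "y \<in> U" for y
      using that nomax cSup_upper[OF _ True] unfolding \<rho>_def
      by (metis order_le_less)
    have mem: "y \<in> U" if "0 < y" "y < \<rho>" for y
      using that less_cSupE[of y U] assms down unfolding \<rho>_def by (metis less_imp_le)
    \<comment> \<open>The maximum with u keeps the radius positive, hence inside U.\<close>
    define t where "t n = max u (\<rho> - 1 / real (Suc n))" for n
    have "t n \<in> U" for n
      using u less[OF u] pos[OF u] by (auto simp: t_def max_def intro!: mem)
    moreover have "incseq t"
      unfolding incseq_Suc_iff t_def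
    proof
      fix n
      have "1 / real (Suc (Suc n)) \<le> 1 / real (Suc n)" by (simp add: field_simps)
      then show "max u (\<rho> - 1 / real (Suc n)) \<le> max u (\<rho> - 1 / real (Suc (Suc n)))" by linarith
    qed
    moreover have "\<exists>n. x < t n" if x: "x \<in> U" for x
    proof -
      obtain n where "1 / real (Suc n) < \<rho> - x" using nat_approx_posE[of "\<rho> - x"] less[OF x] by auto
      then show ?thesis by (intro exI[of _ n]) (auto simp: t_def)
    qed
    ultimately show thesis by (intro that[of t 0]) auto
  qed
qed

lemma lnorm_mono_AE:
  assumes "0 < \<theta>" "AE x in M. x \<in> A \<longrightarrow> x \<in> B \<and> g x \<le> g' x"
  shows "lnorm \<theta> M A g \<le> lnorm \<theta> M B g'"
proof (cases "\<theta> = \<infinity>")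
  case True
  show ?thesis unfolding lnorm_def using True
    by (auto intro!: Inf_superset_mono elim!: eventually_elim2[OF assms(2)] intro: order_trans)
next
  case False
  have "(\<integral>\<^sup>+x\<in>A. epowr (g x) (enn2real \<theta>) \<partial>M) \<le> (\<integral>\<^sup>+x\<in>B. epowr (g' x) (enn2real \<theta>) \<partial>M)"
    using assms(2)
    by (intro nn_integral_mono_AE) (auto elim!: eventually_mono simp: indicator_def intro!: epowr_mono)
  with False show ?thesis unfolding lnorm_def by (auto intro!: epowr_mono)
qed

lemma AE_norm_neq: "AE x in lebesgue. norm (x::'a::euclidean_space) \<noteq> r"
proof -
  have "sphere (0::'a) r \<in> null_sets lebesgue"
    using negligible_sphere[of "0::'a" r] by (simp add: negligible_iff_null_sets)
  then have "AE x in lebesgue. x \<notin> sphere (0::'a) r" by (rule AE_not_in)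
  then show ?thesis by eventually_elim auto
qed

lemma AE_lebesgue_neq: "AE x in lebesgue. x \<noteq> (r::real)"
  using AE_not_in[of "{r}" lebesgue] by (simp add: null_sets_completionI)

lemma borel_imp_lebesgue_measurable:
  "f \<in> borel_measurable borel \<Longrightarrow> f \<in> borel_measurable lebesgue"
  by (simp add: measurable_completion)

section \<open>The setting and the function W\<close>

locale complementary_morrey =
  fixes p :: real and \<theta> :: ennreal and \<omega> :: "real \<Rightarrow> real"
    and v :: "'a::euclidean_space \<Rightarrow> real"
  assumes p: "1 \<le> p" and \<theta>: "0 < \<theta>"
    and \<omega>: "\<omega> \<in> cOmega \<theta>" and v: "v \<in> Wclass"
begin

lemma v_measurable [measurable]: "v \<in> borel_measurable lebesgue"
  using v by (simp add: Wclass_def)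

lemma \<omega>_measurable [measurable]: "\<omega> \<in> borel_measurable lebesgue"
  using \<omega> by (simp add: cOmega_def)

definition W :: "real \<Rightarrow> ennreal" where
  "W t = lnorm \<theta> lebesgue {0<..<t} (\<lambda>r. ennreal (\<omega> r))"

text \<open>\<open>W\<close> is finite for positive t by the condition on \<omega> and 0 otherwise,
  so this real version loses nothing.\<close>

definition w :: "real \<Rightarrow> real" where
  "w t = enn2real (W t)"

definition Winf :: ennreal where
  "Winf = lnorm \<theta> lebesgue {0<..} (\<lambda>r. ennreal (\<omega> r))"

lemma W_mono: "s \<le> t \<Longrightarrow> W s \<le> W t"
  unfolding W_def by (intro lnorm_mono_AE \<theta>) auto

lemma W_nonpos: "t \<le> 0 \<Longrightarrow> W t = 0"
proof -
  assume "t \<le> 0"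
  then have "{0<..<t} = {}" by auto
  then show ?thesis unfolding W_def lnorm_def by (auto simp: bot_ennreal)
qed

lemma W_eq: "W t = ennreal (w t)"
proof (cases "0 < t")
  case True
  then have "W t < \<infinity>" using \<omega> by (auto simp: cOmega_def W_def)
  then show ?thesis by (simp add: w_def ennreal_enn2real)
qed (simp add: w_def W_nonpos)

lemma w_pos: "0 < t \<Longrightarrow> 0 < w t"
  using \<omega> W_eq[of t] by (auto simp: cOmega_def W_def)

lemma w_nonneg: "0 \<le> w t"
  by (simp add: w_def)

lemma w_nonpos: "t \<le> 0 \<Longrightarrow> w t = 0"
  by (simp add: w_def W_nonpos)

lemma mono_w: "mono w"
  using W_mono by (intro monoI) (simp add: W_eq w_nonneg)

lemma w_mono: "s \<le> t \<Longrightarrow> w s \<le> w t"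
  using mono_w by (rule monoD)

lemma w_measurable [measurable]: "w \<in> borel_measurable borel"
  using mono_w by (rule borel_measurable_mono)

lemma w_norm_measurable [measurable]: "(\<lambda>x::'a. w (norm x)) \<in> borel_measurable lebesgue"
  by (rule borel_imp_lebesgue_measurable) measurable

lemma W_le_Winf: "W t \<le> Winf"
  unfolding W_def Winf_def by (intro lnorm_mono_AE \<theta>) auto

lemma Winf_pos: "0 < Winf"
proof -
  have "0 < ennreal (w 1)" using w_pos[of 1] by simp
  also have "\<dots> \<le> Winf" using W_le_Winf[of 1] by (simp add: W_eq)
  finally show ?thesis .
qed

lemma W_eq_integral:
  assumes "\<theta> \<noteq> \<infinity>"
  shows "(\<integral>\<^sup>+r\<in>{0<..<t}. epowr (ennreal (\<omega> r)) (enn2real \<theta>) \<partial>lebesgue) = ennreal (w t powr enn2real \<theta>)"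
proof -
  have "0 < enn2real \<theta>" using \<theta> assms by (simp add: enn2real_positive_iff less_top)
  then have "(\<integral>\<^sup>+r\<in>{0<..<t}. epowr (ennreal (\<omega> r)) (enn2real \<theta>) \<partial>lebesgue) = epowr (W t) (enn2real \<theta>)"
    using assms by (simp add: W_def lnorm_def epowr_epowr)
  then show ?thesis by (simp add: W_eq epowr_ennreal w_nonneg)
qed

lemma enn2real_\<theta>_pos: "\<theta> \<noteq> \<infinity> \<Longrightarrow> 0 < enn2real \<theta>"
  using \<theta> by (simp add: enn2real_positive_iff less_top)

text \<open>With \<open>W_le_Winf\<close> this identifies \<open>Winf\<close> as the supremum of
  \<open>w\<close>, by continuity from below along (0,n).\<close>

lemma Winf_le:
  assumes "\<And>t. w t \<le> s"
  shows "Winf \<le> ennreal s"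
proof -
  have s: "0 \<le> s" using assms[of 0] w_nonneg[of 0] by linarith
  have incs: "incseq (\<lambda>n. {0<..<real n})" by (auto simp: incseq_def)
  have un: "(\<Union>n. {0<..<real n}) = {0<..}" by (auto simp: reals_Archimedean2)
  show ?thesis
  proof (cases "\<theta> = \<infinity>")
    case True
    have "AE r in lebesgue. r \<in> {0<..<real n} \<longrightarrow> ennreal (\<omega> r) \<le> ennreal s" for n
    proof -
      have "Inf {c. AE r in lebesgue. r \<in> {0<..<real n} \<longrightarrow> ennreal (\<omega> r) \<le> c} \<le> ennreal s"
        using W_eq[of "real n"] ennreal_leI[OF assms[of "real n"]] True unfolding W_def lnorm_def by simp
      then show ?thesis
        using AE_le_Inf_AE[where M = lebesgue and A = "{0<..<real n}" and g = "\<lambda>r. ennreal (\<omega> r)"]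
        by (auto elim!: eventually_mono)
    qed
    then have "AE r in lebesgue. \<forall>n. r \<in> {0<..<real n} \<longrightarrow> ennreal (\<omega> r) \<le> ennreal s"
      unfolding AE_all_countable by blast
    then have "AE r in lebesgue. r \<in> {0<..} \<longrightarrow> ennreal (\<omega> r) \<le> ennreal s"
      unfolding un[symmetric] by eventually_elim auto
    then show ?thesis unfolding Winf_def lnorm_def using True by (auto intro!: Inf_lower)
  next
    case False
    note a = enn2real_\<theta>_pos[OF False]
    have "(\<integral>\<^sup>+r\<in>{0<..}. epowr (ennreal (\<omega> r)) (enn2real \<theta>) \<partial>lebesgue) \<le> ennreal (s powr enn2real \<theta>)"
      unfolding un[symmetric]
    proof (rule set_nn_integral_UN_le[OF incs])
      fix n
      show "(\<integral>\<^sup>+r\<in>{0<..<real n}. epowr (ennreal (\<omega> r)) (enn2real \<theta>) \<partial>lebesgue) \<le> ennreal (s powr enn2real \<theta>)"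
        unfolding W_eq_integral[OF False] using assms a w_nonneg
        by (intro ennreal_leI powr_mono2) auto
    qed auto
    then have "epowr (\<integral>\<^sup>+r\<in>{0<..}. epowr (ennreal (\<omega> r)) (enn2real \<theta>) \<partial>lebesgue) (1 / enn2real \<theta>)
        \<le> epowr (ennreal (s powr enn2real \<theta>)) (1 / enn2real \<theta>)"
      using a by (intro epowr_mono) auto
    then show ?thesis using False a s by (simp add: Winf_def lnorm_def epowr_ennreal powr_powr)
  qed
qed

section \<open>Level sets of W(|x|) and the norms over them\<close>

definition D :: "real \<Rightarrow> 'a set" where
  "D s = {x. w (norm x) \<le> s}"

lemma D_measurable [measurable]: "D s \<in> sets lebesgue"
proof -
  have "{x \<in> space lebesgue. w (norm (x::'a)) \<le> s} \<in> sets lebesgue" by measurable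
  then show ?thesis by (simp add: D_def)
qed

definition \<Phi> :: "('a \<Rightarrow> real) \<Rightarrow> real \<Rightarrow> ennreal" where
  "\<Phi> f s = Nfun p v (D s) f"

definition G :: "('a \<Rightarrow> real) \<Rightarrow> real \<Rightarrow> ennreal" where
  "G h s = epowr (Mint p v (- D s) h) (1 / p)"

definition g :: "('a \<Rightarrow> real) \<Rightarrow> real \<Rightarrow> ennreal" where
  "g h r = epowr (cball_int p v h r) (1 / p)"

lemma cball_int_eq: "cball_int p v h r = Mint p v (- ball 0 r) h"
  by (simp add: cball_int_def Mint_def)

lemma mono_\<Phi>: "mono (\<Phi> f)"
  unfolding \<Phi>_def D_def by (intro monoI Nfun_mono_AE p) auto

lemma antimono_G: "antimono (G h)"
  unfolding G_def D_def using p by (intro antimonoI epowr_mono Mint_mono) auto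

lemma antimono_g: "antimono (g h)"
  unfolding g_def cball_int_eq using p by (intro antimonoI epowr_mono Mint_mono) auto

lemma mono_Nfun_ball: "mono (\<lambda>t. Nfun p v (ball 0 t) f)"
  by (intro monoI Nfun_mono_AE p) auto

lemma \<Phi>_measurable [measurable]: "\<Phi> f \<in> borel_measurable borel"
  using mono_\<Phi> by (rule borel_measurable_mono_ennreal)

lemma G_measurable [measurable]: "G h \<in> borel_measurable borel"
  using antimono_G by (rule borel_measurable_antimono_ennreal)

lemma g_measurable [measurable]: "g h \<in> borel_measurable lebesgue"
  by (intro borel_imp_lebesgue_measurable borel_measurable_antimono_ennreal antimono_g)

lemma Nfun_empty: "Nfun p v {} f = 0"
  using p by (auto simp: Nfun_def Let_def bot_ennreal)

lemma Nfun_ball_le_\<Phi>: "w t \<le> s \<Longrightarrow> Nfun p v (ball 0 t) f \<le> \<Phi> f s"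
  unfolding \<Phi>_def D_def
  by (intro Nfun_mono_AE p AE_I2) (auto intro: order_trans[OF w_mono[OF less_imp_le]])

text \<open>Balls with W(t) \<le> s exhaust the level set up to a null set; if there are none, the
  level set is at most the origin. Together with \<open>Nfun_ball_le_\<Phi>\<close> this makes
  \<Phi> f s the supremum of N over these balls.\<close>

lemma \<Phi>_le:
  assumes [measurable]: "f \<in> borel_measurable lebesgue"
    and le: "\<And>t. 0 < t \<Longrightarrow> w t \<le> s \<Longrightarrow> Nfun p v (ball 0 t) f \<le> c"
  shows "\<Phi> f s \<le> c"
proof -
  let ?U = "{t. 0 < t \<and> w t \<le> s}"
  show ?thesis
  proof (cases "?U = {}")
    case True
    have "Nfun p v (D s) f \<le> Nfun p v {} f"
      using True AE_norm_neq[of 0] by (intro Nfun_mono_AE p) (auto simp: D_def elim!: eventually_mono)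
    then show ?thesis by (simp add: \<Phi>_def Nfun_empty)
  next
    case False
    then obtain t m where t: "incseq t" "\<And>n::nat. t n \<in> ?U" "\<And>x. x \<in> ?U \<Longrightarrow> (\<exists>n. x < t n) \<or> x = m"
      by (rule down_closed_sequence) (auto intro: order_trans[OF w_mono])
    have "Nfun p v (D s) f \<le> Nfun p v (\<Union>n. ball 0 (t n)) f"
    proof (intro Nfun_mono_AE p)
      show "AE x in lebesgue. x \<in> D s \<longrightarrow> x \<in> (\<Union>n. ball 0 (t n))"
        using AE_norm_neq[of 0] AE_norm_neq[of m]
      proof eventually_elim
        fix x :: 'a assume "norm x \<noteq> 0" "norm x \<noteq> m"
        then show "x \<in> D s \<longrightarrow> x \<in> (\<Union>n. ball 0 (t n))"
          using t(3)[of "norm x"] by (auto simp: D_def)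
      qed
    qed
    also have "\<dots> \<le> c"
      using t le by (intro Nfun_UN_le p) (auto simp: incseq_def subset_ball)
    finally show ?thesis by (simp add: \<Phi>_def)
  qed
qed

text \<open>The level set is an open ball up to its sphere. The bounds on s make the radius, a
  generalised inverse of w, positive and finite.\<close>

lemma \<Phi>_eq_ball:
  assumes f: "f \<in> borel_measurable lebesgue" and s: "0 < t" "w t \<le> s" "s < w u"
  shows "\<Phi> f s = Nfun p v (ball 0 (Sup {t. w t \<le> s})) f"
proof (rule antisym)
  have bdd: "bdd_above {t. w t \<le> s}"
    using s(3) w_mono by (intro bdd_aboveI[of _ u]) (metis linorder_le_cases mem_Collect_eq not_le order_trans)
  show "\<Phi> f s \<le> Nfun p v (ball 0 (Sup {t. w t \<le> s})) f"
    using bdd by (intro \<Phi>_le f Nfun_mono_AE p) (auto intro!: AE_I2 intro: less_le_trans cSup_upper)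
  show "Nfun p v (ball 0 (Sup {t. w t \<le> s})) f \<le> \<Phi> f s"
    unfolding \<Phi>_def
  proof (intro Nfun_mono_AE p AE_I2 impI)
    fix x :: 'a assume "x \<in> ball 0 (Sup {t. w t \<le> s})"
    then obtain t where "w t \<le> s" "norm x < t"
      using less_cSupE[of "norm x" "{t. w t \<le> s}"] s by auto
    then show "x \<in> D s" using w_mono[of "norm x" t] by (auto simp: D_def)
  qed
qed

text \<open>If nonempty, {W(|x|) > s} is the complement of an open or of a closed ball, depending on
  whether W exceeds s already at the critical radius. In the second case complements of slightly
  larger balls exhaust it. The passage from levels to radii thus keeps s < w r strict.\<close>

lemma less_Mint_D:
  assumes [measurable]: "h \<in> borel_measurable lebesgue" and s: "0 \<le> s"
    and less: "c < Mint p v (- D s) h"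
  shows "\<exists>r>0. s < w r \<and> c < cball_int p v h r"
proof (rule ccontr)
  assume none: "\<not> (\<exists>r>0. s < w r \<and> c < cball_int p v h r)"
  have le: "Mint p v (- ball 0 r) h \<le> c" if "s < w r" for r
    using none that s w_nonpos[of r] unfolding cball_int_eq
    by (cases "0 < r") (auto simp: not_less dest: leD)
  let ?U = "{t. s < w t}"
  have D: "- D s = {x. norm x \<in> ?U}" by (auto simp: D_def)
  have bdd: "bdd_below ?U"
    using s w_nonpos by (intro bdd_belowI[of _ 0]) (metis linorder_le_cases mem_Collect_eq not_le)
  consider "?U = {}" | m where "m \<in> ?U" "\<And>t. t \<in> ?U \<Longrightarrow> m \<le> t"
    | "?U \<noteq> {}" "\<And>m. m \<in> ?U \<Longrightarrow> \<exists>t\<in>?U. t < m" by (metis not_le)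
  then have "Mint p v (- D s) h \<le> c"
  proof cases
    case 1
    then show ?thesis unfolding D by (simp add: Mint_def)
  next
    case 2
    then have "- D s \<subseteq> - ball 0 m" unfolding D by (smt (verit) Compl_iff mem_Collect_eq mem_ball_0 subsetI)
    then show ?thesis using Mint_mono le[of m] 2 by (metis mem_Collect_eq order_trans)
  next
    case 3
    define i where "i = Inf ?U"
    have lt: "i < t" if "t \<in> ?U" for t
      using 3(2)[OF that] cInf_lower[OF _ bdd] unfolding i_def by (meson le_less_trans)
    have mem: "t \<in> ?U" if it: "i < t" for t
    proof -
      obtain u where "u \<in> ?U" "u < t" using it cInf_lessD[OF 3(1), of t] unfolding i_def by auto
      then show ?thesis using w_mono[of u t] by auto
    qed
    have "- D s = (\<Union>n. - ball 0 (i + 1 / real (Suc n)))"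
    proof (intro equalityI subsetI)
      fix x assume "x \<in> - D s"
      then have "0 < norm x - i" unfolding D using lt by auto
      then obtain n where "1 / real (Suc n) < norm x - i" by (rule nat_approx_posE)
      then show "x \<in> (\<Union>n. - ball 0 (i + 1 / real (Suc n)))" by (auto intro!: exI[of _ n])
    next
      fix x :: 'a assume "x \<in> (\<Union>n. - ball 0 (i + 1 / real (Suc n)))"
      then obtain n where "i + 1 / real (Suc n) \<le> norm x" by (auto simp: not_less simp del: of_nat_Suc)
      then have "i < norm x" by (smt (verit) divide_pos_pos of_nat_0_less_iff zero_less_Suc)
      then show "x \<in> - D s" unfolding D using mem by blast
    qed
    moreover have "incseq (\<lambda>n. - ball (0::'a) (i + 1 / real (Suc n)))"
    proof (rule incseq_SucI)
      fix n
      have "1 / real (Suc (Suc n)) \<le> 1 / real (Suc n)" by (simp add: field_simps)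
      then show "- ball (0::'a) (i + 1 / real (Suc n)) \<le> - ball 0 (i + 1 / real (Suc (Suc n)))"
        by (simp add: subset_ball)
    qed
    moreover have "Mint p v (- ball 0 (i + 1 / real (Suc n))) h \<le> c" for n
      using mem[of "i + 1 / real (Suc n)"] by (intro le) auto
    ultimately show ?thesis
      unfolding Mint_def by (simp only:) (rule set_nn_integral_UN_le, auto)
  qed
  with less show False by simp
qed

text \<open>Averaging over the dyadic bands \<open>s/2 < W(|x|) \<le> s\<close> with respect to \<open>ds/s\<close> replaces the
  usual discretisation of \<open>W\<close>.\<close>

lemma nn_integral_mult_le_bands:
  assumes [measurable]: "f \<in> borel_measurable lebesgue" "h \<in> borel_measurable lebesgue"
  shows "(\<integral>\<^sup>+x. ennreal \<bar>f x * h x\<bar> \<partial>lebesgue)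
    \<le> (\<integral>\<^sup>+s\<in>{0<..}. ennreal (2 / s) * (\<Phi> f s * G h (s / 2)) \<partial>lborel)"
proof -
  interpret P: pair_sigma_finite "lebesgue :: 'a measure" "lborel :: real measure" ..
  let ?k = "\<lambda>x. ennreal \<bar>f x * h x\<bar>"
  let ?b = "\<lambda>x s. of_bool (0 < s \<and> w (norm x) \<le> s \<and> s / 2 < w (norm x)) :: ennreal"
  \<comment> \<open>With y = W(|x|) the admissible levels form [y, 2y), an interval of length y on
    which 2/s exceeds 1/y.\<close>
  have one: "1 \<le> (\<integral>\<^sup>+s. ennreal (2 / s) * ?b x s \<partial>lborel)" if "norm x \<noteq> 0" for x :: 'a
  proof -
    define y where "y = w (norm x)"
    have y: "0 < y" unfolding y_def using that by (intro w_pos) auto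
    have "1 = ennreal (1 / y) * ennreal y" using y by (simp flip: ennreal_mult)
    also have "\<dots> = (\<integral>\<^sup>+s. ennreal (1 / y) * indicator {y..<2 * y} s \<partial>lborel)"
      using y by (simp add: nn_integral_cmult_indicator)
    also have "\<dots> \<le> (\<integral>\<^sup>+s. ennreal (2 / s) * ?b x s \<partial>lborel)"
    proof (intro nn_integral_mono)
      fix s
      have "1 / y \<le> 2 / s" if "y \<le> s" "s < 2 * y" using that y by (simp add: field_simps)
      then show "ennreal (1 / y) * indicator {y..<2 * y} s \<le> ennreal (2 / s) * ?b x s"
        using y by (auto simp: indicator_def y_def[symmetric] intro!: ennreal_leI)
    qed
    finally show ?thesis .
  qed
  have "(\<integral>\<^sup>+x. ?k x \<partial>lebesgue) \<le> (\<integral>\<^sup>+x. (\<integral>\<^sup>+s. ?k x * (ennreal (2 / s) * ?b x s) \<partial>lborel) \<partial>lebesgue)"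
  proof (intro nn_integral_mono_AE, use AE_norm_neq[of 0] in eventually_elim)
    fix x :: 'a assume "norm x \<noteq> 0"
    then have "?k x * 1 \<le> ?k x * (\<integral>\<^sup>+s. ennreal (2 / s) * ?b x s \<partial>lborel)"
      by (intro mult_left_mono one) auto
    also have "\<dots> = (\<integral>\<^sup>+s. ?k x * (ennreal (2 / s) * ?b x s) \<partial>lborel)"
      by (rule nn_integral_cmult[symmetric]) measurable
    finally show "?k x \<le> (\<integral>\<^sup>+s. ?k x * (ennreal (2 / s) * ?b x s) \<partial>lborel)" by simp
  qed
  also have "\<dots> = (\<integral>\<^sup>+s. (\<integral>\<^sup>+x. ?k x * (ennreal (2 / s) * ?b x s) \<partial>lebesgue) \<partial>lborel)"
    by (rule P.Fubini'[symmetric]) measurable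
  also have "\<dots> \<le> (\<integral>\<^sup>+s\<in>{0<..}. ennreal (2 / s) * (\<Phi> f s * G h (s / 2)) \<partial>lborel)"
  proof (intro nn_integral_mono)
    fix s :: real
    show "(\<integral>\<^sup>+x. ?k x * (ennreal (2 / s) * ?b x s) \<partial>lebesgue)
        \<le> ennreal (2 / s) * (\<Phi> f s * G h (s / 2)) * indicator {0<..} s"
    proof (cases "0 < s")
      case True
      let ?A = "D s - D (s / 2)"
      have "(\<integral>\<^sup>+x. ?k x * (ennreal (2 / s) * ?b x s) \<partial>lebesgue)
          = (\<integral>\<^sup>+x. ennreal (2 / s) * (?k x * indicator ?A x) \<partial>lebesgue)"
        using True by (intro nn_integral_cong) (auto simp: D_def indicator_def mult_ac)
      also have "\<dots> = ennreal (2 / s) * (\<integral>\<^sup>+x\<in>?A. ?k x \<partial>lebesgue)"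
        by (rule nn_integral_cmult) measurable
      \<comment> \<open>Hoelder's inequality on a single band. The band is then enlarged separately
        for f and for h, so that each factor becomes monotone in s.\<close>
      also have "\<dots> \<le> ennreal (2 / s) * (Nfun p v ?A f * epowr (Mint p v ?A h) (1 / p))"
        by (intro mult_left_mono Holder_Nfun p v) auto
      also have "\<dots> \<le> ennreal (2 / s) * (\<Phi> f s * G h (s / 2))"
        unfolding \<Phi>_def G_def using p
        by (intro mult_left_mono mult_mono Nfun_mono_AE epowr_mono Mint_mono) auto
      finally show ?thesis using True by simp
    next
      case False
      then have "(\<integral>\<^sup>+x. ?k x * (ennreal (2 / s) * ?b x s) \<partial>lebesgue) = integral\<^sup>N lebesgue (\<lambda>x::'a. 0)"
        by (intro nn_integral_cong) auto
      then show ?thesis by simp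
    qed
  qed
  finally show ?thesis .
qed

text \<open>Both sides are layer-cake integrals. If G h (s/2) lies above some value, then so does g
  h r for some r with W(r) > s/2, hence g h on all of (0,r), where \<omega>^\<theta> has mass
  W(r)^\<theta> > (s/2)^\<theta>. So s is at most twice the root of order \<theta> of the
  \<omega>^\<theta>-mass of the superlevel set of g h.\<close>

lemma G_integral_le_Xnorm:
  assumes fin: "\<theta> \<noteq> \<infinity>" and h: "h \<in> borel_measurable lebesgue"
  defines "a \<equiv> enn2real \<theta>"
  shows "epowr (\<integral>\<^sup>+s\<in>{0<..}. ennreal (a * s powr (a - 1)) * epowr (G h (s / 2)) a \<partial>lborel) (1 / a)
    \<le> 2 * Xnorm p \<theta> \<omega> v h"
proof -
  have a: "0 < a" unfolding a_def using fin by (rule enn2real_\<theta>_pos)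
  let ?w1 = "\<lambda>s. ennreal (a * s powr (a - 1)) * indicator {0<..} s"
  let ?w2 = "\<lambda>r. epowr (ennreal (\<omega> r)) a * indicator {0<..} r"
  let ?F1 = "\<lambda>s. epowr (G h (s / 2)) a" and ?F2 = "\<lambda>r. epowr (g h r) a"
  let ?R = "\<lambda>u. (\<integral>\<^sup>+r. ?w2 r * indicator {r. ennreal u < ?F2 r} r \<partial>lebesgue)"
  have level: "(\<integral>\<^sup>+s. ?w1 s * indicator {s. ennreal u < ?F1 s} s \<partial>lborel) \<le> ennreal (2 powr a) * ?R u" (is "?L \<le> _") for u
  proof (cases "?R u = \<infinity>")
    case True
    then show ?thesis by (simp add: ennreal_mult_top)
  next
    case False
    \<comment> \<open>This upper bound for s is chosen so that the density a s^(a-1) has mass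
      exactly 2^a times \<open>?R u\<close> on (0,z].\<close>
    define z where "z = 2 * enn2real (?R u) powr (1 / a)"
    have z: "0 \<le> z" "ennreal (z powr a) = ennreal (2 powr a) * ?R u"
      using False a by (auto simp: z_def powr_mult powr_powr ennreal_mult ennreal_enn2real less_top)
    have le_z: "s \<le> z" if s: "0 < s" "ennreal u < ?F1 s" for s
    proof -
      let ?c = "epowr (ennreal u) (p / a)"
      have "ennreal u < epowr (Mint p v (- D (s / 2)) h) (a / p)"
        using s by (simp add: G_def epowr_epowr)
      then have "?c < epowr (epowr (Mint p v (- D (s / 2)) h) (a / p)) (p / a)"
        using a p by (subst epowr_less_iff) auto
      then have "?c < Mint p v (- D (s / 2)) h"
        using a p by (simp add: epowr_epowr)
      then obtain r where r: "0 < r" "s / 2 < w r" "?c < cball_int p v h r"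
        using less_Mint_D[OF h, of "s / 2" ?c] s by auto
      then have "epowr ?c (a / p) < epowr (cball_int p v h r) (a / p)"
        using a p by (subst epowr_less_iff) auto
      then have ur: "ennreal u < ?F2 r"
        using a p by (simp add: epowr_epowr g_def)
      have "ennreal ((s / 2) powr a) \<le> ennreal (w r powr a)"
        using r s a by (intro ennreal_leI powr_mono2) auto
      also have "\<dots> = (\<integral>\<^sup>+r\<in>{0<..<r}. epowr (ennreal (\<omega> r)) a \<partial>lebesgue)"
        unfolding a_def by (rule W_eq_integral[OF fin, symmetric])
      also have "\<dots> \<le> ?R u"
      proof (intro nn_integral_mono)
        fix t
        have "ennreal u < ?F2 t" if "t < r"
        proof -
          have "?F2 r \<le> ?F2 t" using that a by (intro epowr_mono antimonoD[OF antimono_g]) auto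
          then show ?thesis using ur by (rule less_le_trans[rotated])
        qed
        then show "epowr (ennreal (\<omega> t)) a * indicator {0<..<r} t
            \<le> ?w2 t * indicator {r. ennreal u < ?F2 r} t"
          by (auto simp: indicator_def)
      qed
      finally have "ennreal (2 powr a) * ennreal ((s / 2) powr a) \<le> ennreal (z powr a)"
        unfolding z(2) by (rule mult_left_mono) simp
      then have "s powr a \<le> z powr a"
        using s by (simp add: powr_divide flip: ennreal_mult)
      then show ?thesis using a s z by (metis less_eq_real_def not_less powr_less_mono2)
    qed
    have "?L \<le> (\<integral>\<^sup>+s\<in>{0<..z}. ennreal (a * s powr (a - 1)) \<partial>lborel)"
      using le_z by (intro nn_integral_mono) (auto simp: indicator_def)
    also have "\<dots> = ennreal (z powr a)" using z a by (intro nn_integral_powr_from_0) auto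
    finally show ?thesis using z by simp
  qed
  have "(\<integral>\<^sup>+s\<in>{0<..}. ennreal (a * s powr (a - 1)) * ?F1 s \<partial>lborel) = (\<integral>\<^sup>+s. ?w1 s * ?F1 s \<partial>lborel)"
    by (intro nn_integral_cong) (auto simp: mult_ac)
  also have "\<dots> = (\<integral>\<^sup>+u\<in>{0<..}. (\<integral>\<^sup>+s. ?w1 s * indicator {s. ennreal u < ?F1 s} s \<partial>lborel) \<partial>lborel)"
    by (rule nn_integral_layer_cake) (auto intro: sigma_finite_lborel)
  also have "\<dots> \<le> (\<integral>\<^sup>+u. ennreal (2 powr a) * (?R u * indicator {0<..} u) \<partial>lborel)"
    using level by (intro nn_integral_mono) (auto simp: indicator_def)
  also have "\<dots> = ennreal (2 powr a) * (\<integral>\<^sup>+u\<in>{0<..}. ?R u \<partial>lborel)"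
  proof (rule nn_integral_cmult)
    have "antimono ?R"
    proof (intro antimonoI nn_integral_mono)
      fix x y r :: real assume "x \<le> y"
      then have "ennreal x < ?F2 r" if "ennreal y < ?F2 r"
        using that ennreal_leI[of x y] by (meson le_less_trans)
      then show "?w2 r * indicator {r. ennreal y < ?F2 r} r \<le> ?w2 r * indicator {r. ennreal x < ?F2 r} r"
        by (auto simp: indicator_def)
    qed
    note [measurable] = borel_measurable_antimono_ennreal[OF this]
    show "(\<lambda>u. ?R u * indicator {0<..} u) \<in> borel_measurable lborel" by measurable
  qed
  also have "(\<integral>\<^sup>+u\<in>{0<..}. ?R u \<partial>lborel) = (\<integral>\<^sup>+r. ?w2 r * ?F2 r \<partial>lebesgue)"
  proof (rule nn_integral_layer_cake[OF sigma_finite_lebesgue, symmetric])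
    have [measurable]: "(\<lambda>x::real. x) \<in> borel_measurable lebesgue"
      by (rule borel_imp_lebesgue_measurable) simp
    show "?F2 \<in> borel_measurable lebesgue" "?w2 \<in> borel_measurable lebesgue" by measurable
  qed
  also have "\<dots> = epowr (Xnorm p \<theta> \<omega> v h) a"
    using a fin unfolding Xnorm_def lnorm_def a_def[symmetric]
    by (simp add: epowr_epowr epowr_mult g_def) (auto intro!: nn_integral_cong simp: mult_ac)
  finally have "epowr (\<integral>\<^sup>+s\<in>{0<..}. ennreal (a * s powr (a - 1)) * ?F1 s \<partial>lborel) (1 / a)
      \<le> epowr (ennreal (2 powr a) * epowr (Xnorm p \<theta> \<omega> v h) a) (1 / a)"
    using a by (intro epowr_mono) auto
  also have "\<dots> = 2 * Xnorm p \<theta> \<omega> v h"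
    using a by (simp add: epowr_mult epowr_epowr epowr_ennreal powr_powr)
  finally show ?thesis .
qed

text \<open>Endpoint substitute for the integral estimate. If G exceeded 1/s at s, then g would
  exceed 1/s on (0,r] for some r with W(r) > s. The norm bound would force \<omega> \<le> s almost
  everywhere on (0,r), that is W(r) \<le> s.\<close>

lemma G_le_infinity:
  assumes inf: "\<theta> = \<infinity>" and h: "h \<in> borel_measurable lebesgue"
    and X: "Xnorm p \<theta> \<omega> v h \<le> 1" and s: "0 < s"
  shows "G h s \<le> ennreal (1 / s)"
proof (rule ccontr)
  assume "\<not> G h s \<le> ennreal (1 / s)"
  then have "ennreal (1 / s) < epowr (Mint p v (- D s) h) (1 / p)" by (simp add: G_def)
  then have "epowr (ennreal (1 / s)) p < epowr (epowr (Mint p v (- D s) h) (1 / p)) p"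
    using p by (subst epowr_less_iff) auto
  then have "epowr (ennreal (1 / s)) p < Mint p v (- D s) h"
    using p by (simp add: epowr_epowr)
  then obtain r where r: "0 < r" "s < w r" "epowr (ennreal (1 / s)) p < cball_int p v h r"
    using less_Mint_D[OF h, of s "epowr (ennreal (1 / s)) p"] s by auto
  then have "epowr (epowr (ennreal (1 / s)) p) (1 / p) < g h r"
    unfolding g_def using p by (subst epowr_less_iff) auto
  then have gr: "ennreal (1 / s) < g h r"
    using p by (simp add: epowr_epowr)
  have "AE t in lebesgue. t \<in> {0<..} \<longrightarrow> ennreal (\<omega> t) * g h t \<le> 1"
    using AE_le_Inf_AE[where M = lebesgue and A = "{0<..}" and g = "\<lambda>t. ennreal (\<omega> t) * g h t"] X inf
    by (auto simp: Xnorm_def lnorm_def g_def elim!: eventually_mono)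
  then have "AE t in lebesgue. t \<in> {0<..<r} \<longrightarrow> ennreal (\<omega> t) \<le> ennreal s"
  proof eventually_elim
    fix t assume A: "t \<in> {0<..} \<longrightarrow> ennreal (\<omega> t) * g h t \<le> 1"
    show "t \<in> {0<..<r} \<longrightarrow> ennreal (\<omega> t) \<le> ennreal s"
    proof
      assume t: "t \<in> {0<..<r}"
      then have "ennreal (1 / s) \<le> g h t"
        using gr antimonoD[OF antimono_g, of t r h] by auto
      then have "ennreal (\<omega> t) * ennreal (1 / s) \<le> ennreal (\<omega> t) * g h t"
        by (rule mult_left_mono) simp
      also have "\<dots> \<le> 1" using A t by auto
      finally have "ennreal s * (ennreal (\<omega> t) * ennreal (1 / s)) \<le> ennreal s * 1"
        by (rule mult_left_mono) simp
      moreover have "ennreal s * (ennreal (\<omega> t) * ennreal (1 / s)) = ennreal (\<omega> t)"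
      proof -
        have "ennreal s * ennreal (1 / s) = 1" using s by (simp flip: ennreal_mult)
        then show ?thesis by (metis mult.left_commute mult.right_neutral)
      qed
      ultimately show "ennreal (\<omega> t) \<le> ennreal s" by simp
    qed
  qed
  then have "W r \<le> ennreal s" unfolding W_def lnorm_def using inf by (auto intro!: Inf_lower)
  then show False using r s by (simp add: W_eq)
qed

end

section \<open>Upper bounds\<close>

context complementary_morrey
begin

text \<open>The supremum R gives \<Phi> f s \<le> R s, which cancels the band weight 2/s down to 2.
  The constant collects this 2, the factor 1/\<theta> of \<open>nn_integral_antimono_le\<close> and
  the factor 2 of \<open>G_integral_le_Xnorm\<close>.\<close>

lemma assoc_norm_le_small_exponent:
  assumes \<theta>1: "\<theta> \<le> 1" and f [measurable]: "f \<in> borel_measurable lebesgue"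
  shows "assoc_norm p \<theta> \<omega> v f
    \<le> ennreal (4 / enn2real \<theta>) * (SUP t\<in>{0<..}. Nfun p v (ball 0 t) f / W t)"
  unfolding assoc_norm_def
proof (rule SUP_least)
  fix h assume "h \<in> {h \<in> Xspace p \<theta> \<omega> v. Xnorm p \<theta> \<omega> v h \<le> 1}"
  then have h [measurable]: "h \<in> borel_measurable lebesgue" and X: "Xnorm p \<theta> \<omega> v h \<le> 1"
    by (auto simp: Xspace_def)
  have fin: "\<theta> \<noteq> \<infinity>" using \<theta>1 by (auto simp: top_unique)
  define a where "a = enn2real \<theta>"
  have a: "0 < a" "a \<le> 1"
    using enn2real_\<theta>_pos[OF fin] enn2real_mono[OF \<theta>1] by (auto simp: a_def)
  define R where "R = (SUP t\<in>{0<..}. Nfun p v (ball 0 t) f / W t)"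
  have \<Phi>R: "\<Phi> f s \<le> R * ennreal s" if s: "0 < s" for s
  proof (rule \<Phi>_le[OF f])
    fix t assume t: "0 < t" "w t \<le> s"
    have "Nfun p v (ball 0 t) f = Nfun p v (ball 0 t) f / W t * W t"
      using w_pos[OF t(1)] by (simp add: W_eq ennreal_divide_times ennreal_mult_divide_eq)
    also have "\<dots> \<le> R * ennreal s"
      unfolding R_def using t by (intro mult_mono SUP_upper) (auto simp: W_eq intro: ennreal_leI)
    finally show "Nfun p v (ball 0 t) f \<le> R * ennreal s" .
  qed
  have anti: "antimono (\<lambda>s. G h (s / 2))"
    by (intro antimonoI antimonoD[OF antimono_G]) auto
  have "(\<integral>\<^sup>+x. ennreal \<bar>f x * h x\<bar> \<partial>lebesgue)
      \<le> (\<integral>\<^sup>+s\<in>{0<..}. ennreal (2 / s) * (\<Phi> f s * G h (s / 2)) \<partial>lborel)"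
    by (rule nn_integral_mult_le_bands) fact+
  also have "\<dots> \<le> (\<integral>\<^sup>+s. (2 * R) * (G h (s / 2) * indicator {0<..} s) \<partial>lborel)"
  proof (intro nn_integral_mono)
    fix s :: real
    have "ennreal (2 / s) * (\<Phi> f s * G h (s / 2)) \<le> (2 * R) * G h (s / 2)" if "0 < s"
    proof -
      have "ennreal (2 / s) * (\<Phi> f s * G h (s / 2)) \<le> ennreal (2 / s) * ((R * ennreal s) * G h (s / 2))"
        by (intro mult_left_mono mult_right_mono \<Phi>R that) auto
      also have "\<dots> = (ennreal (2 / s) * ennreal s) * R * G h (s / 2)" by (simp add: mult_ac)
      also have "ennreal (2 / s) * ennreal s = 2" using that by (simp flip: ennreal_mult)
      finally show ?thesis .
    qed
    then show "ennreal (2 / s) * (\<Phi> f s * G h (s / 2)) * indicator {0<..} s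
        \<le> (2 * R) * (G h (s / 2) * indicator {0<..} s)"
      by (auto simp: indicator_def)
  qed
  also have "\<dots> = (2 * R) * (\<integral>\<^sup>+s\<in>{0<..}. G h (s / 2) \<partial>lborel)"
    by (rule nn_integral_cmult) measurable
  also have "(\<integral>\<^sup>+s\<in>{0<..}. G h (s / 2) \<partial>lborel)
      \<le> ennreal (1 / a) * epowr (\<integral>\<^sup>+s\<in>{0<..}. ennreal (a * s powr (a - 1)) * epowr (G h (s / 2)) a \<partial>lborel) (1 / a)"
    using anti a by (rule nn_integral_antimono_le)
  also have "\<dots> \<le> ennreal (1 / a) * (2 * Xnorm p \<theta> \<omega> v h)"
    unfolding a_def by (intro mult_left_mono G_integral_le_Xnorm fin h) auto
  also have "\<dots> \<le> ennreal (1 / a) * (2 * 1)"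
    using X by (intro mult_left_mono) auto
  finally have "(\<integral>\<^sup>+x. ennreal \<bar>f x * h x\<bar> \<partial>lebesgue) \<le> (2 * R) * (ennreal (1 / a) * (2 * 1))"
    by (simp add: mult_left_mono)
  also have "\<dots> = ennreal (4 / a) * R"
  proof -
    have "ennreal (4 / a) = 2 * (ennreal (1 / a) * 2)"
      using a ennreal_mult[of 4 "1 / a"] by (simp add: mult_ac)
    then show ?thesis by (simp add: mult_ac)
  qed
  finally show "(\<integral>\<^sup>+x. ennreal \<bar>f x * h x\<bar> \<partial>lebesgue)
      \<le> ennreal (4 / enn2real \<theta>) * (SUP t\<in>{0<..}. Nfun p v (ball 0 t) f / W t)"
    by (simp add: a_def R_def)
qed

section \<open>The level integral for exponents above one\<close>

definition J :: "('a \<Rightarrow> real) \<Rightarrow> real \<Rightarrow> ennreal" where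
  "J f q = (\<integral>\<^sup>+s\<in>{0<..}. ennreal (q * s powr (- q - 1)) * epowr (\<Phi> f s) q \<partial>lborel)"

lemma conj_exp_gt_1:
  assumes "1 < \<theta>" "\<theta> \<noteq> \<infinity>"
  shows "1 < enn2real \<theta>" "1 < conj_exp \<theta>" "1 / enn2real \<theta> + 1 / conj_exp \<theta> = 1"
proof -
  obtain a where "\<theta> = ennreal a" "0 \<le> a" using assms by (cases \<theta>) auto
  with assms show *: "1 < enn2real \<theta>" by (metis enn2real_ennreal ennreal_1 ennreal_less_iff zero_le_one)
  then show "1 < conj_exp \<theta>" "1 / enn2real \<theta> + 1 / conj_exp \<theta> = 1"
    using assms by (auto simp: conj_exp_def field_simps)
qed

lemma conj_exp_ge_1: "1 < \<theta> \<Longrightarrow> 1 \<le> conj_exp \<theta>"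
  using conj_exp_gt_1 by (cases "\<theta> = \<infinity>") (auto simp: conj_exp_def)

text \<open>For finite \<theta> the band weight is distributed over the densities of d(s^\<theta>)
  and -d(s^(-\<theta>')); for \<theta> = \<infinity> the pointwise bound G h (s/2) \<le> 2/s takes
  the place of Hoelder's inequality. In both cases 4 is a factor 2 from the band weight times a
  factor 2 from the shift to s/2.\<close>

lemma assoc_norm_le_J:
  assumes \<theta>1: "1 < \<theta>" and f [measurable]: "f \<in> borel_measurable lebesgue"
  shows "assoc_norm p \<theta> \<omega> v f \<le> 4 * epowr (J f (conj_exp \<theta>)) (1 / conj_exp \<theta>)"
  unfolding assoc_norm_def
proof (rule SUP_least)
  fix h assume "h \<in> {h \<in> Xspace p \<theta> \<omega> v. Xnorm p \<theta> \<omega> v h \<le> 1}"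
  then have h [measurable]: "h \<in> borel_measurable lebesgue" and X: "Xnorm p \<theta> \<omega> v h \<le> 1"
    by (auto simp: Xspace_def)
  define q where "q = conj_exp \<theta>"
  have bands: "(\<integral>\<^sup>+x. ennreal \<bar>f x * h x\<bar> \<partial>lebesgue)
      \<le> (\<integral>\<^sup>+s\<in>{0<..}. ennreal (2 / s) * (\<Phi> f s * G h (s / 2)) \<partial>lborel)"
    by (rule nn_integral_mult_le_bands) fact+
  have "(\<integral>\<^sup>+x. ennreal \<bar>f x * h x\<bar> \<partial>lebesgue) \<le> 4 * epowr (J f q) (1 / q)"
  proof (cases "\<theta> = \<infinity>")
    case True
    then have q: "q = 1" by (simp add: q_def conj_exp_def)
    have "(\<integral>\<^sup>+s\<in>{0<..}. ennreal (2 / s) * (\<Phi> f s * G h (s / 2)) \<partial>lborel)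
        \<le> (\<integral>\<^sup>+s. 4 * (ennreal (1 * s powr (- 1 - 1)) * epowr (\<Phi> f s) 1 * indicator {0<..} s) \<partial>lborel)"
    proof (intro nn_integral_mono)
      fix s :: real
      have "ennreal (2 / s) * (\<Phi> f s * G h (s / 2)) \<le> 4 * (ennreal (s powr (- 2)) * \<Phi> f s)" if "0 < s"
      proof -
        have "ennreal (2 / s) * (\<Phi> f s * G h (s / 2)) \<le> ennreal (2 / s) * (\<Phi> f s * ennreal (1 / (s / 2)))"
          using that by (intro mult_left_mono G_le_infinity True h X) auto
        also have "\<dots> = (ennreal (2 / s) * ennreal (2 / s)) * \<Phi> f s" by (simp add: mult_ac)
        also have "ennreal (2 / s) * ennreal (2 / s) = 4 * ennreal (s powr (- 2))"
          using that ennreal_mult[of 4 "s powr (- 2)"]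
          by (simp add: powr_minus powr_numeral power2_eq_square divide_inverse flip: ennreal_mult)
        finally show ?thesis by (simp add: mult_ac)
      qed
      then show "ennreal (2 / s) * (\<Phi> f s * G h (s / 2)) * indicator {0<..} s
          \<le> 4 * (ennreal (1 * s powr (- 1 - 1)) * epowr (\<Phi> f s) 1 * indicator {0<..} s)"
        by (auto simp: indicator_def)
    qed
    also have "\<dots> = 4 * J f q" unfolding J_def q by (rule nn_integral_cmult) measurable
    finally show ?thesis using bands q by simp
  next
    case False
    define a where "a = enn2real \<theta>"
    note aq = conj_exp_gt_1[OF \<theta>1 False, folded a_def q_def]
    let ?f = "\<lambda>s. ennreal ((q * s powr (- q - 1)) powr (1 / q)) * \<Phi> f s * indicator {0<..} s"
    let ?g = "\<lambda>s. ennreal ((a * s powr (a - 1)) powr (1 / a)) * G h (s / 2) * indicator {0<..} s"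
    have "(\<integral>\<^sup>+s\<in>{0<..}. ennreal (2 / s) * (\<Phi> f s * G h (s / 2)) \<partial>lborel)
        \<le> (\<integral>\<^sup>+s. 2 * (?f s * ?g s) \<partial>lborel)"
    proof (intro nn_integral_mono)
      fix s :: real
      have "ennreal (2 / s) \<le> 2 * (ennreal ((q * s powr (- q - 1)) powr (1 / q)) * ennreal ((a * s powr (a - 1)) powr (1 / a)))"
        if s: "0 < s"
      proof -
        \<comment> \<open>The powers of s in the two densities multiply to exactly 1/s, and q powr
          (1 / q) and a powr (1 / a) are at least 1, so the product dominates 1/s.\<close>
        have exps: "(- q - 1) * (1 / q) + (a - 1) * (1 / a) = - 1"
          using aq by (simp add: diff_divide_distrib)
        have "1 * (1 * (1 / s)) \<le> q powr (1 / q) * (a powr (1 / a) * (1 / s))"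
          using aq s by (intro mult_mono ge_one_powr_ge_zero) auto
        also have inv_s: "1 / s = s powr ((- q - 1) * (1 / q)) * s powr ((a - 1) * (1 / a))"
          unfolding powr_add[symmetric] exps using s by (simp add: powr_minus divide_inverse)
        also have "q powr (1 / q) * (a powr (1 / a) * (s powr ((- q - 1) * (1 / q)) * s powr ((a - 1) * (1 / a))))
            = (q * s powr (- q - 1)) powr (1 / q) * (a * s powr (a - 1)) powr (1 / a)"
          using aq s by (simp add: powr_mult powr_powr mult_ac)
        finally have "1 / s \<le> (q * s powr (- q - 1)) powr (1 / q) * (a * s powr (a - 1)) powr (1 / a)"
          unfolding inv_s by (simp only: mult_1)
        then have "ennreal (2 * (1 / s)) \<le> ennreal (2 * ((q * s powr (- q - 1)) powr (1 / q) * (a * s powr (a - 1)) powr (1 / a)))"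
          by (intro ennreal_leI mult_left_mono) auto
        then show ?thesis by (simp add: ennreal_mult)
      qed
      then have "ennreal (2 / s) * (\<Phi> f s * G h (s / 2))
          \<le> (2 * (ennreal ((q * s powr (- q - 1)) powr (1 / q)) * ennreal ((a * s powr (a - 1)) powr (1 / a))))
            * (\<Phi> f s * G h (s / 2))" if "0 < s"
        using that by (intro mult_right_mono) auto
      then show "ennreal (2 / s) * (\<Phi> f s * G h (s / 2)) * indicator {0<..} s \<le> 2 * (?f s * ?g s)"
        by (auto simp: indicator_def mult_ac)
    qed
    also have "\<dots> = 2 * (\<integral>\<^sup>+s. ?f s * ?g s \<partial>lborel)" by (rule nn_integral_cmult) measurable
    also have "(\<integral>\<^sup>+s. ?f s * ?g s \<partial>lborel)
        \<le> epowr (\<integral>\<^sup>+s. epowr (?f s) q \<partial>lborel) (1 / q) * epowr (\<integral>\<^sup>+s. epowr (?g s) a \<partial>lborel) (1 / a)"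
      using aq by (intro nn_integral_Holder) auto
    also have "(\<integral>\<^sup>+s. epowr (?f s) q \<partial>lborel) = J f q"
      unfolding J_def using aq
      by (intro nn_integral_cong) (auto simp: indicator_def epowr_mult epowr_ennreal powr_powr)
    also have "(\<integral>\<^sup>+s. epowr (?g s) a \<partial>lborel)
        = (\<integral>\<^sup>+s\<in>{0<..}. ennreal (a * s powr (a - 1)) * epowr (G h (s / 2)) a \<partial>lborel)"
      using aq by (intro nn_integral_cong) (auto simp: indicator_def epowr_mult epowr_ennreal powr_powr)
    also have "epowr (\<integral>\<^sup>+s\<in>{0<..}. ennreal (a * s powr (a - 1)) * epowr (G h (s / 2)) a \<partial>lborel) (1 / a) \<le> 2 * Xnorm p \<theta> \<omega> v h"
      unfolding a_def by (intro G_integral_le_Xnorm False h)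
    also have "\<dots> \<le> 2 * 1" using X by (rule mult_left_mono) simp
    finally have "(\<integral>\<^sup>+s\<in>{0<..}. ennreal (2 / s) * (\<Phi> f s * G h (s / 2)) \<partial>lborel)
        \<le> 2 * (epowr (J f q) (1 / q) * (2 * 1))"
      by (simp add: mult_left_mono)
    also have "\<dots> = 2 * (2 * epowr (J f q) (1 / q))" by (simp add: mult_ac)
    also have "\<dots> = 4 * epowr (J f q) (1 / q)" by (simp flip: mult.assoc)
    finally show ?thesis using bands by (rule order_trans[rotated])
  qed
  then show "(\<integral>\<^sup>+x. ennreal \<bar>f x * h x\<bar> \<partial>lebesgue)
      \<le> 4 * epowr (J f (conj_exp \<theta>)) (1 / conj_exp \<theta>)"
    by (simp add: q_def)
qed

section \<open>The Stieltjes term expressed through levels\<close>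

definition LS :: "('a \<Rightarrow> real) \<Rightarrow> real \<Rightarrow> ennreal" where
  "LS f q = LS_neg_integral (\<lambda>t. enn2real (omega_norm_plus \<theta> \<omega> t) powr - q)
     (\<lambda>t. epowr (Nfun p v (ball 0 t) f) q)"

text \<open>A monotone function has its infimum to the right as right limit, so the
  \<open>Lim\<close> in the definition is a genuine finite limit.\<close>

lemma omega_norm_plus_eq: "enn2real (omega_norm_plus \<theta> \<omega> t) = Inf (w ` {t<..})"
proof -
  have "((\<lambda>s. W s) \<longlongrightarrow> ennreal (Inf (w ` {t<..}))) (at_right t)"
    unfolding W_eq by (intro tendsto_intros mono_tendsto_right mono_w)
  then have "omega_norm_plus \<theta> \<omega> t = ennreal (Inf (w ` {t<..}))"
    unfolding omega_norm_plus_def W_def by (intro tendsto_Lim) auto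
  moreover have "0 \<le> Inf (w ` {t<..})" using w_nonneg by (intro cInf_greatest) auto
  ultimately show ?thesis by simp
qed

text \<open>\<open>LS_neg_integral_eq\<close> moves the integral to the levels, where the ball at
  the generalised inverse of \<open>w\<close> agrees with the level set up to a null set.\<close>

lemma LS_eq:
  assumes q: "1 \<le> q" and f [measurable]: "f \<in> borel_measurable lebesgue"
  shows "LS f q = (\<integral>\<^sup>+s\<in>{s. (\<exists>t>0. w t \<le> s) \<and> (\<exists>t. s < w t)}.
      ennreal (q * s powr (- q - 1)) * epowr (\<Phi> f s) q \<partial>lborel)"
proof -
  have "mono (\<lambda>t. epowr (Nfun p v (ball 0 t) f) q)"
    using q by (intro monoI epowr_mono monoD[OF mono_Nfun_ball]) auto
  then have "LS f q = (\<integral>\<^sup>+s\<in>{s. (\<exists>t>0. w t \<le> s) \<and> (\<exists>t. s < w t)}.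
      ennreal (q * s powr (- q - 1)) * epowr (Nfun p v (ball 0 (Sup {t. w t \<le> s})) f) q \<partial>lborel)"
    unfolding LS_def using q w_pos
    by (intro LS_neg_integral_eq[where L = "\<lambda>t. Inf (w ` {t<..})"] mono_w mono_tendsto_right
        borel_measurable_mono_ennreal) (auto simp: omega_norm_plus_eq)
  also have "\<dots> = (\<integral>\<^sup>+s\<in>{s. (\<exists>t>0. w t \<le> s) \<and> (\<exists>t. s < w t)}.
      ennreal (q * s powr (- q - 1)) * epowr (\<Phi> f s) q \<partial>lborel)"
    by (intro nn_integral_cong) (auto simp: indicator_def \<Phi>_eq_ball[OF f])
  finally show ?thesis .
qed

lemma LS_le_J:
  assumes "1 \<le> q" "f \<in> borel_measurable lebesgue"
  shows "LS f q \<le> J f q"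
  unfolding LS_eq[OF assms] J_def
  using w_pos by (intro nn_integral_mono) (force simp: indicator_def intro: less_le_trans)

lemma \<Phi>_eq_0:
  assumes "f \<in> borel_measurable lebesgue" "\<And>t. 0 < t \<Longrightarrow> s < w t"
  shows "\<Phi> f s = 0"
proof -
  have "\<Phi> f s \<le> 0"
    by (rule \<Phi>_le[OF assms(1)]) (use assms(2) in \<open>auto dest: leD\<close>)
  then show ?thesis by simp
qed

lemma \<Phi>_eq_UNIV: "(\<And>t. w t \<le> s) \<Longrightarrow> \<Phi> f s = Nfun p v UNIV f"
  by (simp add: \<Phi>_def D_def)

text \<open>Besides the levels of the Stieltjes integral there are two kinds: below all W(t) with t
  > 0 the level set is null and \<Phi> vanishes, while above all values of W the function \<Phi> is
  constant and s \<ge> Winf.\<close>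

lemma J_le_LS:
  assumes q: "1 \<le> q" and f [measurable]: "f \<in> borel_measurable lebesgue"
  shows "J f q \<le> LS f q + epowr (Nfun p v UNIV f / Winf) q"
proof -
  let ?S = "{s. (\<exists>t>0. w t \<le> s) \<and> (\<exists>t. s < w t)}"
  let ?T = "{s. 0 < s \<and> (\<forall>t. w t \<le> s)}"
  let ?d = "\<lambda>s. ennreal (q * s powr (- q - 1))"
  let ?N = "Nfun p v UNIV f"
  have [measurable]: "?S \<in> sets borel"
  proof -
    have "{s. \<exists>t>0. w t \<le> s} \<in> sets borel"
      by (rule up_closed_borel) (blast intro: order_trans)
    moreover have "- {s. \<exists>t. s < w t} \<in> sets borel"
      by (rule up_closed_borel) (blast intro: le_less_trans)
    then have "{s. \<exists>t. s < w t} \<in> sets borel" by (metis borel_comp double_complement)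
    ultimately show ?thesis unfolding Collect_conj_eq by (rule sets.Int)
  qed
  have [measurable]: "?T \<in> sets borel"
    by (rule up_closed_borel) (auto intro: order_trans)
  have "J f q \<le> (\<integral>\<^sup>+s. ?d s * epowr (\<Phi> f s) q * indicator ?S s
      + epowr ?N q * (?d s * indicator ?T s) \<partial>lborel)"
    unfolding J_def
  proof (intro nn_integral_mono)
    fix s :: real
    consider "s \<le> 0" | "s \<in> ?S" | "\<And>t. 0 < t \<Longrightarrow> s < w t" | "s \<in> ?T"
      unfolding mem_Collect_eq not_less[symmetric] by blast
    then show "?d s * epowr (\<Phi> f s) q * indicator {0<..} s
        \<le> ?d s * epowr (\<Phi> f s) q * indicator ?S s + epowr ?N q * (?d s * indicator ?T s)"
    proof cases
      case 2
      then show ?thesis by (auto simp: indicator_def)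
    next
      case 3
      then show ?thesis by (simp add: \<Phi>_eq_0[OF f])
    next
      case 4
      then show ?thesis by (auto simp: \<Phi>_eq_UNIV mult_ac)
    qed auto
  qed
  also have "\<dots> = LS f q + epowr ?N q * (\<integral>\<^sup>+s\<in>?T. ?d s \<partial>lborel)"
    unfolding LS_eq[OF q f] by (subst nn_integral_add) (simp_all add: nn_integral_cmult)
  also have "\<dots> \<le> LS f q + epowr (?N / Winf) q"
  proof (intro add_left_mono)
    show "epowr ?N q * (\<integral>\<^sup>+s\<in>?T. ?d s \<partial>lborel) \<le> epowr (?N / Winf) q"
    proof (cases "?T = {}")
      case True
      show ?thesis unfolding True by simp
    next
      case False
      \<comment> \<open>A level above all values of W forces \<open>Winf\<close> to be finite. For
        infinite \<open>Winf\<close> there is no such level, in accordance with the quotient by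
        \<infinity> being 0.\<close>
      then obtain s where "s \<in> ?T" by auto
      then have "Winf \<le> ennreal s" by (auto intro: Winf_le)
      then have "Winf \<noteq> \<infinity>" by (auto simp: top_unique)
      with Winf_pos obtain l where l: "Winf = ennreal l" "0 < l" by (cases Winf) auto
      have "(\<integral>\<^sup>+s\<in>?T. ?d s \<partial>lborel) \<le> (\<integral>\<^sup>+s\<in>{l..}. ?d s \<partial>lborel)"
      proof (intro nn_integral_mono)
        fix s
        have "l \<le> s" if "s \<in> ?T"
        proof -
          have "ennreal l \<le> ennreal s" unfolding l(1)[symmetric] using that by (intro Winf_le) auto
          then show ?thesis using that by (auto simp: ennreal_le_iff)
        qed
        then show "?d s * indicator ?T s \<le> ?d s * indicator {l..} s" by (auto simp: indicator_def)
      qed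
      also have "\<dots> = ennreal (l powr - q)" using l q by (intro nn_integral_powr_atLeast) auto
      finally have "epowr ?N q * (\<integral>\<^sup>+s\<in>?T. ?d s \<partial>lborel) \<le> epowr ?N q * ennreal (l powr - q)"
        by (rule mult_left_mono) simp
      also have "\<dots> = epowr (?N / Winf) q"
        using l unfolding divide_ennreal_def l(1)
        by (simp add: inverse_ennreal epowr_mult epowr_ennreal powr_minus inverse_powr)
      finally show ?thesis .
    qed
  qed
  finally show ?thesis .
qed

end

section \<open>Lower bounds\<close>

context complementary_morrey
begin

text \<open>The radii with W \<le> s form an interval starting at 0, exhausted up to one point by
  intervals (0,t n) with W(t n) \<le> s.\<close>

lemma \<omega>_integral_level_le:
  assumes fin: "\<theta> \<noteq> \<infinity>" and s: "0 < s"
  shows "(\<integral>\<^sup>+r\<in>{r. 0 < r \<and> w r \<le> s}. epowr (ennreal (\<omega> r)) (enn2real \<theta>) \<partial>lebesgue)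
    \<le> ennreal (s powr enn2real \<theta>)"
proof -
  let ?U = "{r. 0 < r \<and> w r \<le> s}"
  let ?k = "\<lambda>r. epowr (ennreal (\<omega> r)) (enn2real \<theta>)"
  show ?thesis
  proof (cases "?U = {}")
    case True
    show ?thesis unfolding True by simp
  next
    case False
    then obtain t m where t: "incseq t" "\<And>n::nat. t n \<in> ?U" "\<And>x. x \<in> ?U \<Longrightarrow> (\<exists>n. x < t n) \<or> x = m"
      by (rule down_closed_sequence) (auto intro: order_trans[OF w_mono])
    have "(\<integral>\<^sup>+r\<in>?U. ?k r \<partial>lebesgue) \<le> (\<integral>\<^sup>+r\<in>(\<Union>n. {0<..<t n}). ?k r \<partial>lebesgue)"
    proof (intro nn_integral_mono_AE, use AE_lebesgue_neq[of m] in eventually_elim)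
      fix r assume "r \<noteq> m"
      then have "r \<in> (\<Union>n. {0<..<t n})" if "r \<in> ?U" using t(3)[OF that] that by auto
      then show "?k r * indicator ?U r \<le> ?k r * indicator (\<Union>n. {0<..<t n}) r"
        by (auto simp: indicator_def)
    qed
    also have "\<dots> \<le> ennreal (s powr enn2real \<theta>)"
    proof (rule set_nn_integral_UN_le)
      show "incseq (\<lambda>n. {0<..<t n})" using t(1) by (force simp: incseq_def intro: less_le_trans)
      fix n
      show "(\<integral>\<^sup>+r\<in>{0<..<t n}. ?k r \<partial>lebesgue) \<le> ennreal (s powr enn2real \<theta>)"
        unfolding W_eq_integral[OF fin] using t(2)[of n] w_nonneg enn2real_\<theta>_pos[OF fin]
        by (intro ennreal_leI powr_mono2) auto
    qed auto
    finally show ?thesis .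
  qed
qed

text \<open>One null set per rational t suffices by monotonicity of w. For \<theta> = \<infinity>
  this allows \<omega>(r) itself as the lower bound y in \<open>cball_int_sum_le\<close>.\<close>

lemma AE_\<omega>_le_w:
  assumes "\<theta> = \<infinity>"
  shows "AE r in lebesgue. 0 < r \<longrightarrow> (\<forall>t>r. \<omega> r \<le> w t)"
proof -
  have "AE r in lebesgue. r \<in> {0<..<real_of_rat t} \<longrightarrow> ennreal (\<omega> r) \<le> W (real_of_rat t)" for t
    using AE_le_Inf_AE[where M = lebesgue and A = "{0<..<real_of_rat t}" and g = "\<lambda>r. ennreal (\<omega> r)"] assms
    unfolding W_def lnorm_def by simp
  then have "AE r in lebesgue. \<forall>t. r \<in> {0<..<real_of_rat t} \<longrightarrow> ennreal (\<omega> r) \<le> W (real_of_rat t)"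
    unfolding AE_all_countable by blast
  then show ?thesis
  proof eventually_elim
    fix r assume A: "\<forall>t. r \<in> {0<..<real_of_rat t} \<longrightarrow> ennreal (\<omega> r) \<le> W (real_of_rat t)"
    show "0 < r \<longrightarrow> (\<forall>t>r. \<omega> r \<le> w t)"
    proof (intro impI allI)
      fix t assume "0 < r" "r < t"
      obtain u where u: "r < real_of_rat u" "real_of_rat u < t"
        using of_rat_dense[OF \<open>r < t\<close>] by auto
      then have "\<omega> r \<le> w (real_of_rat u)"
        using A \<open>0 < r\<close> w_nonneg by (auto simp: W_eq)
      also have "\<dots> \<le> w t" using u by (intro w_mono) auto
      finally show "\<omega> r \<le> w t" .
    qed
  qed
qed

text \<open>On \<open>|x| \<ge> r\<close> only the summands whose level set reaches beyond \<open>r\<close> survive, and Jensen's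
  inequality replaces Minkowski's.\<close>

lemma cball_int_sum_le:
  fixes \<sigma> c :: "'i \<Rightarrow> real" and h :: "'i \<Rightarrow> 'a \<Rightarrow> real"
  assumes I: "finite I" and c: "\<And>i. i \<in> I \<Longrightarrow> 0 \<le> c i"
    and [measurable]: "\<And>i. i \<in> I \<Longrightarrow> h i \<in> borel_measurable lebesgue"
    and h0: "\<And>i x. i \<in> I \<Longrightarrow> 0 \<le> h i x"
    and supp: "\<And>i x. i \<in> I \<Longrightarrow> x \<notin> D (\<sigma> i) \<Longrightarrow> h i x = 0"
    and M: "\<And>i. i \<in> I \<Longrightarrow> Mint p v UNIV (h i) \<le> 1"
    and y: "\<And>t. r < t \<Longrightarrow> y \<le> w t"
  shows "cball_int p v (\<lambda>x. \<Sum>i\<in>I. c i * h i x) r \<le> ennreal ((\<Sum>i\<in>{i \<in> I. y \<le> \<sigma> i}. c i) powr p)"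
proof -
  let ?I = "{i \<in> I. y \<le> \<sigma> i}"
  let ?S = "\<Sum>i\<in>?I. c i"
  have pos: "AE x in lebesgue. 0 < v x" using v by (simp add: Wclass_def)
  have "cball_int p v (\<lambda>x. \<Sum>i\<in>I. c i * h i x) r
      \<le> (\<integral>\<^sup>+x. ennreal (?S powr (p - 1)) * (\<Sum>i\<in>?I. ennreal (c i) * ennreal (\<bar>h i x\<bar> powr p * v x)) \<partial>lebesgue)"
    unfolding cball_int_def
  \<comment> \<open>The sphere |x| = r is discarded because y bounds W only at radii beyond
    r.\<close>
  proof (intro nn_integral_mono_AE, use pos AE_norm_neq[of r] in eventually_elim)
    fix x :: 'a assume x: "0 < v x" "norm x \<noteq> r"
    show "ennreal (\<bar>\<Sum>i\<in>I. c i * h i x\<bar> powr p * v x) * indicator (- ball 0 r) x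
        \<le> ennreal (?S powr (p - 1)) * (\<Sum>i\<in>?I. ennreal (c i) * ennreal (\<bar>h i x\<bar> powr p * v x))"
    proof (cases "x \<in> ball 0 r")
      case False
      then have "y \<le> w (norm x)" using x y by auto
      then have eq: "(\<Sum>i\<in>I. c i * h i x) = (\<Sum>i\<in>?I. c i * h i x)"
        using I supp by (intro sum.mono_neutral_right) (auto simp: D_def, meson order_trans)
      have "(\<Sum>i\<in>?I. c i * h i x) powr p \<le> ?S powr (p - 1) * (\<Sum>i\<in>?I. c i * h i x powr p)"
        using I c h0 p by (intro sum_powr_Jensen) auto
      then have "\<bar>\<Sum>i\<in>I. c i * h i x\<bar> powr p * v x \<le> (?S powr (p - 1) * (\<Sum>i\<in>?I. c i * h i x powr p)) * v x"
        unfolding eq using x c h0 by (subst abs_of_nonneg) (auto intro!: mult_right_mono sum_nonneg)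
      also have "\<dots> = ?S powr (p - 1) * (\<Sum>i\<in>?I. c i * (\<bar>h i x\<bar> powr p * v x))"
        using h0 by (simp add: sum_distrib_right mult.assoc)
      finally have "ennreal (\<bar>\<Sum>i\<in>I. c i * h i x\<bar> powr p * v x)
          \<le> ennreal (?S powr (p - 1) * (\<Sum>i\<in>?I. c i * (\<bar>h i x\<bar> powr p * v x)))"
        by (rule ennreal_leI)
      also have "\<dots> = ennreal (?S powr (p - 1)) * (\<Sum>i\<in>?I. ennreal (c i) * ennreal (\<bar>h i x\<bar> powr p * v x))"
      proof -
        have "ennreal (\<Sum>i\<in>?I. c i * (\<bar>h i x\<bar> powr p * v x))
            = (\<Sum>i\<in>?I. ennreal (c i) * ennreal (\<bar>h i x\<bar> powr p * v x))"
          using c x by (subst sum_ennreal[symmetric]) (auto simp flip: ennreal_mult)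
        then show ?thesis using c x by (simp add: ennreal_mult' sum_nonneg)
      qed
      finally show ?thesis using False by simp
    qed auto
  qed
  also have "\<dots> = ennreal (?S powr (p - 1)) * (\<Sum>i\<in>?I. ennreal (c i) * Mint p v UNIV (h i))"
  proof -
    have "(\<integral>\<^sup>+x. (\<Sum>i\<in>?I. ennreal (c i) * ennreal (\<bar>h i x\<bar> powr p * v x)) \<partial>lebesgue)
        = (\<Sum>i\<in>?I. \<integral>\<^sup>+x. ennreal (c i) * ennreal (\<bar>h i x\<bar> powr p * v x) \<partial>lebesgue)"
      by (rule nn_integral_sum) simp
    also have "\<dots> = (\<Sum>i\<in>?I. ennreal (c i) * Mint p v UNIV (h i))"
      unfolding Mint_def by (intro sum.cong refl) (simp add: nn_integral_cmult)
    finally show ?thesis by (subst nn_integral_cmult) simp_all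
  qed
  also have "\<dots> \<le> ennreal (?S powr (p - 1)) * (\<Sum>i\<in>?I. ennreal (c i) * 1)"
    using M by (intro mult_left_mono sum_mono) auto
  also have "\<dots> = ennreal (?S powr (p - 1) * ?S)"
  proof -
    have "(\<Sum>i\<in>?I. ennreal (c i) * 1) = ennreal ?S" using c by (subst sum_ennreal[symmetric]) auto
    then show ?thesis by (simp add: ennreal_mult')
  qed
  also have "?S powr (p - 1) * ?S = ?S powr p"
  proof (cases "?S = 0")
    case False
    moreover have "0 \<le> ?S" using c by (intro sum_nonneg) auto
    ultimately show ?thesis by (simp add: powr_diff)
  qed simp
  finally show ?thesis .
qed

text \<open>f is tested against the sum H of all c i h i, with h i near-extremal for \<Phi> at level
  \<sigma> i. On |x| \<ge> r the norm of H is at most the sum of the coefficients whose level is at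
  least W(r), and the hypotheses \<open>fin\<close> and \<open>inf\<close> turn this into norm at
  most 1 in X. The alternative b i = 0 covers levels with \<Phi> = 0, where nothing lies strictly
  below.\<close>

lemma assoc_norm_ge_sum:
  fixes \<sigma> c b :: "'i \<Rightarrow> real"
  assumes I: "finite I" and \<sigma>: "\<And>i. i \<in> I \<Longrightarrow> 0 < \<sigma> i" and c: "\<And>i. i \<in> I \<Longrightarrow> 0 \<le> c i"
    and f [measurable]: "f \<in> borel_measurable lebesgue"
    and b: "\<And>i. i \<in> I \<Longrightarrow> 0 \<le> b i" "\<And>i. i \<in> I \<Longrightarrow> b i = 0 \<or> ennreal (b i) < \<Phi> f (\<sigma> i)"
    and fin: "\<theta> \<noteq> \<infinity> \<Longrightarrow>
      (\<Sum>i\<in>I. \<sigma> i powr enn2real \<theta> * (\<Sum>j\<in>{j \<in> I. \<sigma> i \<le> \<sigma> j}. c j) powr enn2real \<theta>) \<le> 1"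
    and inf: "\<And>y. \<theta> = \<infinity> \<Longrightarrow> 0 < y \<Longrightarrow> y * (\<Sum>j\<in>{j \<in> I. y \<le> \<sigma> j}. c j) \<le> 1"
  shows "ennreal (\<Sum>i\<in>I. c i * b i) \<le> assoc_norm p \<theta> \<omega> v f"
proof -
  have "\<forall>i\<in>I. \<exists>h. h \<in> borel_measurable lebesgue \<and> (\<forall>x. 0 \<le> h x) \<and> (\<forall>x. x \<notin> D (\<sigma> i) \<longrightarrow> h x = 0)
      \<and> Mint p v UNIV h \<le> 1 \<and> ennreal (b i) \<le> (\<integral>\<^sup>+x. ennreal (\<bar>f x\<bar> * h x) \<partial>lebesgue)"
  proof
    fix i assume i: "i \<in> I"
    show "\<exists>h. h \<in> borel_measurable lebesgue \<and> (\<forall>x. 0 \<le> h x) \<and> (\<forall>x. x \<notin> D (\<sigma> i) \<longrightarrow> h x = 0)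
      \<and> Mint p v UNIV h \<le> 1 \<and> ennreal (b i) \<le> (\<integral>\<^sup>+x. ennreal (\<bar>f x\<bar> * h x) \<partial>lebesgue)"
    proof (cases "b i = 0")
      case True
      then show ?thesis by (intro exI[of _ "\<lambda>_. 0"]) (simp add: Mint_def)
    next
      case False
      then have "ennreal (b i) < Nfun p v (D (\<sigma> i)) f" using b i by (auto simp: \<Phi>_def)
      from Nfun_near_extremal[OF p v D_measurable f b(1)[OF i] this] show ?thesis by metis
    qed
  qed
  then obtain h where h: "\<And>i. i \<in> I \<Longrightarrow> h i \<in> borel_measurable lebesgue"
    "\<And>i x. i \<in> I \<Longrightarrow> 0 \<le> h i x" "\<And>i x. i \<in> I \<Longrightarrow> x \<notin> D (\<sigma> i) \<Longrightarrow> h i x = 0"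
    "\<And>i. i \<in> I \<Longrightarrow> Mint p v UNIV (h i) \<le> 1"
    "\<And>i. i \<in> I \<Longrightarrow> ennreal (b i) \<le> (\<integral>\<^sup>+x. ennreal (\<bar>f x\<bar> * h i x) \<partial>lebesgue)"
    unfolding bchoice_iff by blast
  note [measurable] = h(1)
  define H where "H x = (\<Sum>i\<in>I. c i * h i x)" for x
  have H [measurable]: "H \<in> borel_measurable lebesgue" unfolding H_def by measurable
  define C where "C y = (\<Sum>j\<in>{j \<in> I. y \<le> \<sigma> j}. c j)" for y
  have C: "0 \<le> C y" for y unfolding C_def using c by (intro sum_nonneg) auto
  have cball: "cball_int p v H r \<le> ennreal (C y powr p)" if "\<And>t. r < t \<Longrightarrow> y \<le> w t" for r y
    unfolding H_def C_def using h c that by (intro cball_int_sum_le I) auto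
  have g_le: "g H r \<le> ennreal (C y)" if "\<And>t. r < t \<Longrightarrow> y \<le> w t" for r y
  proof -
    have "g H r \<le> epowr (ennreal (C y powr p)) (1 / p)"
      unfolding g_def using p cball[OF that] by (intro epowr_mono) auto
    then show ?thesis using p C by (simp add: epowr_ennreal powr_powr)
  qed
  have X: "Xnorm p \<theta> \<omega> v H \<le> 1"
  proof (cases "\<theta> = \<infinity>")
    case True
    have "AE r in lebesgue. r \<in> {0<..} \<longrightarrow> ennreal (\<omega> r) * g H r \<le> 1"
      using AE_\<omega>_le_w[OF True]
    proof eventually_elim
      fix r assume A: "0 < r \<longrightarrow> (\<forall>t>r. \<omega> r \<le> w t)"
      show "r \<in> {0<..} \<longrightarrow> ennreal (\<omega> r) * g H r \<le> 1"
      proof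
        assume "r \<in> {0<..}"
        \<comment> \<open>For \<theta> = \<infinity> the tail is cut at \<omega>(r) instead of W(r),
          so that \<open>inf\<close> applies with y = \<omega>(r).\<close>
        then have "ennreal (\<omega> r) * g H r \<le> ennreal (\<omega> r) * ennreal (C (\<omega> r))"
          using A by (intro mult_left_mono g_le) auto
        also have "\<dots> \<le> 1"
        proof (cases "0 < \<omega> r")
          case pos: True
          have "\<omega> r * C (\<omega> r) \<le> 1" unfolding C_def by (rule inf[OF True pos])
          then show ?thesis using pos C by (simp add: ennreal_le_1 flip: ennreal_mult)
        qed (simp add: ennreal_neg)
        finally show "ennreal (\<omega> r) * g H r \<le> 1" .
      qed
    qed
    then show ?thesis unfolding Xnorm_def lnorm_def g_def using True by (auto intro!: Inf_lower)
  next
    case False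
    define a where "a = enn2real \<theta>"
    have a: "0 < a" unfolding a_def using False by (rule enn2real_\<theta>_pos)
    let ?w = "\<lambda>r. epowr (ennreal (\<omega> r)) a"
    have "(\<integral>\<^sup>+r\<in>{0<..}. epowr (ennreal (\<omega> r) * g H r) a \<partial>lebesgue)
        \<le> (\<integral>\<^sup>+r. (\<Sum>i\<in>I. ennreal (C (\<sigma> i) powr a) * (?w r * indicator {r. 0 < r \<and> w r \<le> \<sigma> i} r)) \<partial>lebesgue)"
    proof (intro nn_integral_mono)
      fix r
      show "epowr (ennreal (\<omega> r) * g H r) a * indicator {0<..} r
          \<le> (\<Sum>i\<in>I. ennreal (C (\<sigma> i) powr a) * (?w r * indicator {r. 0 < r \<and> w r \<le> \<sigma> i} r))"
      proof (cases "0 < r \<and> C (w r) \<noteq> 0")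
        case True
        let ?I = "{j \<in> I. w r \<le> \<sigma> j}"
        have "?I \<noteq> {}" using True unfolding C_def by (intro notI) simp
        then have "Min (\<sigma> ` ?I) \<in> \<sigma> ` ?I" using I by (intro Min_in) auto
        \<comment> \<open>i has the smallest level that is still at least W(r). Its tail sum equals
          the one at W(r), so a single summand already dominates.\<close>
        then obtain i where i: "i \<in> ?I" "\<sigma> i = Min (\<sigma> ` ?I)" by auto
        have "\<sigma> i \<le> \<sigma> j" if "j \<in> ?I" for j
          unfolding i(2) using I that by (intro Min_le) auto
        then have "?I = {j \<in> I. \<sigma> i \<le> \<sigma> j}" using i(1) by auto
        then have Ci: "C (w r) = C (\<sigma> i)" by (simp add: C_def)
        have "epowr (ennreal (\<omega> r) * g H r) a \<le> epowr (ennreal (\<omega> r) * ennreal (C (w r))) a"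
          using a by (intro epowr_mono mult_left_mono g_le w_mono) auto
        also have "\<dots> = ennreal (C (\<sigma> i) powr a) * (?w r * indicator {r. 0 < r \<and> w r \<le> \<sigma> i} r)"
          using C i True by (simp add: epowr_mult epowr_ennreal Ci mult.commute)
        also have "\<dots> \<le> (\<Sum>i\<in>I. ennreal (C (\<sigma> i) powr a) * (?w r * indicator {r. 0 < r \<and> w r \<le> \<sigma> i} r))"
          using i by (intro member_le_sum I) auto
        finally show ?thesis using True by simp
      next
        case False
        have "g H r \<le> ennreal (C (w r))" by (intro g_le w_mono) auto
        then show ?thesis using False by (auto simp: indicator_def)
      qed
    qed
    also have "\<dots> = (\<Sum>i\<in>I. ennreal (C (\<sigma> i) powr a) * (\<integral>\<^sup>+r\<in>{r. 0 < r \<and> w r \<le> \<sigma> i}. ?w r \<partial>lebesgue))"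
    proof -
      have [measurable]: "{r. 0 < r \<and> w r \<le> s} \<in> sets lebesgue" for s
      proof -
        have "{r \<in> space borel. 0 < r \<and> w r \<le> s} \<in> sets borel" by measurable
        then show ?thesis by simp
      qed
      show ?thesis by (subst nn_integral_sum) (auto simp: nn_integral_cmult)
    qed
    also have "\<dots> \<le> (\<Sum>i\<in>I. ennreal (C (\<sigma> i) powr a) * ennreal (\<sigma> i powr a))"
      unfolding a_def using \<sigma> by (intro sum_mono mult_left_mono \<omega>_integral_level_le False) auto
    also have "\<dots> = ennreal (\<Sum>i\<in>I. \<sigma> i powr a * C (\<sigma> i) powr a)"
      by (subst sum_ennreal[symmetric]) (auto simp: ennreal_mult mult.commute intro!: sum.cong)
    also have "\<dots> \<le> 1" using fin[OF False] by (simp add: a_def C_def ennreal_le_1)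
    finally have "epowr (\<integral>\<^sup>+r\<in>{0<..}. epowr (ennreal (\<omega> r) * g H r) a \<partial>lebesgue) (1 / a) \<le> epowr 1 (1 / a)"
      using a by (intro epowr_mono) auto
    then show ?thesis unfolding Xnorm_def lnorm_def g_def a_def using False by simp
  qed
  \<comment> \<open>The trivial lower bound y = 0 for W bounds this by a power of a finite sum of
    coefficients.\<close>
  have "cball_int p v H t < \<infinity>" for t
    using cball[of t 0] w_nonneg by (auto intro: le_less_trans)
  with X have mem: "H \<in> {g \<in> Xspace p \<theta> \<omega> v. Xnorm p \<theta> \<omega> v g \<le> 1}"
    by (auto simp: Xspace_def intro: le_less_trans)
  have "ennreal (\<Sum>i\<in>I. c i * b i) = (\<Sum>i\<in>I. ennreal (c i) * ennreal (b i))"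
    using c b(1) by (subst sum_ennreal[symmetric]) (auto simp: ennreal_mult)
  also have "\<dots> \<le> (\<Sum>i\<in>I. ennreal (c i) * (\<integral>\<^sup>+x. ennreal (\<bar>f x\<bar> * h i x) \<partial>lebesgue))"
    using h(5) by (intro sum_mono mult_left_mono) auto
  also have "\<dots> = (\<integral>\<^sup>+x. (\<Sum>i\<in>I. ennreal (c i) * ennreal (\<bar>f x\<bar> * h i x)) \<partial>lebesgue)"
    by (subst nn_integral_sum) (auto simp: nn_integral_cmult)
  also have "\<dots> = (\<integral>\<^sup>+x. ennreal \<bar>f x * H x\<bar> \<partial>lebesgue)"
  proof (intro nn_integral_cong)
    fix x
    have "0 \<le> H x" unfolding H_def using c h by (intro sum_nonneg) auto
    then have "\<bar>f x * H x\<bar> = \<bar>f x\<bar> * H x" by (simp add: abs_mult)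
    also have "\<dots> = (\<Sum>i\<in>I. c i * (\<bar>f x\<bar> * h i x))"
      by (simp add: H_def sum_distrib_left mult_ac)
    finally have "\<bar>f x * H x\<bar> = (\<Sum>i\<in>I. c i * (\<bar>f x\<bar> * h i x))" .
    moreover have "ennreal (\<Sum>i\<in>I. c i * (\<bar>f x\<bar> * h i x)) = (\<Sum>i\<in>I. ennreal (c i) * ennreal (\<bar>f x\<bar> * h i x))"
      using c h by (subst sum_ennreal[symmetric]) (auto simp: ennreal_mult)
    ultimately show "(\<Sum>i\<in>I. ennreal (c i) * ennreal (\<bar>f x\<bar> * h i x)) = ennreal \<bar>f x * H x\<bar>" by simp
  qed
  also have "\<dots> \<le> assoc_norm p \<theta> \<omega> v f" unfolding assoc_norm_def using mem by (rule SUP_upper)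
  finally show ?thesis .
qed

text \<open>A single near-extremal function at level s with coefficient 1/s has norm at most 1 in X.
  Density of the order removes the strict inequality below \<Phi>.\<close>

lemma \<Phi>_le_assoc_norm:
  assumes f: "f \<in> borel_measurable lebesgue" and s: "0 < s"
  shows "\<Phi> f s \<le> ennreal s * assoc_norm p \<theta> \<omega> v f"
proof (rule dense_le)
  fix x assume x: "x < \<Phi> f s"
  then obtain b where b: "x = ennreal b" "0 \<le> b" by (cases x) auto
  have "ennreal (\<Sum>i\<in>{()}. 1 / s * b) \<le> assoc_norm p \<theta> \<omega> v f"
  proof (rule assoc_norm_ge_sum[where \<sigma> = "\<lambda>_. s", OF _ _ _ f])
    show "(\<Sum>i\<in>{()}. s powr enn2real \<theta> * (\<Sum>j\<in>{j \<in> {()}. s \<le> s}. 1 / s) powr enn2real \<theta>) \<le> 1"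
      using s by (simp add: powr_divide)
    fix y :: real assume "0 < y"
    then show "y * (\<Sum>j\<in>{j \<in> {()}. y \<le> s}. 1 / s) \<le> 1"
      using s by (cases "y \<le> s") auto
  qed (use s b x in auto)
  then have "ennreal s * ennreal (1 / s * b) \<le> ennreal s * assoc_norm p \<theta> \<omega> v f"
    by (intro mult_left_mono) auto
  then show "x \<le> ennreal s * assoc_norm p \<theta> \<omega> v f"
    using s b by (simp flip: ennreal_mult)
qed

lemma Nfun_ball_le_assoc_norm:
  assumes "f \<in> borel_measurable lebesgue" "0 < t"
  shows "Nfun p v (ball 0 t) f / W t \<le> assoc_norm p \<theta> \<omega> v f"
proof -
  have "Nfun p v (ball 0 t) f \<le> W t * assoc_norm p \<theta> \<omega> v f"
    unfolding W_eq
    by (rule order_trans[OF Nfun_ball_le_\<Phi> \<Phi>_le_assoc_norm]) (use assms w_pos in auto)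
  then show ?thesis
    using w_pos[OF assms(2)] by (simp add: W_eq divide_le_posI_ennreal mult.commute)
qed

text \<open>If \<open>Winf\<close> is finite, the level set at \<open>Winf\<close> is the whole
  space; otherwise the quotient is 0.\<close>

lemma Nfun_UNIV_le_assoc_norm:
  assumes f: "f \<in> borel_measurable lebesgue"
  shows "Nfun p v UNIV f / Winf \<le> assoc_norm p \<theta> \<omega> v f"
proof (cases "Winf = \<infinity>")
  case False
  with Winf_pos obtain l where l: "Winf = ennreal l" "0 < l" by (cases Winf) auto
  have "w t \<le> l" for t using W_le_Winf[of t] l by (simp add: W_eq)
  then have "Nfun p v UNIV f \<le> Winf * assoc_norm p \<theta> \<omega> v f"
    using \<Phi>_le_assoc_norm[OF f l(2)] by (simp add: \<Phi>_eq_UNIV l)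
  then show ?thesis using l by (simp add: divide_le_posI_ennreal mult.commute)
qed (simp add: divide_ennreal_def)

end

text \<open>With m the least index in the tail, the sum is at most 2 powr (- m), while y \<le> 2
  powr m. Halving each coefficient compensates the factor 2 of the geometric series.\<close>

lemma sum_dyadic_tail_le:
  fixes I :: "int set"
  assumes "finite I" "0 < y"
  shows "y * (\<Sum>k\<in>{k \<in> I. y \<le> 2 powr k}. 2 powr (- k) / 2 :: real) \<le> 1"
proof (cases "{k \<in> I. y \<le> 2 powr k} = {}")
  case False
  let ?I = "{k \<in> I. y \<le> 2 powr k}"
  define m where "m = Min ?I"
  have m: "m \<in> ?I" "\<And>k. k \<in> ?I \<Longrightarrow> m \<le> k"
    using False assms(1) Min_in[of ?I] by (auto simp: m_def)
  have "(\<Sum>k\<in>?I. 2 powr (- k) / 2 :: real) = 2 powr (- m) / 2 * (\<Sum>k\<in>?I. (1 / 2) powr (k - m))"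
    unfolding sum_distrib_left
  proof (intro sum.cong refl)
    fix k
    have "(1 / 2 :: real) powr (k - m) = 2 powr (m - k)"
      by (simp add: powr_divide powr_diff)
    then show "2 powr (- k) / 2 = 2 powr (- m) / 2 * (1 / 2 :: real) powr (k - m)"
      by (simp add: powr_diff powr_minus_divide)
  qed
  also have "\<dots> \<le> 2 powr (- m) / 2 * (1 / (1 - 1 / 2))"
    using assms(1) m by (intro mult_left_mono sum_geometric_int_le) (auto simp: inj_on_def)
  finally have "(\<Sum>k\<in>?I. 2 powr (- k) / 2 :: real) \<le> 2 powr (- m)" by simp
  then have "y * (\<Sum>k\<in>?I. 2 powr (- k) / 2) \<le> 2 powr m * 2 powr (- m)"
    using m assms by (intro mult_mono) (auto intro: sum_nonneg)
  then show ?thesis by (simp flip: powr_add)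
next
  case True
  show ?thesis unfolding True by simp
qed

section \<open>From dyadic sums to the level integral\<close>

context complementary_morrey
begin

text \<open>The 4 comes from halving both coefficients and values of \<Phi> when \<theta> =
  \<infinity>. The other entry is twice the Hardy constant for finite \<theta>, the 2 coming from
  testing with half of \<Phi>.\<close>

definition K :: real where
  "K = max 4 (2 / (1 - 2 powr (- 1 / 2)))"

lemma K_ge: "4 \<le> K" "2 / (1 - 2 powr (- 1 / 2)) \<le> K"
  by (auto simp: K_def)

text \<open>Discrete duality. The values a k / 2 are zero or strictly below \<Phi>, as
  \<open>assoc_norm_ge_sum\<close> requires. Its norm hypothesis is verified by the dyadic Hardy
  inequality for finite \<theta>, and by the geometric tail bound for \<theta> =
  \<infinity>.\<close>

lemma sum_\<Phi>_le_assoc_norm: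
  fixes I :: "int set" and a :: "int \<Rightarrow> real"
  assumes \<theta>1: "1 < \<theta>" and f: "f \<in> borel_measurable lebesgue" and I: "finite I"
    and a: "\<And>k. k \<in> I \<Longrightarrow> \<Phi> f (2 powr k) = ennreal (a k)" "\<And>k. k \<in> I \<Longrightarrow> 0 \<le> a k"
  defines "q \<equiv> conj_exp \<theta>"
  shows "ennreal ((\<Sum>k\<in>I. (2 powr k) powr - q * a k powr q) powr (1 / q)) \<le> ennreal K * assoc_norm p \<theta> \<omega> v f"
proof -
  have half: "a k / 2 = 0 \<or> ennreal (a k / 2) < \<Phi> f (2 powr k)" if "k \<in> I" for k
    using a[OF that] by (auto simp: ennreal_less_iff)
  have scale: "ennreal x \<le> ennreal K * assoc_norm p \<theta> \<omega> v f"
    if "ennreal y \<le> assoc_norm p \<theta> \<omega> v f" "x \<le> K * y" "0 \<le> y" for x y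
  proof -
    have "ennreal x \<le> ennreal K * ennreal y"
      using that K_ge by (simp add: ennreal_leI flip: ennreal_mult)
    also have "\<dots> \<le> ennreal K * assoc_norm p \<theta> \<omega> v f" using that by (intro mult_left_mono) auto
    finally show ?thesis .
  qed
  define Q where "Q = (\<Sum>k\<in>I. (2 powr k) powr - q * a k powr q)"
  have Q: "0 \<le> Q" unfolding Q_def by (intro sum_nonneg) auto
  have "ennreal (Q powr (1 / q)) \<le> ennreal K * assoc_norm p \<theta> \<omega> v f"
  proof (cases "\<theta> = \<infinity>")
    case True
    then have q: "q = 1" by (simp add: q_def conj_exp_def)
    have "ennreal (\<Sum>k\<in>I. 2 powr (- k) / 2 * (a k / 2)) \<le> assoc_norm p \<theta> \<omega> v f"
    proof (rule assoc_norm_ge_sum[where \<sigma> = "\<lambda>k. 2 powr real_of_int k"])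
      show "y * (\<Sum>j\<in>{j \<in> I. y \<le> 2 powr real_of_int j}. 2 powr (- j) / 2) \<le> 1" if "0 < y" for y
        using sum_dyadic_tail_le[OF I that] by simp
    qed (use I a f half True in auto)
    moreover have "Q = 4 * (\<Sum>k\<in>I. 2 powr (- k) / 2 * (a k / 2))"
      unfolding Q_def q sum_distrib_left using a by (intro sum.cong) (auto simp: powr_minus)
    moreover have nonneg: "0 \<le> (\<Sum>k\<in>I. 2 powr (- k) / 2 * (a k / 2))"
      using a by (intro sum_nonneg) auto
    ultimately show ?thesis
      using Q q K_ge by (intro scale) (auto intro!: mult_right_mono)
  next
    case False
    define e where "e = enn2real \<theta>"
    note eq = conj_exp_gt_1[OF \<theta>1 False, folded e_def q_def]
    have qe: "(q - 1) * e = q" "e - q * e = - q" "1 - 1 / e = 1 / q"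
      using eq by (auto simp: field_simps)
    define B where "B = 1 / (1 - 2 powr (- 1 / 2) :: real)"
    have B: "0 < B" unfolding B_def using powr_less_mono[of "- 1 / 2" 0 "2::real"] by simp
    show ?thesis
    proof (cases "Q = 0")
      case False
      then have Q0: "0 < Q" using Q by simp
      \<comment> \<open>The equality case of Hoelder's inequality for sums: as (q - 1) e = q and e -
        q e = - q, the powers of order e of 2^k B c k add up to 1. The division by B pays for the
        Hardy constant.\<close>
      define c where "c k = a k powr (q - 1) * (2 powr k) powr - q / (B * Q powr (1 / e))" for k :: int
      have "ennreal (\<Sum>k\<in>I. c k * (a k / 2)) \<le> assoc_norm p \<theta> \<omega> v f"
      proof (rule assoc_norm_ge_sum[where \<sigma> = "\<lambda>k. 2 powr real_of_int k", OF I _ _ f _ half])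
        have "(\<Sum>i\<in>I. (2 powr i) powr e * (\<Sum>j\<in>{j \<in> I. 2 powr real_of_int i \<le> 2 powr j}. c j) powr e)
            = (\<Sum>i\<in>I. (2 powr i) powr e * (\<Sum>j\<in>{j \<in> I. i \<le> j}. c j) powr e)"
          by simp
        also have "\<dots> \<le> B powr e * (\<Sum>k\<in>I. (2 powr k) powr e * c k powr e)"
          unfolding B_def using I eq Q0 B by (intro sum_dyadic_Hardy) (auto simp: c_def)
        also have "\<dots> = B powr e * (\<Sum>k\<in>I. (2 powr k) powr - q * a k powr q / (B powr e * Q))"
        proof (intro arg_cong[where f = "(*) (B powr e)"] sum.cong refl)
          fix k assume k: "k \<in> I"
          have "c k powr e = a k powr ((q - 1) * e) * (2 powr k) powr (- q * e) / (B powr e * Q)"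
            unfolding c_def using eq B Q0 by (simp add: powr_divide powr_mult powr_powr mult.assoc)
          then have "(2 powr k) powr e * c k powr e
              = a k powr ((q - 1) * e) * ((2 powr k) powr e * (2 powr k) powr (- q * e)) / (B powr e * Q)"
            by simp
          also have "(2 powr k) powr e * (2 powr k) powr (- q * e) = (2 powr k) powr - q"
            unfolding powr_add[symmetric] using qe(2) by simp
          finally show "(2 powr k) powr e * c k powr e = (2 powr k) powr - q * a k powr q / (B powr e * Q)"
            unfolding qe(1) by (simp add: mult.commute)
        qed
        also have "\<dots> = 1"
          unfolding sum_divide_distrib[symmetric] Q_def[symmetric] using B Q0 by simp
        finally show "(\<Sum>i\<in>I. (2 powr real_of_int i) powr enn2real \<theta>
            * (\<Sum>j\<in>{j \<in> I. 2 powr real_of_int i \<le> 2 powr j}. c j) powr enn2real \<theta>) \<le> 1"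
          by (simp add: e_def)
      qed (use a B Q0 \<open>\<theta> \<noteq> \<infinity>\<close> in \<open>auto simp: c_def\<close>)
      moreover have "(\<Sum>k\<in>I. c k * (a k / 2)) = Q powr (1 / q) / (2 * B)"
      proof -
        have "(\<Sum>k\<in>I. c k * (a k / 2)) = (\<Sum>k\<in>I. (2 powr k) powr - q * a k powr q / (2 * B * Q powr (1 / e)))"
        proof (intro sum.cong refl)
          fix k assume "k \<in> I"
          then have "a k powr (q - 1) * a k = a k powr q"
            using a(2)[of k] eq by (cases "a k = 0") (auto simp: powr_diff)
          then show "c k * (a k / 2) = (2 powr k) powr - q * a k powr q / (2 * B * Q powr (1 / e))"
            unfolding c_def by (simp add: mult_ac)
        qed
        also have "\<dots> = Q / (2 * B * Q powr (1 / e))"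
          unfolding sum_divide_distrib[symmetric] Q_def[symmetric] ..
        also have "\<dots> = Q powr (1 - 1 / e) / (2 * B)"
          using Q0 by (simp add: powr_diff)
        finally show ?thesis unfolding qe(3) .
      qed
      ultimately have "ennreal (Q powr (1 / q) / (2 * B)) \<le> assoc_norm p \<theta> \<omega> v f" by simp
      moreover have "Q powr (1 / q) \<le> K * (Q powr (1 / q) / (2 * B))"
      proof -
        have "2 * B * (Q powr (1 / q) / (2 * B)) \<le> K * (Q powr (1 / q) / (2 * B))"
          using K_ge B by (intro mult_right_mono) (auto simp: B_def)
        then show ?thesis using B by simp
      qed
      ultimately show ?thesis using B by (intro scale) auto
    qed simp
  qed
  then show ?thesis by (simp add: Q_def)
qed

text \<open>On the band from 2^(k-1) to 2^k monotonicity bounds \<Phi> by its value at the right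
  end, and the density has mass at most 2^q (2^k)^(-q). Finitely many bands thus cost only a factor
  2 beyond \<open>sum_\<Phi>_le_assoc_norm\<close>, uniformly in their number, and they exhaust
  (0,\<infinity>).\<close>

lemma J_le_assoc_norm:
  assumes \<theta>1: "1 < \<theta>" and f [measurable]: "f \<in> borel_measurable lebesgue"
  shows "epowr (J f (conj_exp \<theta>)) (1 / conj_exp \<theta>) \<le> ennreal (2 * K) * assoc_norm p \<theta> \<omega> v f"
proof (cases "assoc_norm p \<theta> \<omega> v f = \<infinity>")
  case True
  then show ?thesis using K_ge by (simp add: ennreal_mult_top)
next
  case False
  define q where "q = conj_exp \<theta>"
  have q: "1 \<le> q" unfolding q_def by (rule conj_exp_ge_1) fact
  define A where "A = enn2real (assoc_norm p \<theta> \<omega> v f)"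
  have A: "assoc_norm p \<theta> \<omega> v f = ennreal A" "0 \<le> A"
    using False by (auto simp: A_def ennreal_enn2real less_top)
  define a where "a k = enn2real (\<Phi> f (2 powr real_of_int k))" for k :: int
  have a: "\<Phi> f (2 powr k) = ennreal (a k)" "0 \<le> a k" for k :: int
  proof -
    \<comment> \<open>The single-level bound makes all dyadic values of \<Phi> finite, hence real
      numbers.\<close>
    have "\<Phi> f (2 powr k) \<le> ennreal (2 powr k) * ennreal A"
      unfolding A(1)[symmetric] by (rule \<Phi>_le_assoc_norm) auto
    also have "\<dots> < top" by (simp add: ennreal_mult_less_top)
    finally show "\<Phi> f (2 powr k) = ennreal (a k)" "0 \<le> a k" by (auto simp: a_def)
  qed
  let ?d = "\<lambda>s. ennreal (q * s powr (- q - 1)) * epowr (\<Phi> f s) q"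
  \<comment> \<open>The open left end 2 powr - (n + 1) makes the ceiling of log 2 s at least -n, so
    the indices are exactly those from -n to n.\<close>
  have band: "(\<integral>\<^sup>+s\<in>{2 powr - real (Suc n)<..2 powr real n}. ?d s \<partial>lborel) \<le> ennreal ((2 * K * A) powr q)" for n
  proof -
    let ?I = "{- int n..int n}"
    let ?B = "\<lambda>k::int. {2 powr (k - 1)..2 powr k :: real}"
    have "(\<integral>\<^sup>+s\<in>{2 powr - real (Suc n)<..2 powr real n}. ?d s \<partial>lborel)
        \<le> (\<integral>\<^sup>+s. (\<Sum>k\<in>?I. ennreal (a k powr q) * (ennreal (q * s powr (- q - 1)) * indicator (?B k) s)) \<partial>lborel)"
    proof (intro nn_integral_mono)
      fix s :: real
      show "?d s * indicator {2 powr - real (Suc n)<..2 powr real n} s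
          \<le> (\<Sum>k\<in>?I. ennreal (a k powr q) * (ennreal (q * s powr (- q - 1)) * indicator (?B k) s))"
      proof (cases "s \<in> {2 powr - real (Suc n)<..2 powr real n}")
        case True
        then have s: "0 < s" by (auto intro: less_trans[rotated])
        define k where "k = \<lceil>log 2 s\<rceil>"
        have log: "- real (Suc n) < log 2 s" "log 2 s \<le> real n"
          using True s by (auto simp: less_log_iff log_le_iff)
        then have k: "k \<in> ?I" unfolding k_def by (auto simp: ceiling_le_iff le_ceiling_iff)
        have "real_of_int k - 1 < log 2 s" "log 2 s \<le> k" unfolding k_def by linarith+
        then have sk: "s \<in> ?B k" "s \<le> 2 powr k"
          using s by (auto simp: less_log_iff log_le_iff)
        have "\<Phi> f s \<le> ennreal (a k)" using monoD[OF mono_\<Phi> sk(2), of f] a by simp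
        then have "epowr (\<Phi> f s) q \<le> ennreal (a k powr q)"
          using q a epowr_mono[of q "\<Phi> f s" "ennreal (a k)"] by (simp add: epowr_ennreal)
        then have "?d s \<le> ennreal (a k powr q) * (ennreal (q * s powr (- q - 1)) * indicator (?B k) s)"
          using sk by (simp add: mult_left_mono mult_right_mono mult.commute)
        also have "\<dots> \<le> (\<Sum>k\<in>?I. ennreal (a k powr q) * (ennreal (q * s powr (- q - 1)) * indicator (?B k) s))"
          using k by (intro member_le_sum) auto
        finally show ?thesis using True by simp
      qed simp
    qed
    also have "\<dots> = (\<Sum>k\<in>?I. ennreal (a k powr q) * (\<integral>\<^sup>+s\<in>?B k. ennreal (q * s powr (- q - 1)) \<partial>lborel))"
      by (subst nn_integral_sum) (auto simp: nn_integral_cmult)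
    also have "\<dots> \<le> (\<Sum>k\<in>?I. ennreal (a k powr q) * ennreal (2 powr q * (2 powr k) powr - q))"
    proof (intro sum_mono mult_left_mono)
      fix k :: int
      have "(\<integral>\<^sup>+s\<in>?B k. ennreal (q * s powr (- q - 1)) \<partial>lborel) = ennreal ((2 powr (real_of_int k - 1)) powr - q - (2 powr k) powr - q)"
        using q by (intro nn_integral_powr_Icc) auto
      also have "\<dots> \<le> ennreal ((2 powr (real_of_int k - 1)) powr - q)" by (intro ennreal_leI) simp
      also have "(2 powr (real_of_int k - 1)) powr - q = 2 powr q * (2 powr k) powr - q"
        by (simp add: powr_powr algebra_simps flip: powr_add)
      finally show "(\<integral>\<^sup>+s\<in>?B k. ennreal (q * s powr (- q - 1)) \<partial>lborel) \<le> ennreal (2 powr q * (2 powr k) powr - q)" .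
    qed simp
    also have "\<dots> = ennreal (2 powr q * (\<Sum>k\<in>?I. (2 powr k) powr - q * a k powr q))"
      unfolding sum_distrib_left
      by (subst sum_ennreal[symmetric]) (auto simp: mult_ac simp flip: ennreal_mult)
    also have "\<dots> \<le> ennreal ((2 * K * A) powr q)"
    proof (intro ennreal_leI)
      let ?Q = "\<Sum>k\<in>?I. (2 powr k) powr - q * a k powr q"
      have Q: "0 \<le> ?Q" by (intro sum_nonneg) auto
      have "ennreal (?Q powr (1 / q)) \<le> ennreal (K * A)"
        using sum_\<Phi>_le_assoc_norm[OF \<theta>1 f, of ?I a] a A K_ge
        by (simp add: q_def ennreal_mult)
      then have "?Q powr (1 / q) \<le> K * A" using A K_ge by (simp add: ennreal_le_iff)
      then have "(?Q powr (1 / q)) powr q \<le> (K * A) powr q" using q by (intro powr_mono2) auto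
      then have "?Q \<le> (K * A) powr q" using Q q by (simp add: powr_powr)
      then have "2 powr q * ?Q \<le> 2 powr q * (K * A) powr q" by (intro mult_left_mono) auto
      also have "\<dots> = (2 * K * A) powr q" using A K_ge by (simp add: powr_mult)
      finally show "2 powr q * ?Q \<le> (2 * K * A) powr q" .
    qed
    finally show ?thesis .
  qed
  have un: "(\<Union>n. {2 powr - real (Suc n)<..2 powr real n}) = {0::real<..}"
  proof (intro equalityI subsetI)
    fix s :: real assume "s \<in> {0<..}"
    then have s: "0 < s" by simp
    obtain n where "\<bar>log 2 s\<bar> < real n" using reals_Archimedean2 by blast
    then have "s \<in> {2 powr - real (Suc n)<..2 powr real n}"
      using s by (auto simp: less_log_iff[symmetric] log_le_iff[symmetric])
    then show "s \<in> (\<Union>n. {2 powr - real (Suc n)<..2 powr real n})" by blast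
  qed (auto intro: less_trans[rotated])
  have "J f q \<le> ennreal ((2 * K * A) powr q)"
    unfolding J_def un[symmetric]
  proof (rule set_nn_integral_UN_le)
    show "incseq (\<lambda>n. {2 powr - real (Suc n)<..2 powr real n})"
    proof (rule incseq_SucI)
      fix n
      have "2 powr - real (Suc (Suc n)) \<le> 2 powr - real (Suc n)" "2 powr real n \<le> 2 powr real (Suc n)"
        by (intro powr_mono; simp)+
      then show "{2 powr - real (Suc n)<..2 powr real n} \<le> {2 powr - real (Suc (Suc n))<..2 powr real (Suc n)}"
        unfolding subset_iff greaterThanAtMost_iff by (meson le_less_trans order_trans)
    qed
  qed (use band in auto)
  then have "epowr (J f q) (1 / q) \<le> epowr (ennreal ((2 * K * A) powr q)) (1 / q)"
    using q by (intro epowr_mono) auto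
  also have "\<dots> = ennreal (2 * K * A)" using q A K_ge by (simp add: epowr_ennreal powr_powr)
  also have "\<dots> = ennreal (2 * K) * assoc_norm p \<theta> \<omega> v f" using A K_ge by (simp add: ennreal_mult)
  finally show ?thesis by (simp add: q_def)
qed

section \<open>Assembly of the two-sided bounds\<close>

lemma equivalence_small_exponent:
  assumes "\<theta> \<le> 1" "f \<in> borel_measurable lebesgue"
  defines "R \<equiv> SUP t\<in>{0<..}. Nfun p v (ball 0 t) f / W t"
  shows "ennreal 1 * R \<le> assoc_norm p \<theta> \<omega> v f"
    "assoc_norm p \<theta> \<omega> v f \<le> ennreal (4 / enn2real \<theta>) * R"
  unfolding R_def using assms
  by (auto intro!: SUP_least Nfun_ball_le_assoc_norm assoc_norm_le_small_exponent)

text \<open>The lower constant adds 2 K for the Stieltjes term and 1 for the whole-space term. The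
  upper constant is that of \<open>assoc_norm_le_J\<close>, since the power 1/\<theta>' is
  subadditive.\<close>

lemma equivalence_large_exponent:
  assumes \<theta>1: "1 < \<theta>" and f: "f \<in> borel_measurable lebesgue"
  defines "R \<equiv> epowr (LS f (conj_exp \<theta>)) (1 / conj_exp \<theta>) + Nfun p v UNIV f / Winf"
  shows "ennreal (1 / (2 * K + 1)) * R \<le> assoc_norm p \<theta> \<omega> v f"
    "assoc_norm p \<theta> \<omega> v f \<le> ennreal 4 * R"
proof -
  let ?A = "assoc_norm p \<theta> \<omega> v f"
  define q where "q = conj_exp \<theta>"
  have q: "1 \<le> q" unfolding q_def by (rule conj_exp_ge_1) fact
  have "epowr (LS f q) (1 / q) \<le> epowr (J f q) (1 / q)"
    using q LS_le_J[OF q f] by (intro epowr_mono) auto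
  also have "\<dots> \<le> ennreal (2 * K) * ?A" unfolding q_def by (rule J_le_assoc_norm[OF \<theta>1 f])
  finally have "R \<le> ennreal (2 * K) * ?A + ?A"
    unfolding R_def q_def[symmetric] using Nfun_UNIV_le_assoc_norm[OF f] by (intro add_mono)
  also have "\<dots> = ennreal (2 * K + 1) * ?A"
    using K_ge by (simp add: ennreal_plus distrib_right)
  finally have "ennreal (1 / (2 * K + 1)) * R \<le> ennreal (1 / (2 * K + 1)) * (ennreal (2 * K + 1) * ?A)"
    by (rule mult_left_mono) simp
  also have "\<dots> = ?A"
  proof -
    have "ennreal (1 / (2 * K + 1)) * ennreal (2 * K + 1) = 1"
      using K_ge by (simp flip: ennreal_mult del: ennreal_plus)
    then show ?thesis by (simp only: mult.assoc[symmetric] mult_1)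
  qed
  finally show "ennreal (1 / (2 * K + 1)) * R \<le> ?A" .
  have "?A \<le> 4 * epowr (J f q) (1 / q)" unfolding q_def by (rule assoc_norm_le_J[OF \<theta>1 f])
  also have "epowr (J f q) (1 / q) \<le> epowr (LS f q + epowr (Nfun p v UNIV f / Winf) q) (1 / q)"
    using q J_le_LS[OF q f] by (intro epowr_mono) auto
  also have "\<dots> \<le> epowr (LS f q) (1 / q) + epowr (epowr (Nfun p v UNIV f / Winf) q) (1 / q)"
    using q by (intro epowr_subadditive) auto
  also have "\<dots> = R" using q by (simp add: epowr_epowr R_def q_def)
  finally show "?A \<le> ennreal 4 * R" by (simp add: mult_left_mono)
qed

end

theorem theorem4p5:
  fixes p :: real and \<theta> :: ennreal and \<omega> :: "real \<Rightarrow> real"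
    and v :: "'a::euclidean_space \<Rightarrow> real"
  assumes p: "1 \<le> p" and \<theta>: "0 < \<theta>"
    and \<omega>: "\<omega> \<in> cOmega \<theta>" and v: "v \<in> Wclass"
  shows
   "(\<theta> \<le> 1 \<longrightarrow>
      (\<exists>c C. 0 < c \<and> 0 < C \<and>
        (\<forall>f \<in> borel_measurable lebesgue.
          let R = (SUP t \<in> {0<..}. Nfun p v (ball 0 t) f / lnorm \<theta> lebesgue {0<..<t} (\<lambda>r. ennreal (\<omega> r)))
          in ennreal c * R \<le> assoc_norm p \<theta> \<omega> v f \<and> assoc_norm p \<theta> \<omega> v f \<le> ennreal C * R))) \<and>
    (1 < \<theta> \<longrightarrow>
      (\<exists>c C. 0 < c \<and> 0 < C \<and>
        (\<forall>f \<in> borel_measurable lebesgue.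
          let \<theta>' = conj_exp \<theta>;
              \<phi> = (\<lambda>t. enn2real (omega_norm_plus \<theta> \<omega> t) powr (- \<theta>'));
              R = epowr (LS_neg_integral \<phi> (\<lambda>t. epowr (Nfun p v (ball 0 t) f) \<theta>')) (1 / \<theta>')
                  + Nfun p v UNIV f / lnorm \<theta> lebesgue {0<..} (\<lambda>r. ennreal (\<omega> r))
          in ennreal c * R \<le> assoc_norm p \<theta> \<omega> v f \<and> assoc_norm p \<theta> \<omega> v f \<le> ennreal C * R)))"
proof -
  interpret complementary_morrey p \<theta> \<omega> v
    using assms by unfold_locales
  show ?thesis
  proof (intro conjI impI)
    assume \<theta>1: "\<theta> \<le> 1"
    then have "\<theta> \<noteq> \<infinity>" by (auto simp: top_unique)
    then have "0 < 4 / enn2real \<theta>" using enn2real_\<theta>_pos by simp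
    with equivalence_small_exponent[OF \<theta>1]
    show "\<exists>c C. 0 < c \<and> 0 < C \<and>
        (\<forall>f \<in> borel_measurable lebesgue.
          let R = (SUP t \<in> {0<..}. Nfun p v (ball 0 t) f / lnorm \<theta> lebesgue {0<..<t} (\<lambda>r. ennreal (\<omega> r)))
          in ennreal c * R \<le> assoc_norm p \<theta> \<omega> v f \<and> assoc_norm p \<theta> \<omega> v f \<le> ennreal C * R)"
      unfolding Let_def W_def by (intro exI[of _ 1] exI[of _ "4 / enn2real \<theta>"]) simp
  next
    assume \<theta>1: "1 < \<theta>"
    have "0 < 1 / (2 * K + 1)" using K_ge by simp
    with equivalence_large_exponent[OF \<theta>1]
    show "\<exists>c C. 0 < c \<and> 0 < C \<and>
        (\<forall>f \<in> borel_measurable lebesgue.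
          let \<theta>' = conj_exp \<theta>;
              \<phi> = (\<lambda>t. enn2real (omega_norm_plus \<theta> \<omega> t) powr (- \<theta>'));
              R = epowr (LS_neg_integral \<phi> (\<lambda>t. epowr (Nfun p v (ball 0 t) f) \<theta>')) (1 / \<theta>')
                  + Nfun p v UNIV f / lnorm \<theta> lebesgue {0<..} (\<lambda>r. ennreal (\<omega> r))
          in ennreal c * R \<le> assoc_norm p \<theta> \<omega> v f \<and> assoc_norm p \<theta> \<omega> v f \<le> ennreal C * R)"
      unfolding Let_def LS_def Winf_def
      by (intro exI[of _ "1 / (2 * K + 1)"] exI[of _ 4]) simp
  qed
qed

end
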